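(* Let $(H,\mathcal V)$ be a controllable LQ optimal control problem on a symplectic vector space $(\Sigma,\omega)$ of dimension $2n$, with Hamiltonian vector field $\vec H$ diagonalizable (over $\mathbb{C}$) and having at least one pure imaginary eigenvalue. Let $E=\bigoplus_{\lambda\text{ pure imaginary}}E_\lambda\subset\Sigma$, a symplectic subspace, and let $2(n-k)=\dim E$. Suppose that in some symplectic (Darboux) coordinates on $E$ the restriction of the Hamiltonian to $E$ can be written as $$H(p,x)=\frac12\sum_{j=1}^{n-k}\omega_j(p_j^2+x_j^2).$$ Then, for every integer $N\ge1$, if $$T\ge\frac{(N+4n-3k-1)\pi}{\sum_{j=1}^{n-k}\omega_j},$$ there are at least $N$ conjugate times, counted with multiplicity, in the interval $(0,T]$. In particular, the first conjugate time $\bar t=\inf\{t>0:J(t)\cap\mathcal V\neq0\}$ satisfies $$\bar t\le\frac{(4n-3k)\pi}{\sum_{j=1}^{n-k}\omega_j}.$$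
   Context: An LQ optimal control problem on a symplectic vector space $(\Sigma,\omega)$, $\dim\Sigma=2n$, is a pair $(H,\mathcal V)$ where $H:\Sigma\to\mathbb{R}$ is a quadratic form and $\mathcal V\subset\Sigma$ is a Lagrangian subspace with $H|_{\mathcal V}\ge 0$. The Hamiltonian vector field $\vec H$ is the linear map defined by $dH(\cdot)=\omega(\cdot,\vec H)$, and its flow is $P_t=e^{t\vec H}$. The Jacobi curve is $J(t)=e^{-t\vec H}\mathcal V$. A number $t\ne0$ is a conjugate time if $J(t)\cap\mathcal V\neq 0$, with multiplicity $\dim(J(t)\cap\mathcal V)$. Controllability: choose Darboux coordinates $(p,x)\in\mathbb{R}^{2n}$ with $\omega=\sum_i dp_i\wedge dx_i$ and $\mathcal V=\{(p,0):p\in\mathbb{R}^n\}$. Then $H(p,x)=\frac12(p^* B B^* p+2p^*Ax+x^*Qx)$ for some real matrices $A$, $B$, $Q=Q^*$, and $\vec H=\begin{pmatrix} -A^* & -Q \\ B B^* & A \end{pmatrix}$. The problem is controllable if there is $m>0$ with $\operatorname{rank}(B,AB,\dots,A^{m-1}B)=n$. A pure imaginary eigenvalue means $\lambda=i\beta$ with $\beta\in\mathbb{R}$, $\beta\ne0$. For an eigenvalue $\lambda$ of $\vec H$, $E_\lambda=E_{\bar\lambda}\subset\Sigma$ is the real $\vec H$-invariant subspace spanned by all $u,v\in\Sigma$ with $u+iv\in\ker(\vec H-\lambda\mathbb{I})^j$ for some $j\ge0$; in the direct sum, each pair $\lambda,\bar\lambda$ is counted once. Symplectic coordinates on $E$ are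 coordinates $(p_1,\dots,p_{n-k},x_1,\dots,x_{n-k})$ in which $\omega|_E=\sum_j dp_j\wedge dx_j$. *)

theory Defs
  imports "HOL-Analysis.Analysis"
begin

section \<open>Symplectic vector spaces and Hamiltonian vector fields\<close>

text \<open>
  A symplectic vector space is a finite-dimensional real vector space, given as a type of class
  \<^class>\<open>euclidean_space\<close>, with a symplectic form on it. The inner product of the type plays no
  role in the definitions; it only supplies the (norm-independent) topology used for derivatives
  and for the exponential series.
\<close>

definition symplectic_form :: "('a::euclidean_space \<Rightarrow> 'a \<Rightarrow> real) \<Rightarrow> bool" where
  "symplectic_form \<omega> \<longleftrightarrow>
     bilinear \<omega> \<and> (\<forall>x. \<omega> x x = 0) \<and> (\<forall>x. (\<forall>y. \<omega> x y = 0) \<longrightarrow> x = 0)"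

definition lagrangian :: "('a::euclidean_space \<Rightarrow> 'a \<Rightarrow> real) \<Rightarrow> 'a set \<Rightarrow> bool" where
  "lagrangian \<omega> V \<longleftrightarrow> subspace V \<and> V = {x. \<forall>y\<in>V. \<omega> x y = 0}"

definition quadratic_form :: "('a::euclidean_space \<Rightarrow> real) \<Rightarrow> bool" where
  "quadratic_form H \<longleftrightarrow> (\<exists>b. bilinear b \<and> (\<forall>x. H x = b x x))"

definition hamiltonian_vf ::
  "('a::euclidean_space \<Rightarrow> 'a \<Rightarrow> real) \<Rightarrow> ('a \<Rightarrow> real) \<Rightarrow> 'a \<Rightarrow> 'a" where
  "hamiltonian_vf \<omega> H = (THE F. \<forall>x. (H has_derivative (\<lambda>v. \<omega> v (F x))) (at x))"

text \<open>The description above is proper for a quadratic form on a symplectic vector space.\<close>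

lemma symplectic_form_represents:
  fixes \<omega> :: "'a::euclidean_space \<Rightarrow> 'a \<Rightarrow> real"
  assumes \<omega>: "symplectic_form \<omega>" and f: "linear f"
  shows "\<exists>!y. \<forall>v. f v = \<omega> v y"
proof -
  have bil: "bilinear \<omega>" and alt: "\<And>x. \<omega> x x = 0"
    and nd: "\<And>x. (\<And>y. \<omega> x y = 0) \<Longrightarrow> x = 0"
    using \<omega> by (auto simp: symplectic_form_def)
  have linl: "linear (\<lambda>x. \<omega> x y)" and linr: "linear (\<omega> x)" for x y
    using bil by (auto simp: bilinear_def)
  have skew: "\<omega> x y = - \<omega> y x" for x y
    using alt[of "x + y"] alt[of x] alt[of y]
    by (simp add: bilinear_ladd[OF bil] bilinear_radd[OF bil])
  have nd': "y = 0" if "\<And>v. \<omega> v y = 0" for y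
    using nd[of y] skew[of y] that by simp
  define L where "L = (\<lambda>y. \<Sum>b\<in>Basis. \<omega> b y *\<^sub>R b)"
  have L: "L y \<bullet> b = \<omega> b y" if "b \<in> Basis" for y b
    using that by (simp add: L_def inner_sum_left inner_Basis if_distrib cong: if_cong)
  have ext: "g = h" if "linear g" "linear h" "\<And>b. b \<in> Basis \<Longrightarrow> g b = h b"
    for g h :: "'a \<Rightarrow> real"
    using that by (metis linear_eq_stdbasis)
  have "linear L"
    unfolding L_def
    by (intro linearI)
      (simp_all add: linear_add[OF linr] linear_scale[OF linr] scaleR_add_left sum.distrib
        scaleR_sum_right)
  moreover have "inj L"
    unfolding linear_injective_0[OF \<open>linear L\<close>]
  proof (intro allI impI)
    fix y assume "L y = 0"
    then have "\<omega> b y = 0" if "b \<in> Basis" for b using L[OF that, of y] by simp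
    then have "(\<lambda>v. \<omega> v y) = (\<lambda>v. 0)"
      by (intro ext linl module_hom_zero) auto
    then show "y = 0" by (intro nd') meson
  qed
  ultimately have "surj L" by (simp add: linear_injective_imp_surjective)
  then obtain y where y: "L y = (\<Sum>b\<in>Basis. f b *\<^sub>R b)" by (metis surjD)
  have "f b = \<omega> b y" if "b \<in> Basis" for b
    using L[OF that, of y] that
    by (simp add: y inner_sum_left inner_Basis if_distrib cong: if_cong)
  then have fy: "f = (\<lambda>v. \<omega> v y)"
    by (intro ext f linl) auto
  show ?thesis
  proof (rule ex1I[of _ y])
    show "\<forall>v. f v = \<omega> v y" by (simp add: fy)
  next
    fix z assume "\<forall>v. f v = \<omega> v z"
    then have "\<omega> v (z - y) = 0" for v by (simp add: fy linear_diff[OF linr])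
    then have "z - y = 0" by (rule nd')
    then show "z = y" by simp
  qed
qed

lemma hamiltonian_vf_has_derivative:
  fixes \<omega> :: "'a::euclidean_space \<Rightarrow> 'a \<Rightarrow> real"
  assumes \<omega>: "symplectic_form \<omega>" and H: "quadratic_form H"
  shows "(H has_derivative (\<lambda>v. \<omega> v (hamiltonian_vf \<omega> H x))) (at x)"
proof -
  obtain b where b: "bilinear b" "H = (\<lambda>x. b x x)"
    using H by (auto simp: quadratic_form_def)
  interpret b: bounded_bilinear b
    using b(1) bilinear_conv_bounded_bilinear by blast
  have der: "(H has_derivative (\<lambda>v. b x v + b v x)) (at x)" for x
    unfolding b(2) by (rule b.FDERIV) (auto intro!: derivative_eq_intros)
  have "\<exists>!y. \<forall>v. b x v + b v x = \<omega> v y" for x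
    by (intro symplectic_form_represents[OF \<omega>] linearI)
      (simp_all add: b.add_left b.add_right b.scaleR_left b.scaleR_right algebra_simps)
  then obtain F where F: "\<And>x v. b x v + b v x = \<omega> v (F x)"
    and uniq: "\<And>x y. (\<And>v. b x v + b v x = \<omega> v y) \<Longrightarrow> y = F x"
    by metis
  have "\<forall>x. (H has_derivative (\<lambda>v. \<omega> v (hamiltonian_vf \<omega> H x))) (at x)"
    unfolding hamiltonian_vf_def
  proof (rule theI[of _ F])
    show "\<forall>x. (H has_derivative (\<lambda>v. \<omega> v (F x))) (at x)" using der F by simp
  next
    fix G assume G: "\<forall>x. (H has_derivative (\<lambda>v. \<omega> v (G x))) (at x)"
    show "G = F"
    proof
      fix x
      have "(\<lambda>v. b x v + b v x) = (\<lambda>v. \<omega> v (G x))"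
        using der G has_derivative_unique by blast
      then show "G x = F x" by (intro uniq) meson
    qed
  qed
  then show ?thesis by blast
qed

definition lin_exp :: "('a::euclidean_space \<Rightarrow> 'a) \<Rightarrow> 'a \<Rightarrow> 'a" where
  "lin_exp F x = (\<Sum>k. (F ^^ k) x /\<^sub>R fact k)"


section \<open>LQ problems, Jacobi curves and conjugate times\<close>

definition lq_problem ::
  "('a::euclidean_space \<Rightarrow> 'a \<Rightarrow> real) \<Rightarrow> ('a \<Rightarrow> real) \<Rightarrow> 'a set \<Rightarrow> bool" where
  "lq_problem \<omega> H V \<longleftrightarrow>
     symplectic_form \<omega> \<and> quadratic_form H \<and> lagrangian \<omega> V \<and> (\<forall>v\<in>V. H v \<ge> 0)"

definition jacobi_curve ::
  "('a::euclidean_space \<Rightarrow> 'a \<Rightarrow> real) \<Rightarrow> ('a \<Rightarrow> real) \<Rightarrow> 'a set \<Rightarrow> real \<Rightarrow> 'a set" where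
  "jacobi_curve \<omega> H V t = lin_exp (\<lambda>x. (- t) *\<^sub>R hamiltonian_vf \<omega> H x) ` V"

definition conjugate_time ::
  "('a::euclidean_space \<Rightarrow> 'a \<Rightarrow> real) \<Rightarrow> ('a \<Rightarrow> real) \<Rightarrow> 'a set \<Rightarrow> real \<Rightarrow> bool" where
  "conjugate_time \<omega> H V t \<longleftrightarrow> t \<noteq> 0 \<and> jacobi_curve \<omega> H V t \<inter> V \<noteq> {0}"

definition conj_multiplicity ::
  "('a::euclidean_space \<Rightarrow> 'a \<Rightarrow> real) \<Rightarrow> ('a \<Rightarrow> real) \<Rightarrow> 'a set \<Rightarrow> real \<Rightarrow> nat" where
  "conj_multiplicity \<omega> H V t = dim (jacobi_curve \<omega> H V t \<inter> V)"

text \<open>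
  Number of conjugate times in $(0,T]$, with multiplicity. Taking the supremum over finite sets
  gives the right value (infinity) should there be infinitely many of them.
\<close>

definition num_conjugate_times ::
  "('a::euclidean_space \<Rightarrow> 'a \<Rightarrow> real) \<Rightarrow> ('a \<Rightarrow> real) \<Rightarrow> 'a set \<Rightarrow> real \<Rightarrow> enat" where
  "num_conjugate_times \<omega> H V T =
     (SUP S \<in> {S. finite S \<and> S \<subseteq> {t. 0 < t \<and> t \<le> T \<and> conjugate_time \<omega> H V t}}.
        enat (\<Sum>t\<in>S. conj_multiplicity \<omega> H V t))"

text \<open>Extended-real valued, so that the infimum of the empty set is infinity.\<close>

definition first_conjugate_time ::
  "('a::euclidean_space \<Rightarrow> 'a \<Rightarrow> real) \<Rightarrow> ('a \<Rightarrow> real) \<Rightarrow> 'a set \<Rightarrow> ereal" where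
  "first_conjugate_time \<omega> H V = (INF t \<in> {t. t > 0 \<and> conjugate_time \<omega> H V t}. ereal t)"


section \<open>Darboux coordinates and controllability\<close>

text \<open>
  Coordinates $(p,x)$ on a subspace \<open>E\<close> are given by the parametrization \<open>\<phi>\<close> sending a coordinate
  pair to the vector it describes; the last clause says $\omega|_E = \sum_j dp_j\wedge dx_j$.
\<close>

definition darboux_coords ::
  "('a::euclidean_space \<Rightarrow> 'a \<Rightarrow> real) \<Rightarrow> 'a set \<Rightarrow> ((real^'d) \<times> (real^'d) \<Rightarrow> 'a) \<Rightarrow> bool" where
  "darboux_coords \<omega> E \<phi> \<longleftrightarrow>
     linear \<phi> \<and> bij_betw \<phi> UNIV E \<and>
     (\<forall>p x p' x'. \<omega> (\<phi> (p, x)) (\<phi> (p', x')) =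
        (\<Sum>j\<in>UNIV. p $ j * x' $ j - x $ j * p' $ j))"

text \<open>
  The block matrix $(B, AB, \dots, A^{m-1}B)$ is not formed as a matrix, since its number of columns
  would have to be a type depending on \<open>m\<close>; its rank is written out as the dimension of the
  span of its columns.
\<close>

definition kalman_condition :: "real^'n^'n \<Rightarrow> real^'r^'n \<Rightarrow> bool" where
  "kalman_condition A B \<longleftrightarrow>
     (\<exists>m>0. dim (\<Union>i<m. columns (((\<lambda>M. A ** M) ^^ i) B)) = CARD('n))"

text \<open>
  \<open>controllable_in \<omega> H V \<phi> A B Q\<close>: in the Darboux coordinates \<open>\<phi>\<close>, adapted to \<open>V\<close>, the Hamiltonian
  has matrices \<open>A\<close>, \<open>B\<close>, \<open>Q\<close>, and these satisfy the rank condition. Whether the rank condition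
  holds does not depend on the choice of \<open>\<phi>\<close>, \<open>A\<close>, \<open>B\<close>, \<open>Q\<close>.
\<close>

definition controllable_in ::
  "('a::euclidean_space \<Rightarrow> 'a \<Rightarrow> real) \<Rightarrow> ('a \<Rightarrow> real) \<Rightarrow> 'a set \<Rightarrow>
   ((real^'n) \<times> (real^'n) \<Rightarrow> 'a) \<Rightarrow> real^'n^'n \<Rightarrow> real^'r^'n \<Rightarrow> real^'n^'n \<Rightarrow> bool" where
  "controllable_in \<omega> H V \<phi> A B Q \<longleftrightarrow>
     darboux_coords \<omega> UNIV \<phi> \<and> V = {\<phi> (p, 0) |p. True} \<and> transpose Q = Q \<and>
     (\<forall>p x. H (\<phi> (p, x)) =
        1/2 * (p \<bullet> ((B ** transpose B) *v p) + 2 * (p \<bullet> (A *v x)) + x \<bullet> (Q *v x))) \<and>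
     kalman_condition A B"


section \<open>Complex spectrum of a real linear map\<close>

text \<open>
  The complexification of \<open>'a\<close> is \<open>'a \<times> 'a\<close>, where the pair \<open>(u, v)\<close> stands for $u + iv$.
\<close>

definition cscale :: "complex \<Rightarrow> 'a::real_vector \<times> 'a \<Rightarrow> 'a \<times> 'a" where
  "cscale c w = (Re c *\<^sub>R fst w - Im c *\<^sub>R snd w, Im c *\<^sub>R fst w + Re c *\<^sub>R snd w)"

global_interpretation cplx: vector_space cscale
  by unfold_locales (auto simp: cscale_def prod_eq_iff algebra_simps)

definition clift :: "('a \<Rightarrow> 'a) \<Rightarrow> 'a \<times> 'a \<Rightarrow> 'a \<times> 'a" where
  "clift F w = (F (fst w), F (snd w))"

definition ceigenvalue :: "('a::real_vector \<Rightarrow> 'a) \<Rightarrow> complex \<Rightarrow> bool" where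
  "ceigenvalue F l \<longleftrightarrow> (\<exists>w. w \<noteq> 0 \<and> clift F w = cscale l w)"

definition cdiagonalizable :: "('a::real_vector \<Rightarrow> 'a) \<Rightarrow> bool" where
  "cdiagonalizable F \<longleftrightarrow>
     (\<exists>S. cplx.independent S \<and> cplx.span S = UNIV \<and> (\<forall>w\<in>S. \<exists>l. clift F w = cscale l w))"

definition pure_imaginary :: "complex \<Rightarrow> bool" where
  "pure_imaginary l \<longleftrightarrow> (\<exists>\<beta>::real. \<beta> \<noteq> 0 \<and> l = \<i> * of_real \<beta>)"

definition real_gen_eigenspace :: "('a::real_vector \<Rightarrow> 'a) \<Rightarrow> complex \<Rightarrow> 'a set" where
  "real_gen_eigenspace F l =
     span (\<Union>{{u, v} |u v. \<exists>j. ((\<lambda>w. clift F w - cscale l w) ^^ j) (u, v) = 0})"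

text \<open>
  The direct sum of the \<open>real_gen_eigenspace F l\<close>, each conjugate pair counted once, is the span
  of their union, as conjugate eigenvalues give the same subspace.
\<close>

definition imaginary_subspace :: "('a::real_vector \<Rightarrow> 'a) \<Rightarrow> 'a set" where
  "imaginary_subspace F =
     span (\<Union>l\<in>{l. ceigenvalue F l \<and> pure_imaginary l}. real_gen_eigenspace F l)"

end

theory Submission
  imports Defs "HOL-Computational_Algebra.Fundamental_Theorem_Algebra"
begin

text \<open>
  The skew-orthogonal complement of the imaginary subspace \<open>E\<close> contains an invariant Lagrangian subspace
  \<open>L\<close>; by controllability \<open>L\<close> is transversal to \<open>V\<close>. The symplectic reduction of \<open>V\<close> by \<open>L\<close> is a
  Lagrangian subspace of \<open>E\<close>, on which the Hamiltonian is nonnegative and has trace half the sum of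
  the frequencies, whence that sum is positive.

  Let \<open>K\<close> be the sum of \<open>L\<close> and a coordinate Lagrangian of \<open>E\<close>, rotated to be transversal to \<open>V\<close>,
  and let \<open>S(v + l) = \<omega>(v, l)\<close> for \<open>v\<close> in \<open>V\<close> and \<open>l\<close> in \<open>K\<close>. The kernel of the quadratic form
  \<open>S - S \<circ> P\<^sub>t\<close> is the sum of \<open>V \<inter> J(t)\<close> and of the vectors of \<open>K\<close> that the flow returns to \<open>K\<close>.
  The latter exceed a constant subspace containing \<open>L\<close> only at explicit times, when the form moves
  on them with the signs of the frequencies. As the negative index of the form stays between 0 and
  \<open>dim \<Sigma> - dim L\<close>, the drift of the index caused by \<open>K\<close> must be compensated by conjugate times.
\<close>

section \<open>Negative index of a symmetric form\<close>

text \<open>Put d = CARD('d), so that d = n - k, dim L = k and 4n - 3k = 4d + k. The index has room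
  2d + k. The crossings of \<open>K\<close> caused by one frequency up to time T number |omega_j| T
  / pi rounded down, so rounding costs less than d in all. The conjugate multiplicities up to T
  therefore add up to more than T * (sum of omega_j) / pi - 3d - k, and d >= 1 turns this into the
  stated bound. Single frequencies may have either sign, so crossings of \<open>K\<close> move the
  index both ways and only the sum is controlled. On \<open>V \<inter> J(t)\<close> the derivative
  of the form is -4H, which is merely semidefinite; hence the change of index at a conjugate time is
  not computed, and the whole multiplicity is charged as a possible increase. Controllability is
  used in the form that \<open>V\<close> contains no nonzero invariant subspace. At a vector of
  \<open>V\<close> where H vanishes, semidefiniteness forces the field to point into
  \<open>V\<close>; this yields both the transversality of \<open>L\<close> and the positivity of
  the sum.\<close>

definition neg_def_on :: "('a::euclidean_space \<Rightarrow> 'a \<Rightarrow> real) \<Rightarrow> 'a set \<Rightarrow> bool" where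
  "neg_def_on b W \<longleftrightarrow> subspace W \<and> (\<forall>x\<in>W. x \<noteq> 0 \<longrightarrow> b x x < 0)"

definition neg_index :: "('a::euclidean_space \<Rightarrow> 'a \<Rightarrow> real) \<Rightarrow> nat" where
  "neg_index b = Max (dim ` {W. neg_def_on b W})"

definition radical :: "('a::euclidean_space \<Rightarrow> 'a \<Rightarrow> real) \<Rightarrow> 'a set" where
  "radical b = {x. \<forall>y. b x y = 0}"

lemma finite_neg_def_dims: "finite (dim ` {W. neg_def_on (b :: 'a::euclidean_space \<Rightarrow> _) W})"
  by (rule finite_subset[of _ "{..DIM('a)}"]) (auto simp: dim_subset_UNIV)

lemma dim_le_neg_index: "neg_def_on b W \<Longrightarrow> dim W \<le> neg_index b"
  unfolding neg_index_def by (rule Max_ge[OF finite_neg_def_dims]) auto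

lemma neg_index_attained: "\<exists>W. neg_def_on b W \<and> dim W = neg_index b"
proof -
  have "neg_def_on b {0}" by (auto simp: neg_def_on_def)
  then have "dim ` {W. neg_def_on b W} \<noteq> {}" by auto
  from Max_in[OF finite_neg_def_dims this] show ?thesis
    unfolding neg_index_def by auto
qed

lemma dim_le_codim:
  fixes S T :: "'a::euclidean_space set"
  assumes "subspace S" "subspace T" "S \<inter> T \<subseteq> {0}"
  shows "dim S + dim T \<le> DIM('a)"
proof -
  have "dim {x + y |x y. x \<in> S \<and> y \<in> T} + dim (S \<inter> T) = dim S + dim T"
    by (rule dim_sums_Int) (use assms in auto)
  moreover have "dim (S \<inter> T) = 0" using assms(3) by (simp add: dim_eq_0)
  ultimately show ?thesis using dim_subset_UNIV[of "{x + y |x y. x \<in> S \<and> y \<in> T}"] by simp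
qed

lemma dim_direct_sum:
  fixes S T :: "'a::euclidean_space set"
  assumes "subspace S" "subspace T" "S \<inter> T \<subseteq> {0}"
  shows "dim {x + y |x y. x \<in> S \<and> y \<in> T} = dim S + dim T"
proof -
  have "dim {x + y |x y. x \<in> S \<and> y \<in> T} + dim (S \<inter> T) = dim S + dim T"
    by (rule dim_sums_Int) (use assms in auto)
  moreover have "dim (S \<inter> T) = 0" using assms(3) by (simp add: dim_eq_0)
  ultimately show ?thesis by simp
qed

lemma dim_Int_ge:
  fixes S T :: "'a::euclidean_space set"
  assumes "subspace S" "subspace T"
  shows "dim S + dim T \<le> dim (S \<inter> T) + DIM('a)"
  using dim_sums_Int[OF assms] dim_subset_UNIV[of "{x + y |x y. x \<in> S \<and> y \<in> T}"] by simp

text \<open>A negative definite subspace meets \<open>P\<close> only in 0. Every upper bound for the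
  index below is obtained by exhibiting such a \<open>P\<close>.\<close>

lemma neg_index_le:
  fixes b :: "'a::euclidean_space \<Rightarrow> 'a \<Rightarrow> real"
  assumes "subspace P" "\<And>x. x \<in> P \<Longrightarrow> b x x \<ge> 0"
  shows "neg_index b + dim P \<le> DIM('a)"
proof -
  obtain W where W: "neg_def_on b W" "dim W = neg_index b" using neg_index_attained by blast
  have "W \<inter> P \<subseteq> {0}" using W(1) assms(2) by (fastforce simp: neg_def_on_def)
  then show ?thesis using dim_le_codim[of W P] W assms(1) by (simp add: neg_def_on_def)
qed

lemma bilinear_inner_rep:
  fixes b :: "'a::euclidean_space \<Rightarrow> 'a \<Rightarrow> real"
  assumes "bilinear b"
  obtains T where "linear T" "\<And>x y. b x y = T x \<bullet> y"
proof -
  have linl: "linear (\<lambda>x. b x y)" and linr: "linear (b x)" for x y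
    using assms by (auto simp: bilinear_def)
  define T where "T = (\<lambda>x. \<Sum>e\<in>Basis. b x e *\<^sub>R e)"
  have "linear T"
    unfolding T_def
    by (intro linearI)
      (simp_all add: linear_add[OF linl] linear_scale[OF linl] scaleR_add_left sum.distrib
        scaleR_sum_right)
  moreover have "b x y = T x \<bullet> y" for x y
  proof -
    have "b x y = b x (\<Sum>e\<in>Basis. (y \<bullet> e) *\<^sub>R e)" by (simp add: euclidean_representation)
    also have "\<dots> = (\<Sum>e\<in>Basis. (y \<bullet> e) * b x e)"
      by (simp add: linear_sum[OF linr] linear_scale[OF linr])
    also have "\<dots> = T x \<bullet> y"
      by (simp add: T_def inner_sum_left inner_commute[of y] mult.commute)
    finally show ?thesis .
  qed
  ultimately show thesis using that by blast
qed

lemma subspace_annihilator: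
  assumes "bilinear b"
  shows "subspace {y. \<forall>w\<in>W. b w y = 0}"
  using assms by (auto simp: subspace_def bilinear_radd bilinear_rmul bilinear_rzero)

text \<open>Writing \<open>b x y = T x \<bullet> y\<close>, the annihilator of \<open>W\<close> is
  the orthogonal complement of the image of \<open>W\<close> under \<open>T\<close>; this image has
  at most the dimension of \<open>W\<close>, and the same dimension if the radical is
  trivial.\<close>

lemma dim_annihilator:
  fixes b :: "'a::euclidean_space \<Rightarrow> 'a \<Rightarrow> real"
  assumes b: "bilinear b" and W: "subspace W"
  shows "DIM('a) \<le> dim {y. \<forall>w\<in>W. b w y = 0} + dim W"
    and "(\<And>x. x \<in> radical b \<Longrightarrow> x = 0) \<Longrightarrow> dim {y. \<forall>w\<in>W. b w y = 0} + dim W = DIM('a)"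
proof -
  obtain T where T: "linear T" "\<And>x y. b x y = T x \<bullet> y" using bilinear_inner_rep[OF b] by blast
  have "dim {y \<in> UNIV. \<forall>x\<in>T ` W. orthogonal x y} + dim (T ` W) = dim (UNIV :: 'a set)"
    by (rule dim_subspace_orthogonal_to_vectors)
      (use linear_subspace_image[OF T(1) W] in auto)
  moreover have "{y \<in> UNIV. \<forall>x\<in>T ` W. orthogonal x y} = {y. \<forall>w\<in>W. b w y = 0}"
    by (auto simp: T orthogonal_def)
  ultimately have eq: "dim {y. \<forall>w\<in>W. b w y = 0} + dim (T ` W) = DIM('a)" by simp
  then show "DIM('a) \<le> dim {y. \<forall>w\<in>W. b w y = 0} + dim W"
    using dim_image_le[OF T(1), of W] by simp
  assume "\<And>x. x \<in> radical b \<Longrightarrow> x = 0"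
  then have "inj T"
    unfolding linear_injective_0[OF T(1)] by (auto simp: radical_def T)
  then show "dim {y. \<forall>w\<in>W. b w y = 0} + dim W = DIM('a)"
    using eq dim_image_eq[OF T(1), of W] by (simp add: inj_on_subset)
qed

text \<open>If \<open>b x y\<close> were nonzero, the value of \<open>b\<close> along the line
  \<open>c *\<^sub>R x + y\<close> would be a nonconstant affine function of \<open>c\<close>, hence
  negative somewhere.\<close>

lemma semidefinite_null:
  fixes b :: "'a::real_vector \<Rightarrow> 'a \<Rightarrow> real"
  assumes b: "bilinear b" and sym: "b y x = b x y"
    and W: "subspace W" and nn: "\<And>z. z \<in> W \<Longrightarrow> b z z \<ge> 0"
    and x: "x \<in> W" "b x x = 0" and y: "y \<in> W"
  shows "b x y = 0"
proof (rule ccontr)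
  assume ne: "b x y \<noteq> 0"
  \<comment> \<open>Solves \<open>2 * c * b x y + b y y = - 1\<close>.\<close>
  define c where "c = - (b y y + 1) / (2 * b x y)"
  have "b (c *\<^sub>R x + y) (c *\<^sub>R x + y) = c * c * b x x + 2 * c * b x y + b y y"
    using sym by (simp add: bilinear_ladd[OF b] bilinear_radd[OF b] bilinear_lmul[OF b]
      bilinear_rmul[OF b] algebra_simps)
  also have "\<dots> = -1" using ne x by (simp add: c_def field_simps)
  finally show False
    using nn[of "c *\<^sub>R x + y"] W x y by (simp add: subspace_add subspace_scale)
qed

text \<open>Half of Sylvester's law of inertia. For a maximal negative definite \<open>W\<close>,
  the form is nonnegative on the annihilator \<open>A\<close> of \<open>W\<close>, as a negative
  vector of \<open>A\<close> would enlarge \<open>W\<close>. Its null vectors in \<open>A\<close>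
  then lie in the radical, and \<open>P\<close> is a complement of the radical in
  \<open>A\<close>.\<close>

lemma positive_complement:
  fixes b :: "'a::euclidean_space \<Rightarrow> 'a \<Rightarrow> real"
  assumes b: "bilinear b" and sym: "\<And>x y. b x y = b y x"
  obtains P where "subspace P" "\<And>x. x \<in> P \<Longrightarrow> x \<noteq> 0 \<Longrightarrow> b x x > 0"
    "DIM('a) \<le> neg_index b + dim (radical b) + dim P"
proof -
  obtain W where W: "neg_def_on b W" "dim W = neg_index b" using neg_index_attained by blast
  have sW: "subspace W" and neg: "\<And>x. x \<in> W \<Longrightarrow> x \<noteq> 0 \<Longrightarrow> b x x < 0"
    using W(1) by (auto simp: neg_def_on_def)
  define A where "A = {y. \<forall>w\<in>W. b w y = 0}"
  note bs = bilinear_ladd[OF b] bilinear_radd[OF b] bilinear_lmul[OF b] bilinear_rmul[OF b]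
  have sA: "subspace A" unfolding A_def by (rule subspace_annihilator[OF b])
  have dA: "DIM('a) \<le> dim A + dim W" unfolding A_def by (rule dim_annihilator(1)[OF b sW])
  have WA: "W \<inter> A \<subseteq> {0}" using neg unfolding A_def by fastforce
  define Z where "Z = {x + y |x y. x \<in> W \<and> y \<in> A}"
  have "dim Z = DIM('a)"
    using dim_direct_sum[OF sW sA WA] dim_le_codim[OF sW sA WA] dA by (simp add: Z_def)
  moreover have "subspace Z" unfolding Z_def by (rule subspace_sums[OF sW sA])
  ultimately have WAU: "Z = UNIV" using dim_eq_full[of Z] span_eq_iff[of Z] by metis
  have nnA: "b y y \<ge> 0" if y: "y \<in> A" for y
  proof (rule ccontr)
    assume "\<not> b y y \<ge> 0"
    then have yy: "b y y < 0" by simp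
    then have y0: "y \<noteq> 0" using bilinear_lzero[OF b] by auto
    have ynW: "y \<notin> W" using WA y y0 by auto
    let ?W = "{x + z |x z. x \<in> W \<and> z \<in> span {y}}"
    have "neg_def_on b ?W"
      unfolding neg_def_on_def
    proof (intro conjI ballI impI)
      show "subspace ?W" by (intro subspace_sums sW subspace_span)
      fix z assume "z \<in> ?W" "z \<noteq> 0"
      then obtain x c where z: "x \<in> W" "z = x + c *\<^sub>R y" by (auto simp: span_singleton)
      have "b x y = 0" "b y x = 0" using y z sym by (auto simp: A_def)
      then have e: "b z z = b x x + c * c * b y y" by (simp add: z bs algebra_simps)
      show "b z z < 0"
      proof (cases "c = 0")
        case True
        then show ?thesis using neg[of x] z \<open>z \<noteq> 0\<close> by simp
      next
        case False
        then have "0 < c * c" by (metis not_real_square_gt_zero)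
        then have "c * c * b y y < 0" using yy by (rule mult_pos_neg)
        moreover have "b x x \<le> 0" using neg[of x] z bilinear_lzero[OF b] by (cases "x = 0") auto
        ultimately show ?thesis using e by simp
      qed
    qed
    from dim_le_neg_index[OF this] have "dim ?W \<le> dim W" using W(2) by simp
    moreover have "dim ?W = dim W + dim (span {y})"
    proof (intro dim_direct_sum sW subspace_span)
      show "W \<inter> span {y} \<subseteq> {0}"
      proof safe
        fix x assume "x \<in> W" "x \<in> span {y}"
        then obtain c where c: "x = c *\<^sub>R y" by (auto simp: span_singleton)
        then have "x \<in> A" using sA y by (simp add: subspace_scale)
        then show "x = 0" using WA \<open>x \<in> W\<close> by auto
      qed
    qed
    ultimately show False using y0 by (simp add: dim_span)
  qed
  have rad: "y \<in> radical b" if y: "y \<in> A" "b y y = 0" for y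
  proof -
    have "b y z = 0" for z
    proof -
      obtain w a where z: "z = w + a" "w \<in> W" "a \<in> A" using WAU unfolding Z_def by blast
      have "b y a = 0" by (rule semidefinite_null[OF b sym sA nnA y z(3)])
      moreover have "b y w = 0" using y z sym by (auto simp: A_def)
      ultimately show ?thesis by (simp add: z bs)
    qed
    then show ?thesis by (simp add: radical_def)
  qed
  have sR: "subspace (radical b)"
    by (auto simp: radical_def subspace_def bs bilinear_lzero[OF b])
  have RA: "radical b \<subseteq> A" using sym by (auto simp: radical_def A_def)
  define P where "P = {y \<in> A. \<forall>x\<in>radical b. orthogonal x y}"
  have "dim P + dim (radical b) = dim A"
    unfolding P_def by (rule dim_subspace_orthogonal_to_vectors[OF sR sA RA])
  then have "DIM('a) \<le> neg_index b + dim (radical b) + dim P" using dA W by simp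
  moreover have "subspace P"
    using sA by (auto simp: P_def subspace_def orthogonal_clauses)
  moreover have "b x x > 0" if "x \<in> P" "x \<noteq> 0" for x
  proof -
    have "x \<notin> radical b" using that by (auto simp: P_def orthogonal_self)
    then show ?thesis using nnA[of x] rad[of x] that by (force simp: P_def)
  qed
  ultimately show thesis using that by blast
qed

section \<open>One-sided changes of the index in a differentiable family of forms\<close>

lemma bilinear_abs_le:
  fixes b :: "'a::euclidean_space \<Rightarrow> 'a \<Rightarrow> real"
  assumes b: "bilinear b"
  shows "\<bar>b x y\<bar> \<le> (\<Sum>i\<in>Basis. \<Sum>j\<in>Basis. \<bar>b i j\<bar>) * norm x * norm y"
proof -
  have linl: "linear (\<lambda>x. b x y)" and linr: "linear (b x)" for x y
    using b by (auto simp: bilinear_def)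
  have "b x y = b (\<Sum>i\<in>Basis. (x \<bullet> i) *\<^sub>R i) (\<Sum>j\<in>Basis. (y \<bullet> j) *\<^sub>R j)"
    by (simp add: euclidean_representation)
  also have "\<dots> = (\<Sum>i\<in>Basis. \<Sum>j\<in>Basis. (x \<bullet> i) * ((y \<bullet> j) * b i j))"
    by (simp add: linear_sum[OF linl] linear_sum[OF linr] linear_scale[OF linl]
      linear_scale[OF linr] sum_distrib_left, subst sum.swap, simp add: mult_ac)
  finally have "\<bar>b x y\<bar> \<le> (\<Sum>i\<in>Basis. \<Sum>j\<in>Basis. \<bar>(x \<bullet> i) * ((y \<bullet> j) * b i j)\<bar>)"
    by (auto intro!: order_trans[OF sum_abs] sum_mono)
  also have "\<dots> \<le> (\<Sum>i\<in>Basis. \<Sum>j\<in>Basis. norm x * (norm y * \<bar>b i j\<bar>))"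
    by (intro sum_mono) (auto simp: abs_mult Basis_le_norm intro!: mult_mono)
  also have "\<dots> = (\<Sum>i\<in>Basis. \<Sum>j\<in>Basis. \<bar>b i j\<bar>) * norm x * norm y"
    by (simp add: sum_distrib_left sum_distrib_right mult_ac)
  finally show ?thesis .
qed

lemma definite_lower_bound:
  fixes b :: "'a::euclidean_space \<Rightarrow> 'a \<Rightarrow> real"
  assumes b: "bilinear b" and X: "subspace X" and pos: "\<And>x. x \<in> X \<Longrightarrow> x \<noteq> 0 \<Longrightarrow> b x x > 0"
  obtains c where "c > 0" "\<And>x. x \<in> X \<Longrightarrow> b x x \<ge> c * (norm x)\<^sup>2"
proof (cases "X \<inter> sphere 0 1 = {}")
  case True
  have "X \<subseteq> {0}"
  proof (rule ccontr)
    assume "\<not> X \<subseteq> {0}"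
    then obtain x where x: "x \<in> X" "x \<noteq> 0" by auto
    then have "x /\<^sub>R norm x \<in> X \<inter> sphere 0 1" using X by (simp add: subspace_scale)
    with True show False by auto
  qed
  then show thesis using that[of 1] bilinear_lzero[OF b] by fastforce
next
  case False
  have "compact (X \<inter> sphere 0 1)"
    by (simp add: closed_Int_compact closed_subspace X)
  moreover have "continuous_on (X \<inter> sphere 0 1) (\<lambda>x. b x x)"
    by (intro bilinear_continuous_on_compose[OF _ _ b] continuous_on_id)
  ultimately obtain u where u: "u \<in> X \<inter> sphere 0 1" "\<And>x. x \<in> X \<inter> sphere 0 1 \<Longrightarrow> b u u \<le> b x x"
    using continuous_attains_inf[OF _ False] by blast
  show thesis
  proof (rule that[of "b u u"])
    show "b u u > 0" using u(1) by (intro pos) auto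
    fix x assume x: "x \<in> X"
    show "b u u * (norm x)\<^sup>2 \<le> b x x"
    proof (cases "x = 0")
      case False
      then have "b u u \<le> b (x /\<^sub>R norm x) (x /\<^sub>R norm x)"
        by (intro u(2)) (use x X in \<open>simp add: subspace_scale\<close>)
      also have "\<dots> = b x x / (norm x)\<^sup>2"
        by (simp add: bilinear_lmul[OF b] bilinear_rmul[OF b] power2_eq_square divide_inverse)
      finally show ?thesis using False by (simp add: field_simps)
    qed (simp add: bilinear_lzero[OF b])
  qed
qed

lemma quadratic_pos:
  fixes \<alpha> \<beta> \<gamma> :: real
  assumes "\<alpha> > 0" "\<gamma>\<^sup>2 < \<alpha> * \<beta>" "X \<noteq> 0 \<or> Y \<noteq> 0"
  shows "\<alpha> * X\<^sup>2 - 2 * \<gamma> * (X * Y) + \<beta> * Y\<^sup>2 > 0"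
proof -
  have "\<alpha> * (\<alpha> * X\<^sup>2 - 2 * \<gamma> * (X * Y) + \<beta> * Y\<^sup>2) = (\<alpha> * X - \<gamma> * Y)\<^sup>2 + (\<alpha> * \<beta> - \<gamma>\<^sup>2) * Y\<^sup>2"
    by (simp add: power2_eq_square algebra_simps)
  also have "\<dots> > 0"
  proof (cases "Y = 0")
    case True
    then show ?thesis using assms by simp
  next
    case False
    then have "(\<alpha> * \<beta> - \<gamma>\<^sup>2) * Y\<^sup>2 > 0" using assms by simp
    then show ?thesis by (smt (verit) zero_le_power2)
  qed
  finally show ?thesis using assms(1) by (simp add: zero_less_mult_iff)
qed

text \<open>On \<open>X\<close> the form stays above a constant times the squared norm; on
  \<open>P\<close> it grows linearly in \<open>s\<close> because of \<open>d\<close>. Since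
  \<open>P\<close> lies in the radical at 0, the mixed terms are O(s). Their square is O(s^2) and is
  beaten by the product of the two diagonal bounds, which is of order s.\<close>

lemma definite_perturbation:
  fixes b :: "real \<Rightarrow> 'a::euclidean_space \<Rightarrow> 'a \<Rightarrow> real"
  assumes bil: "\<And>s. bilinear (b s)" and sym: "\<And>s x y. b s x y = b s y x" and d: "bilinear d"
    and der: "\<And>x y. ((\<lambda>s. b s x y) has_real_derivative d x y) (at 0)"
    and X: "subspace X" and Xpos: "\<And>x. x \<in> X \<Longrightarrow> x \<noteq> 0 \<Longrightarrow> b 0 x x > 0"
    and P: "subspace P" "P \<subseteq> radical (b 0)" and Ppos: "\<And>p. p \<in> P \<Longrightarrow> p \<noteq> 0 \<Longrightarrow> d p p > 0"
  shows "\<forall>\<^sub>F s in at_right 0. \<forall>x\<in>X. \<forall>p\<in>P. x + p \<noteq> 0 \<longrightarrow> b s (x + p) (x + p) > 0"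
proof -
  obtain c1 where c1: "c1 > 0" "\<And>x. x \<in> X \<Longrightarrow> b 0 x x \<ge> c1 * (norm x)\<^sup>2"
    using definite_lower_bound[OF bil X Xpos] by blast
  obtain c2 where c2: "c2 > 0" "\<And>p. p \<in> P \<Longrightarrow> d p p \<ge> c2 * (norm p)\<^sup>2"
    using definite_lower_bound[OF d P(1) Ppos] by blast
  define e where "e = (\<lambda>s x y. b s x y - b 0 x y - s * d x y)"
  \<comment> \<open>Sums of absolute matrix entries: finitely many scalar limits then give estimates
    uniform in the vectors.\<close>
  define r where "r = (\<lambda>s. \<Sum>i\<in>Basis. \<Sum>j\<in>Basis. \<bar>e s i j\<bar>)"
  define D where "D = (\<Sum>i\<in>Basis. \<Sum>j\<in>Basis. \<bar>d i j\<bar>)"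
  \<comment> \<open>Half of the lower bound for \<open>d\<close> on \<open>P\<close> is given up to
    the remainder \<open>e\<close>.\<close>
  define \<epsilon> where "\<epsilon> = c2 / 2"
  define K where "K = D + \<epsilon>"
  have eb: "bilinear (e s)" for s
    unfolding e_def bilinear_def
    by (intro conjI allI linearI)
      (simp_all add: bilinear_ladd[OF bil] bilinear_radd[OF bil] bilinear_lmul[OF bil]
        bilinear_rmul[OF bil] bilinear_ladd[OF d] bilinear_radd[OF d] bilinear_lmul[OF d]
        bilinear_rmul[OF d] algebra_simps)
  have e_le: "\<bar>e s x y\<bar> \<le> r s * norm x * norm y" for s x y
    unfolding r_def by (rule bilinear_abs_le[OF eb])
  have d_le: "\<bar>d x y\<bar> \<le> D * norm x * norm y" for x y
    unfolding D_def by (rule bilinear_abs_le[OF d])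
  have lim: "((\<lambda>s. e s x y / s) \<longlongrightarrow> 0) (at_right 0)" for x y
  proof -
    have "((\<lambda>s. (b s x y - b 0 x y) / (s - 0)) \<longlongrightarrow> d x y) (at_right 0)"
      using has_field_derivative_at_within[OF der[of x y]] unfolding has_field_derivative_iff .
    then have "((\<lambda>s. (b s x y - b 0 x y) / s - d x y) \<longlongrightarrow> d x y - d x y) (at_right 0)"
      by (intro tendsto_diff tendsto_const) simp
    then have "((\<lambda>s. (b s x y - b 0 x y) / s - d x y) \<longlongrightarrow> 0) (at_right 0)" by simp
    then show ?thesis
      by (rule Lim_transform_eventually)
        (auto simp: e_def eventually_at_right_field field_simps intro!: exI[of _ 1])
  qed
  have "((\<lambda>s. \<Sum>i\<in>Basis. \<Sum>j\<in>Basis. \<bar>e s i j / s\<bar>) \<longlongrightarrow> 0) (at_right 0)"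
    by (intro tendsto_null_sum tendsto_rabs_zero lim)
  then have "\<forall>\<^sub>F s in at_right 0. (\<Sum>i\<in>Basis. \<Sum>j\<in>Basis. \<bar>e s i j / s\<bar>) < \<epsilon>"
    using c2 by (intro order_tendstoD) (auto simp: \<epsilon>_def)
  moreover have "\<forall>\<^sub>F s in at_right 0. s * k < c" if "c > 0" for k c :: real
  proof -
    have "((\<lambda>s. s * k) \<longlongrightarrow> 0 * k) (at_right 0)"
      by (intro tendsto_mult tendsto_const tendsto_ident_at)
    then show ?thesis using that by (intro order_tendstoD) auto
  qed
  \<comment> \<open>The first inequality keeps half of \<open>c1\<close> on \<open>X\<close>; the
    second is the discriminant condition of \<open>quadratic_pos\<close>, divided by
    \<open>s\<close>.\<close>
  from this[of "c1 / 2" K] this[of "c1 * c2 / 4" "K\<^sup>2"]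
  have "\<forall>\<^sub>F s in at_right 0. s * K < c1 / 2" "\<forall>\<^sub>F s in at_right 0. s * K\<^sup>2 < c1 * c2 / 4"
    using c1 c2 by auto
  moreover have "\<forall>\<^sub>F s in at_right 0. (0::real) < s" by (rule eventually_at_right_less)
  ultimately show ?thesis
  proof eventually_elim
    case (elim s)
    have s: "s > 0" by fact
    have "r s = s * (\<Sum>i\<in>Basis. \<Sum>j\<in>Basis. \<bar>e s i j / s\<bar>)"
      using s by (simp add: r_def sum_distrib_left abs_divide)
    also have "\<dots> \<le> s * \<epsilon>" using s elim by simp
    finally have rs: "r s \<le> s * \<epsilon>" .
    show ?case
    proof (intro ballI impI)
      fix x p assume x: "x \<in> X" and p: "p \<in> P" and nz: "x + p \<noteq> 0"
      define N where "N = norm x"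
      define M where "M = norm p"
      have NM: "N \<ge> 0" "M \<ge> 0" "N \<noteq> 0 \<or> M \<noteq> 0" using nz by (auto simp: N_def M_def)
      have le: "\<bar>b s u v - b 0 u v - s * d u v\<bar> \<le> s * \<epsilon> * (norm u * norm v)" for u v
        using e_le[of s u v] mult_right_mono[OF rs, of "norm u * norm v"] unfolding e_def
        by (simp add: mult.assoc)
      have le': "\<bar>b s u v - b 0 u v\<bar> \<le> s * K * (norm u * norm v)" for u v
      proof -
        have "\<bar>s * d u v\<bar> \<le> s * D * (norm u * norm v)"
          using mult_left_mono[OF d_le[of u v], of s] s by (simp add: abs_mult mult.assoc)
        then show ?thesis using le[of u v] unfolding K_def by (simp add: algebra_simps)
      qed
      have 1: "b s x x \<ge> c1 / 2 * N\<^sup>2"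
      proof -
        have "s * K * N\<^sup>2 \<le> c1 / 2 * N\<^sup>2" using elim by (intro mult_right_mono) auto
        then show ?thesis using le'[of x x] c1(2)[OF x] by (simp add: N_def power2_eq_square)
      qed
      have 2: "\<bar>b s x p\<bar> \<le> s * K * (N * M)"
      proof -
        have "b 0 x p = 0" using p P(2) sym by (auto simp: radical_def)
        then show ?thesis using le'[of x p] by (simp add: N_def M_def)
      qed
      have 3: "b s p p \<ge> s * c2 / 2 * M\<^sup>2"
      proof -
        have "b 0 p p = 0" using p P(2) by (auto simp: radical_def)
        moreover have "s * d p p \<ge> s * (c2 * M\<^sup>2)"
          using c2(2)[OF p] s by (intro mult_left_mono) (auto simp: M_def)
        moreover have "\<bar>b s p p - b 0 p p - s * d p p\<bar> \<le> s * (c2 * M\<^sup>2) / 2"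
          using le[of p p] by (simp add: M_def \<epsilon>_def power2_eq_square)
        ultimately have "b s p p \<ge> s * (c2 * M\<^sup>2) / 2" by linarith
        then show ?thesis by simp
      qed
      have "b s (x + p) (x + p) = b s x x + 2 * b s x p + b s p p"
        using sym[of s p x] by (simp add: bilinear_ladd[OF bil] bilinear_radd[OF bil])
      also have "\<dots> \<ge> c1 / 2 * N\<^sup>2 - 2 * (s * K) * (N * M) + s * c2 / 2 * M\<^sup>2"
        using 1 2 3 by linarith
      moreover have "c1 / 2 * N\<^sup>2 - 2 * (s * K) * (N * M) + s * c2 / 2 * M\<^sup>2 > 0"
      proof (rule quadratic_pos)
        have "s * (s * K\<^sup>2) < s * (c1 * c2 / 4)" using elim s by (intro mult_strict_left_mono) auto
        then show "(s * K)\<^sup>2 < c1 / 2 * (s * c2 / 2)" by (simp add: power2_eq_square mult_ac)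
      qed (use c1 NM in auto)
      ultimately show "b s (x + p) (x + p) > 0" by linarith
    qed
  qed
qed

text \<open>Right after \<open>t0\<close> the form is nonnegative on \<open>X + P + L\<close>:
  \<open>X\<close> is a positive complement at \<open>t0\<close>, \<open>P\<close> has become
  positive, and \<open>L\<close> is null at all times. So at most the rest of the radical at
  \<open>t0\<close> can turn negative.\<close>

lemma neg_index_after:
  fixes b :: "real \<Rightarrow> 'a::euclidean_space \<Rightarrow> 'a \<Rightarrow> real"
  assumes bil: "\<And>s. bilinear (b s)" and sym: "\<And>s x y. b s x y = b s y x" and d: "bilinear d"
    and der: "\<And>x y. ((\<lambda>s. b s x y) has_real_derivative d x y) (at t0)"
    and P: "subspace P" "P \<subseteq> radical (b t0)" and Ppos: "\<And>p. p \<in> P \<Longrightarrow> p \<noteq> 0 \<Longrightarrow> d p p > 0"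
    and L: "subspace L" "\<And>s. L \<subseteq> radical (b s)" and PL: "P \<inter> L \<subseteq> {0}"
  shows "\<exists>\<eta>>0. \<forall>t. t0 < t \<and> t < t0 + \<eta> \<longrightarrow>
    neg_index (b t) + dim P + dim L \<le> neg_index (b t0) + dim (radical (b t0))"
proof -
  obtain X where X: "subspace X" "\<And>x. x \<in> X \<Longrightarrow> x \<noteq> 0 \<Longrightarrow> b t0 x x > 0"
    "DIM('a) \<le> neg_index (b t0) + dim (radical (b t0)) + dim X"
    using positive_complement[OF bil sym] by metis
  have "\<forall>\<^sub>F s in at_right 0. \<forall>x\<in>X. \<forall>p\<in>P. x + p \<noteq> 0 \<longrightarrow> b (s + t0) (x + p) (x + p) > 0"
  proof (rule definite_perturbation[where b = "\<lambda>s. b (s + t0)", OF bil sym d])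
    show "((\<lambda>s. b (s + t0) x y) has_real_derivative d x y) (at 0)" for x y
      using der[of x y] DERIV_shift[of "\<lambda>s. b s x y" "d x y" 0 t0] by simp
  qed (use X P Ppos in auto)
  then obtain \<eta> where \<eta>: "\<eta> > 0"
    "\<And>s x p. 0 < s \<Longrightarrow> s < \<eta> \<Longrightarrow> x \<in> X \<Longrightarrow> p \<in> P \<Longrightarrow> x + p \<noteq> 0 \<Longrightarrow> b (s + t0) (x + p) (x + p) > 0"
    unfolding eventually_at_right_field by blast
  define Y where "Y = {x + p |x p. x \<in> X \<and> p \<in> P}"
  define Z where "Z = {y + l |y l. y \<in> Y \<and> l \<in> L}"
  have sY: "subspace Y" unfolding Y_def by (intro subspace_sums X P)
  have sZ: "subspace Z" unfolding Z_def by (intro subspace_sums sY L)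
  have rad0: "b t0 x x = 0" if "x \<in> radical (b t0)" for x using that by (auto simp: radical_def)
  have sR: "subspace (radical (b t0))"
    by (auto simp: radical_def subspace_def bilinear_ladd[OF bil] bilinear_lmul[OF bil]
        bilinear_lzero[OF bil])
  have XR: "x = 0" if "x \<in> X" "x \<in> radical (b t0)" for x
    using X(2)[of x] rad0[of x] that by force
  have dY: "dim Y = dim X + dim P"
    unfolding Y_def by (intro dim_direct_sum X P) (use XR P in auto)
  have "Y \<inter> L \<subseteq> {0}"
  proof safe
    fix y assume "y \<in> Y" "y \<in> L"
    then obtain x p where y: "y = x + p" "x \<in> X" "p \<in> P" by (auto simp: Y_def)
    have "y - p \<in> radical (b t0)"
      using \<open>y \<in> L\<close> L(2)[of t0] y P(2) sR by (intro subspace_diff) auto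
    then have "x = 0" using XR y by simp
    then show "y = 0" using PL y \<open>y \<in> L\<close> by auto
  qed
  then have dZ: "dim Z = dim X + dim P + dim L"
    unfolding Z_def using dim_direct_sum[OF sY L(1)] dY by simp
  show ?thesis
  proof (intro exI[of _ \<eta>] conjI allI impI \<eta>(1))
    fix t assume t: "t0 < t \<and> t < t0 + \<eta>"
    have "neg_index (b t) + dim Z \<le> DIM('a)"
    proof (rule neg_index_le[OF sZ])
      fix z assume "z \<in> Z"
      then obtain x p l where z: "z = (x + p) + l" "x \<in> X" "p \<in> P" "l \<in> L"
        by (auto simp: Z_def Y_def)
      have "b t l w = 0" "b t w l = 0" for w using L(2)[of t] z sym by (auto simp: radical_def)
      then have "b t z z = b t (x + p) (x + p)"
        unfolding z by (simp add: bilinear_ladd[OF bil] bilinear_radd[OF bil])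
      also have "\<dots> \<ge> 0"
      proof (cases "x + p = 0")
        case True
        then show ?thesis by (simp add: bilinear_lzero[OF bil])
      next
        case False
        then show ?thesis using \<eta>(2)[of "t - t0" x p] t z by simp
      qed
      finally show "0 \<le> b t z z" .
    qed
    then show "neg_index (b t) + dim P + dim L \<le> neg_index (b t0) + dim (radical (b t0))"
      using dZ X(3) by simp
  qed
qed

text \<open>Just before \<open>t0\<close> the vectors of \<open>P\<close> are negative, and they
  join a maximal negative definite subspace at \<open>t0\<close>. In \<open>c\<close> the reversal
  of time and the change of sign cancel, so its derivative at 0 is again \<open>d\<close>.\<close>

lemma neg_index_before:
  fixes b :: "real \<Rightarrow> 'a::euclidean_space \<Rightarrow> 'a \<Rightarrow> real"
  assumes bil: "\<And>s. bilinear (b s)" and sym: "\<And>s x y. b s x y = b s y x" and d: "bilinear d"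
    and der: "\<And>x y. ((\<lambda>s. b s x y) has_real_derivative d x y) (at t0)"
    and P: "subspace P" "P \<subseteq> radical (b t0)" and Ppos: "\<And>p. p \<in> P \<Longrightarrow> p \<noteq> 0 \<Longrightarrow> d p p > 0"
  shows "\<exists>\<eta>>0. \<forall>t. t0 - \<eta> < t \<and> t < t0 \<longrightarrow> neg_index (b t0) + dim P \<le> neg_index (b t)"
proof -
  obtain W where W: "neg_def_on (b t0) W" "dim W = neg_index (b t0)"
    using neg_index_attained by blast
  then have sW: "subspace W" and neg: "\<And>x. x \<in> W \<Longrightarrow> x \<noteq> 0 \<Longrightarrow> b t0 x x < 0"
    by (auto simp: neg_def_on_def)
  define c where "c = (\<lambda>s x y. - b (t0 - s) x y)"
  have cbil: "bilinear (c s)" for s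
    unfolding c_def bilinear_def
    by (intro conjI allI linearI)
      (simp_all add: bilinear_ladd[OF bil] bilinear_radd[OF bil] bilinear_lmul[OF bil]
        bilinear_rmul[OF bil])
  have "\<forall>\<^sub>F s in at_right 0. \<forall>x\<in>W. \<forall>p\<in>P. x + p \<noteq> 0 \<longrightarrow> c s (x + p) (x + p) > 0"
  proof (rule definite_perturbation[OF cbil _ d])
    show "((\<lambda>s. c s x y) has_real_derivative d x y) (at 0)" for x y
    proof -
      have "((\<lambda>s. b (t0 - s) x y) has_real_derivative d x y * (- 1)) (at 0)"
        by (rule DERIV_chain2[where f = "\<lambda>s. b s x y" and g = "\<lambda>s. t0 - s"])
          (auto simp: der intro!: derivative_eq_intros)
      from DERIV_minus[OF this] show ?thesis by (simp add: c_def)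
    qed
  qed (use sW neg P Ppos sym in \<open>auto simp: c_def radical_def\<close>)
  then obtain \<eta> where \<eta>: "\<eta> > 0"
    "\<And>s x p. 0 < s \<Longrightarrow> s < \<eta> \<Longrightarrow> x \<in> W \<Longrightarrow> p \<in> P \<Longrightarrow> x + p \<noteq> 0 \<Longrightarrow> c s (x + p) (x + p) > 0"
    unfolding eventually_at_right_field by blast
  define Y where "Y = {x + p |x p. x \<in> W \<and> p \<in> P}"
  have "W \<inter> P \<subseteq> {0}" using neg P(2) by (fastforce simp: radical_def)
  then have dY: "dim Y = dim W + dim P"
    unfolding Y_def by (intro dim_direct_sum sW P)
  show ?thesis
  proof (intro exI[of _ \<eta>] conjI allI impI \<eta>(1))
    fix t assume t: "t0 - \<eta> < t \<and> t < t0"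
    have "neg_def_on (b t) Y"
      unfolding neg_def_on_def
    proof (intro conjI ballI impI)
      show "subspace Y" unfolding Y_def by (intro subspace_sums sW P)
      fix y assume "y \<in> Y" "y \<noteq> 0"
      then show "b t y y < 0" using \<eta>(2)[of "t0 - t"] t by (auto simp: Y_def c_def)
    qed
    from dim_le_neg_index[OF this] show "neg_index (b t0) + dim P \<le> neg_index (b t)"
      using dY W by simp
  qed
qed

section \<open>The flow of a linear vector field\<close>

definition flow :: "('a::euclidean_space \<Rightarrow> 'a) \<Rightarrow> real \<Rightarrow> 'a \<Rightarrow> 'a" where
  "flow F t = lin_exp (\<lambda>x. t *\<^sub>R F x)"

context
  fixes F :: "'a::euclidean_space \<Rightarrow> 'a"
  assumes F: "linear F"
begin

lemma linear_funpow: "linear (F ^^ k)"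
proof (induction k)
  case (Suc k)
  then show ?case using linear_compose[OF Suc F] by (simp add: o_def)
qed (simp add: linear_id[unfolded id_def] id_def)

lemma summable_flow: "summable (\<lambda>k. (t ^ k / fact k) *\<^sub>R (F ^^ k) x)"
proof -
  obtain K where K: "K > 0" "\<And>x. norm (F x) \<le> norm x * K"
    using bounded_linear.pos_bounded[of F] F linear_conv_bounded_linear by blast
  have le: "norm ((F ^^ k) x) \<le> K ^ k * norm x" for k
  proof (induction k)
    case (Suc k)
    have "norm ((F ^^ Suc k) x) \<le> norm ((F ^^ k) x) * K" using K(2) by simp
    also have "\<dots> \<le> K ^ k * norm x * K" using Suc K by (intro mult_right_mono) auto
    finally show ?case by (simp add: mult_ac)
  qed simp
  show ?thesis
  proof (rule summable_comparison_test')
    have "summable (\<lambda>k. (\<bar>t\<bar> * K) ^ k /\<^sub>R fact k)" by (rule summable_exp_generic)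
    then show "summable (\<lambda>k. ((\<bar>t\<bar> * K) ^ k /\<^sub>R fact k) * norm x)" by (rule summable_mult2)
    fix k
    have "norm ((t ^ k / fact k) *\<^sub>R (F ^^ k) x) = \<bar>t\<bar> ^ k / fact k * norm ((F ^^ k) x)"
      by (simp add: power_abs)
    also have "\<dots> \<le> \<bar>t\<bar> ^ k / fact k * (K ^ k * norm x)"
      by (intro mult_left_mono le) auto
    also have "\<dots> = ((\<bar>t\<bar> * K) ^ k /\<^sub>R fact k) * norm x"
      by (simp add: power_mult_distrib divide_inverse mult_ac)
    finally show "norm ((t ^ k / fact k) *\<^sub>R (F ^^ k) x) \<le> ((\<bar>t\<bar> * K) ^ k /\<^sub>R fact k) * norm x" .
  qed
qed

lemma flow_series: "flow F t x = (\<Sum>k. (t ^ k / fact k) *\<^sub>R (F ^^ k) x)"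
proof -
  have "((\<lambda>x. t *\<^sub>R F x) ^^ k) x = t ^ k *\<^sub>R (F ^^ k) x" for k
    by (induction k) (simp_all add: linear_scale[OF F])
  then show ?thesis by (simp add: flow_def lin_exp_def divide_inverse mult.commute)
qed

lemma linear_flow: "linear (flow F t)"
proof (rule linearI)
  show "flow F t (x + y) = flow F t x + flow F t y" for x y
    unfolding flow_series
    by (subst suminf_add[OF summable_flow summable_flow])
      (simp add: linear_add[OF linear_funpow] scaleR_add_right)
  show "flow F t (r *\<^sub>R x) = r *\<^sub>R flow F t x" for r x
    unfolding flow_series
    by (subst bounded_linear.suminf[OF bounded_linear_scaleR_right summable_flow])
      (simp add: linear_scale[OF linear_funpow] mult.commute)
qed

lemma flow_0: "flow F 0 x = x"
  unfolding flow_series by (subst suminf_finite[of "{0}"]) auto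

lemma flow_commute: "F (flow F t x) = flow F t (F x)"
proof -
  have "bounded_linear F" using F linear_conv_bounded_linear by blast
  from bounded_linear.suminf[OF this summable_flow] show ?thesis
    by (simp add: flow_series linear_scale[OF F] funpow_swap1)
qed

text \<open>Each coordinate of the flow is an everywhere convergent scalar power series, which may
  be differentiated term by term.\<close>

lemma flow_has_derivative: "((\<lambda>t. flow F t x) has_vector_derivative F (flow F t x)) (at t)"
proof -
  have "((\<lambda>t. flow F t x \<bullet> i) has_real_derivative F (flow F t x) \<bullet> i) (at t)" for i
  proof -
    define c where "c = (\<lambda>x k. ((F ^^ k) x \<bullet> i) / fact k)"
    have sm: "summable (\<lambda>k. c x k * t ^ k)" for x t
      using bounded_linear.summable[OF bounded_linear_inner_left[of i] summable_flow[of t x]]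
      by (simp add: c_def field_simps)
    have eq: "flow F t x \<bullet> i = (\<Sum>k. c x k * t ^ k)" for x t
      unfolding flow_series bounded_linear.suminf[OF bounded_linear_inner_left[of i] summable_flow]
      by (simp add: c_def field_simps)
    have "((\<lambda>t. \<Sum>k. c x k * t ^ k) has_real_derivative (\<Sum>k. diffs (c x) k * t ^ k)) (at t)"
      by (rule termdiffs_strong_converges_everywhere) (rule sm)
    moreover have "diffs (c x) k = c (F x) k" for k
      by (simp add: diffs_def c_def funpow_swap1 del: of_nat_Suc)
    ultimately show ?thesis by (simp add: eq flow_commute)
  qed
  then show ?thesis
    unfolding has_vector_derivative_def has_field_derivative_def
    by (subst has_derivative_componentwise_within) (auto simp: mult_commute_abs)
qed

text \<open>The derivative of \<open>flow F (- t) (y t)\<close> is zero. Stated with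
  \<open>flow F (- t)\<close>, this also yields the inverse of the flow, by taking a flow line for
  \<open>y\<close>, without any product of series.\<close>

lemma flow_unique:
  assumes y: "\<And>t. (y has_vector_derivative F (y t)) (at t)"
  shows "flow F (- t) (y t) = y 0"
proof -
  \<comment> \<open>Expanding \<open>y t\<close> in a basis reduces the derivative to products of a
    scalar function and a flow line.\<close>
  define h where "h = (\<lambda>t. \<Sum>b\<in>Basis. (y t \<bullet> b) *\<^sub>R flow F (- t) b)"
  have h: "h t = flow F (- t) (y t)" for t
    unfolding h_def
    by (subst (2) euclidean_representation[symmetric])
      (simp add: linear_sum[OF linear_flow] linear_scale[OF linear_flow])
  have "(h has_vector_derivative 0) (at t)" for t
  proof -
    have 1: "((\<lambda>t. y t \<bullet> b) has_vector_derivative F (y t) \<bullet> b) (at t)" for b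
      by (rule bounded_linear.has_vector_derivative[OF bounded_linear_inner_left y])
    have 2: "((\<lambda>t. flow F (- t) b) has_vector_derivative - F (flow F (- t) b)) (at t)" for b
    proof -
      have "((\<lambda>t. - t) has_vector_derivative (- 1 :: real)) (at t)"
        unfolding has_real_derivative_iff_has_vector_derivative[symmetric]
        by (auto intro!: derivative_eq_intros)
      from vector_diff_chain_at[OF this flow_has_derivative] show ?thesis by (simp add: o_def)
    qed
    have "(h has_vector_derivative (\<Sum>b\<in>Basis. (y t \<bullet> b) *\<^sub>R (- F (flow F (- t) b)) +
        (F (y t) \<bullet> b) *\<^sub>R flow F (- t) b)) (at t)"
      unfolding h_def
      by (intro has_vector_derivative_sum has_vector_derivative_scaleR
        1[unfolded has_real_derivative_iff_has_vector_derivative[symmetric]] 2)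
    also have "(\<Sum>b\<in>Basis. (y t \<bullet> b) *\<^sub>R (- F (flow F (- t) b)) + (F (y t) \<bullet> b) *\<^sub>R flow F (- t) b) =
       - F (\<Sum>b\<in>Basis. (y t \<bullet> b) *\<^sub>R flow F (- t) b) + (\<Sum>b\<in>Basis. (F (y t) \<bullet> b) *\<^sub>R flow F (- t) b)"
      by (simp add: sum.distrib linear_sum[OF F] linear_scale[OF F] sum_negf sum_subtractf)
    also have "(\<Sum>b\<in>Basis. (F (y t) \<bullet> b) *\<^sub>R flow F (- t) b) = flow F (- t) (F (y t))"
      by (subst (2) euclidean_representation[symmetric, of "F (y t)"])
        (simp add: linear_sum[OF linear_flow] linear_scale[OF linear_flow])
    also have "- F (\<Sum>b\<in>Basis. (y t \<bullet> b) *\<^sub>R flow F (- t) b) = - flow F (- t) (F (y t))"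
      using h[of t] by (simp add: h_def flow_commute)
    finally show ?thesis by simp
  qed
  then have "h t = h 0"
    using has_derivative_zero_unique[of UNIV h 0 t]
    by (auto simp: has_vector_derivative_def intro: has_derivative_at_withinI)
  then show ?thesis using h[of t] h[of 0] by (simp add: flow_0)
qed

lemma flow_minus_flow: "flow F (- t) (flow F t x) = x"
  using flow_unique[of "\<lambda>t. flow F t x" t] flow_has_derivative by (simp add: flow_0)

lemma flow_flow_minus: "flow F t (flow F (- t) x) = x"
  using flow_minus_flow[of "- t"] by simp

lemma flow_eqI:
  assumes "\<And>t. (y has_vector_derivative F (y t)) (at t)"
  shows "flow F t (y 0) = y t"
  using flow_unique[of y t, OF assms] flow_flow_minus[of t "y t"] by simp

lemma flow_invariant:
  assumes L: "subspace L" and inv: "\<And>x. x \<in> L \<Longrightarrow> F x \<in> L" and x: "x \<in> L"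
  shows "flow F t x \<in> L"
proof -
  have "(F ^^ k) x \<in> L" for k by (induction k) (use inv x in auto)
  then have "(\<Sum>k<n. (t ^ k / fact k) *\<^sub>R (F ^^ k) x) \<in> L" for n
    by (intro subspace_sum subspace_scale L)
  moreover have "(\<lambda>n. \<Sum>k<n. (t ^ k / fact k) *\<^sub>R (F ^^ k) x) \<longlonglongrightarrow> flow F t x"
    unfolding flow_series by (rule summable_LIMSEQ[OF summable_flow])
  ultimately show ?thesis
    by (rule closed_sequentially[OF closed_subspace[OF L]])
qed

lemma bilinear_flow_has_derivative:
  assumes b: "bilinear b"
  shows "((\<lambda>t. b (flow F t x) (flow F t y) :: real) has_real_derivative
    b (F (flow F t x)) (flow F t y) + b (flow F t x) (F (flow F t y))) (at t)"
proof -
  interpret b: bounded_bilinear b using b bilinear_conv_bounded_bilinear by blast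
  show ?thesis
    unfolding has_real_derivative_iff_has_vector_derivative
    using b.has_vector_derivative[OF flow_has_derivative[of x t] flow_has_derivative[of y t]]
    by (simp add: add.commute)
qed

lemma flow_preserves:
  assumes b: "bilinear b" and skew: "\<And>x y. b (F x) y = - b x (F y)"
  shows "(b (flow F t x) (flow F t y) :: real) = b x y"
proof -
  have "((\<lambda>t. b (flow F t x) (flow F t y)) has_real_derivative 0) (at t)" for t
    using bilinear_flow_has_derivative[OF b, of x y t] by (simp add: skew)
  then have "b (flow F t x) (flow F t y) = b (flow F 0 x) (flow F 0 y)"
    by (intro DERIV_isconst_all allI)
  then show ?thesis by (simp add: flow_0)
qed

end

section \<open>Invariant Lagrangian subspaces\<close>

definition poly_at :: "('a::real_vector \<Rightarrow> 'a) \<Rightarrow> real poly \<Rightarrow> 'a \<Rightarrow> 'a" where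
  "poly_at F p x = (\<Sum>i\<le>degree p. coeff p i *\<^sub>R (F ^^ i) x)"

lemma poly_at_altdef:
  assumes "degree p \<le> n"
  shows "poly_at F p x = (\<Sum>i\<le>n. coeff p i *\<^sub>R (F ^^ i) x)"
  unfolding poly_at_def using assms
  by (intro sum.mono_neutral_left) (auto simp: coeff_eq_0)

lemma poly_at_pCons:
  assumes "linear F"
  shows "poly_at F (pCons a p) x = a *\<^sub>R x + F (poly_at F p x)"
proof -
  have "poly_at F (pCons a p) x = (\<Sum>i\<le>Suc (degree p). coeff (pCons a p) i *\<^sub>R (F ^^ i) x)"
    by (rule poly_at_altdef) (rule degree_pCons_le)
  also have "\<dots> = a *\<^sub>R x + (\<Sum>i\<le>degree p. coeff p i *\<^sub>R F ((F ^^ i) x))"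
    by (subst sum.atMost_Suc_shift) simp
  also have "\<dots> = a *\<^sub>R x + F (poly_at F p x)"
    by (simp add: poly_at_def linear_sum[OF assms] linear_scale[OF assms])
  finally show ?thesis .
qed

lemma poly_at_add: "poly_at F (p + q) x = poly_at F p x + poly_at F q x"
proof -
  define n where "n = max (degree p) (degree q)"
  have "degree (p + q) \<le> n" "degree p \<le> n" "degree q \<le> n"
    by (auto simp: n_def degree_add_le_max)
  then show ?thesis by (simp add: poly_at_altdef[of _ n] scaleR_add_left sum.distrib)
qed

lemma poly_at_smult: "poly_at F (smult a p) x = a *\<^sub>R poly_at F p x"
  using poly_at_altdef[of "smult a p" "degree p" F x]
  by (simp add: degree_smult_le poly_at_def scaleR_sum_right)

lemma poly_at_0: "poly_at F 0 x = 0"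
  by (simp add: poly_at_def)

lemma poly_at_mult:
  assumes "linear F"
  shows "poly_at F (p * q) x = poly_at F p (poly_at F q x)"
proof (induction p)
  case 0
  then show ?case by (simp add: poly_at_0)
next
  case (pCons a p)
  then show ?case
    by (simp add: mult_pCons_left poly_at_add poly_at_smult poly_at_pCons[OF assms])
qed

lemma poly_at_in_subspace:
  assumes "subspace W" "\<And>x. x \<in> W \<Longrightarrow> F x \<in> W" "x \<in> W"
  shows "poly_at F p x \<in> W"
proof -
  have "(F ^^ k) x \<in> W" for k by (induction k) (use assms in auto)
  then show ?thesis unfolding poly_at_def by (intro subspace_sum subspace_scale assms(1))
qed

text \<open>The \<open>DIM('a) + 1\<close> first iterates are too many to be independent. Coinciding
  iterates are treated separately, since the set of iterates is then too small for the dimension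
  count; the difference of two monomials does it.\<close>

lemma poly_at_zero_ex:
  fixes F :: "'a::euclidean_space \<Rightarrow> 'a"
  shows "\<exists>p. p \<noteq> 0 \<and> poly_at F p x = 0"
proof (cases "inj_on (\<lambda>i. (F ^^ i) x) {..DIM('a)}")
  case True
  let ?S = "(\<lambda>i. (F ^^ i) x) ` {..DIM('a)}"
  have "card ?S > DIM('a)" by (simp add: card_image[OF True])
  then have "dependent ?S" by (intro dependent_biggerset) auto
  then obtain u where u: "\<exists>v\<in>?S. u v \<noteq> 0" "(\<Sum>v\<in>?S. u v *\<^sub>R v) = 0"
    by (subst (asm) dependent_finite) auto
  define p where "p = (\<Sum>i\<le>DIM('a). monom (u ((F ^^ i) x)) i)"
  have c: "coeff p i = (if i \<le> DIM('a) then u ((F ^^ i) x) else 0)" for i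
    by (simp add: p_def coeff_sum)
  have "degree p \<le> DIM('a)" by (rule degree_le) (simp add: c)
  then have "poly_at F p x = (\<Sum>i\<le>DIM('a). u ((F ^^ i) x) *\<^sub>R (F ^^ i) x)"
    by (simp add: poly_at_altdef c)
  also have "\<dots> = 0" using u(2) by (simp add: sum.reindex[OF True])
  finally have "poly_at F p x = 0" .
  moreover obtain i where "i \<le> DIM('a)" "u ((F ^^ i) x) \<noteq> 0" using u(1) by auto
  then have "coeff p i \<noteq> 0" by (simp add: c)
  then have "p \<noteq> 0" by auto
  ultimately show ?thesis by blast
next
  case False
  then obtain i j where ij: "i \<noteq> j" "(F ^^ i) x = (F ^^ j) x" by (auto simp: inj_on_def)
  define p :: "real poly" where "p = monom 1 i - monom 1 j"
  define n where "n = max i j"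
  have "coeff p i = 1" using ij by (simp add: p_def)
  then have "p \<noteq> 0" by auto
  moreover have "poly_at F p x = poly_at F (monom 1 i) x - poly_at F (monom 1 j) x"
  proof -
    have "p = monom 1 i + smult (- 1) (monom 1 j)" by (simp add: p_def)
    then have "poly_at F p x = poly_at F (monom 1 i) x + (- 1) *\<^sub>R poly_at F (monom 1 j) x"
      by (simp only: poly_at_add poly_at_smult)
    then show ?thesis by simp
  qed
  moreover have "poly_at F (monom 1 k) x = (F ^^ k) x" for k
    by (simp add: poly_at_def degree_monom_eq if_distrib[of "\<lambda>a. a *\<^sub>R _"] cong: if_cong)
  ultimately show ?thesis using ij by auto
qed

text \<open>Divide by the real minimal polynomial \<open>d\<close> of a complex root
  \<open>z\<close>: the remainder vanishes at \<open>z\<close> and has smaller degree than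
  \<open>d\<close>, so it is zero.\<close>

lemma real_poly_factor:
  fixes p :: "real poly"
  assumes "degree p > 2"
  shows "\<exists>d q. p = d * q \<and> 0 < degree d \<and> degree d < degree p"
proof -
  have deg: "degree (map_poly complex_of_real p) = degree p" by (rule degree_map_poly) simp
  then have "\<not> constant (poly (map_poly complex_of_real p))"
    using assms by (simp add: constant_degree)
  then obtain z where z: "poly (map_poly complex_of_real p) z = 0"
    using fundamental_theorem_of_algebra by blast
  \<comment> \<open>Multiplication by \<open>z\<close> is a real linear map of the complex plane,
    and \<open>poly_at\<close> of it at 1 is the value of the polynomial at \<open>z\<close>; the
    rules for \<open>poly_at\<close> thus also serve for evaluation.\<close>
  have lin: "linear ((*) z)" by (intro linearI) (auto simp: algebra_simps)
  have pw: "(((*) z) ^^ i) 1 = z ^ i" for i by (induction i) auto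
  have pz: "poly_at ((*) z) p 1 = 0"
    using z by (simp add: poly_altdef deg poly_at_def pw coeff_map_poly scaleR_conv_of_real)
  define d where "d = (if Im z = 0 then [:- Re z, 1:] else [:(cmod z)\<^sup>2, - 2 * Re z, 1:])"
  define r where "r = p mod d"
  have d0: "d \<noteq> 0" and dd: "degree d = (if Im z = 0 then 1 else 2)" by (auto simp: d_def)
  have dz: "poly_at ((*) z) d w = 0" for w
  proof (cases "Im z = 0")
    case True
    then have "z = of_real (Re z)" by (simp add: complex_eq_iff)
    then have "z * w = Re z *\<^sub>R w" by (metis scaleR_conv_of_real)
    then show ?thesis using True by (simp add: d_def poly_at_pCons[OF lin] poly_at_0)
  next
    case False
    have "poly_at ((*) z) d w = (of_real ((cmod z)\<^sup>2) - of_real (2 * Re z) * z + z * z) * w"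
      using False by (simp add: d_def poly_at_pCons[OF lin] poly_at_0 scaleR_conv_of_real algebra_simps)
    also have "of_real ((cmod z)\<^sup>2) - of_real (2 * Re z) * z + z * z = 0"
      unfolding cmod_power2 by (simp add: complex_eq_iff power2_eq_square algebra_simps)
    finally show ?thesis by simp
  qed
  have pq: "p = d * (p div d) + r" by (simp add: r_def)
  have "poly_at ((*) z) p 1 = poly_at ((*) z) r 1"
    by (subst pq) (simp add: poly_at_add poly_at_mult[OF lin] dz)
  then have rz: "poly_at ((*) z) r 1 = 0" using pz by simp
  have "r = 0"
  proof (rule ccontr)
    assume r: "r \<noteq> 0"
    have dr: "degree r < degree d" unfolding r_def using d0 r r_def degree_mod_less' by blast
    show False
    proof (cases "Im z = 0")
      case True
      then obtain c where "r = [:c:]" using dr dd by (auto elim: degree_eq_zeroE)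
      then show False using rz r by (simp add: poly_at_pCons[OF lin] poly_at_0)
    next
      case False
      then have "degree r \<le> 1" using dr dd by simp
      then have "r = [:coeff r 0, coeff r 1:]"
        by (intro poly_eqI) (auto simp: coeff_pCons coeff_eq_0 split: nat.split)
      then obtain a b where ab: "r = [:a, b:]" by blast
      then have "of_real a + z * of_real b = 0"
        using rz by (simp add: poly_at_pCons[OF lin] poly_at_0 scaleR_conv_of_real)
      then have "b = 0 \<and> a = 0" using False by (auto simp: complex_eq_iff)
      then show False using r ab by simp
    qed
  qed
  then have "p = d * (p div d)" using pq by simp
  then show ?thesis using dd assms by (intro exI[of _ d] exI[of _ "p div d"]) auto
qed

text \<open>Among all nonzero polynomials that send some vector of \<open>W\<close> outside
  \<open>L\<close> into \<open>L\<close>, one of least degree has no proper factorization: if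
  \<open>p = d * q\<close>, then either \<open>q\<close> works for \<open>x\<close>, or
  \<open>d\<close> works for the image of \<open>x\<close> under \<open>q\<close>. Hence its degree
  is at most 2. The relation found makes \<open>L + span {x, F x}\<close> invariant.\<close>

lemma quadratic_relation_mod:
  fixes F :: "'a::euclidean_space \<Rightarrow> 'a"
  assumes F: "linear F" and W: "subspace W" "\<And>x. x \<in> W \<Longrightarrow> F x \<in> W"
    and L: "subspace L" "\<And>x. x \<in> L \<Longrightarrow> F x \<in> L" and x0: "x0 \<in> W" "x0 \<notin> L"
  shows "\<exists>x a b. x \<in> W \<and> x \<notin> L \<and> F (F x) + a *\<^sub>R F x + b *\<^sub>R x \<in> L"
proof -
  define Q where "Q = (\<lambda>p. p \<noteq> 0 \<and> (\<exists>x. x \<in> W \<and> x \<notin> L \<and> poly_at F p x \<in> L))"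
  obtain p0 where "p0 \<noteq> 0" "poly_at F p0 x0 = 0" using poly_at_zero_ex by blast
  then have "Q p0" using x0 L(1) by (auto simp: Q_def subspace_0)
  then obtain p where p: "Q p" and min: "\<And>q. Q q \<Longrightarrow> degree p \<le> degree q"
    using ex_has_least_nat[of Q p0 degree] by blast
  obtain x where x: "x \<in> W" "x \<notin> L" "poly_at F p x \<in> L" and p0: "p \<noteq> 0"
    using p by (auto simp: Q_def)
  have nofac: False if pq: "p = d * q" "0 < degree d" "degree d < degree p" for d q
  proof -
    have nz: "d \<noteq> 0" "q \<noteq> 0" using pq p0 by auto
    then have dq: "degree q < degree p" using pq by (simp add: degree_mult_eq)
    have m: "poly_at F p x = poly_at F d (poly_at F q x)" unfolding pq(1) by (rule poly_at_mult[OF F])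
    show False
    proof (cases "poly_at F q x \<in> L")
      case True
      then have "Q q" using nz x by (auto simp: Q_def)
      then show False using min dq by fastforce
    next
      case False
      then have "Q d"
        using nz x m poly_at_in_subspace[of W F x q, OF W x(1)]
        unfolding Q_def by (intro conjI exI[of _ "poly_at F q x"]) auto
      then show False using min pq by fastforce
    qed
  qed
  then have "degree p \<le> 2" using real_poly_factor[of p] by fastforce
  then have "p = [:coeff p 0, coeff p 1, coeff p 2:]"
    by (intro poly_eqI) (auto simp: coeff_pCons coeff_eq_0 numeral_2_eq_2 split: nat.split)
  then obtain a b c where abc: "p = [:a, b, c:]" by blast
  have e: "poly_at F p x = a *\<^sub>R x + b *\<^sub>R F x + c *\<^sub>R F (F x)"
    by (simp add: abc poly_at_pCons[OF F] poly_at_0 linear_add[OF F] linear_scale[OF F] linear_0[OF F])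
  show ?thesis
  proof (cases "c = 0")
    case False
    have "F (F x) + (b / c) *\<^sub>R F x + (a / c) *\<^sub>R x = (1 / c) *\<^sub>R poly_at F p x"
      using False by (simp add: e scaleR_add_right)
    then show ?thesis using x subspace_scale[OF L(1) x(3)] by metis
  next
    case c: True
    show ?thesis
    proof (cases "b = 0")
      case False
      \<comment> \<open>A relation of degree 1 is raised to degree 2 by applying
        \<open>F\<close>.\<close>
      have "F x + (a / b) *\<^sub>R x = (1 / b) *\<^sub>R poly_at F p x"
        using False c by (simp add: e scaleR_add_right)
      then have "F x + (a / b) *\<^sub>R x \<in> L" using subspace_scale[OF L(1) x(3)] by metis
      then have "F (F x + (a / b) *\<^sub>R x) \<in> L" by (rule L(2))
      then have "F (F x) + (a / b) *\<^sub>R F x + 0 *\<^sub>R x \<in> L"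
        by (simp add: linear_add[OF F] linear_scale[OF F])
      then show ?thesis using x by blast
    next
      case True
      then have "a \<noteq> 0" using p0 abc c by simp
      then have "x = (1 / a) *\<^sub>R poly_at F p x" using True c by (simp add: e)
      then have "x \<in> L" using subspace_scale[OF L(1) x(3)] by metis
      then show ?thesis using x by simp
    qed
  qed
qed

section \<open>Skew-orthogonality and isotropic invariant subspaces\<close>

locale symplectic_space =
  fixes \<omega> :: "'a::euclidean_space \<Rightarrow> 'a \<Rightarrow> real"
  assumes symplectic: "symplectic_form \<omega>"
begin

lemma bil: "bilinear \<omega>" and alt: "\<omega> x x = 0"
  using symplectic by (auto simp: symplectic_form_def)

lemmas om_simps = bilinear_ladd[OF bil] bilinear_radd[OF bil] bilinear_lmul[OF bil]
  bilinear_rmul[OF bil] bilinear_lzero[OF bil] bilinear_rzero[OF bil]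
  bilinear_lneg[OF bil] bilinear_rneg[OF bil] bilinear_lsub[OF bil] bilinear_rsub[OF bil] alt

lemma skew: "\<omega> x y = - \<omega> y x"
  using alt[of "x + y"] alt[of x] alt[of y] by (simp add: bilinear_ladd[OF bil] bilinear_radd[OF bil])

lemma nondegenerate: "(\<And>y. \<omega> x y = 0) \<Longrightarrow> x = 0"
  using symplectic by (auto simp: symplectic_form_def)

definition skew_compl :: "'a set \<Rightarrow> 'a set" where
  "skew_compl S = {x. \<forall>y\<in>S. \<omega> x y = 0}"

lemma skew_compl_iff: "x \<in> skew_compl S \<longleftrightarrow> (\<forall>y\<in>S. \<omega> x y = 0)"
  by (simp add: skew_compl_def)

lemma skew_compl_altdef: "skew_compl S = {x. \<forall>y\<in>S. \<omega> y x = 0}"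
proof -
  have "\<omega> x y = 0 \<longleftrightarrow> \<omega> y x = 0" for x y using skew[of x y] by simp
  then show ?thesis by (simp add: skew_compl_def)
qed

lemma subspace_skew_compl: "subspace (skew_compl S)"
  unfolding skew_compl_altdef by (rule subspace_annihilator[OF bil])

lemma dim_skew_compl:
  assumes "subspace S"
  shows "dim (skew_compl S) + dim S = DIM('a)"
  unfolding skew_compl_altdef
  by (rule dim_annihilator(2)[OF bil assms]) (auto simp: radical_def intro: nondegenerate)

definition isotropic :: "'a set \<Rightarrow> bool" where
  "isotropic S \<longleftrightarrow> S \<subseteq> skew_compl S"

lemma isotropicD: "isotropic S \<Longrightarrow> x \<in> S \<Longrightarrow> y \<in> S \<Longrightarrow> \<omega> x y = 0"
  by (auto simp: isotropic_def skew_compl_iff)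

end

locale hamiltonian_field = symplectic_space \<omega>
  for \<omega> :: "'a::euclidean_space \<Rightarrow> 'a \<Rightarrow> real" +
  fixes F :: "'a \<Rightarrow> 'a"
  assumes linear_F: "linear F" and skew_F: "\<omega> (F x) y = - \<omega> x (F y)"
begin

lemmas F_simps = linear_add[OF linear_F] linear_scale[OF linear_F] linear_0[OF linear_F]
  linear_neg[OF linear_F] linear_diff[OF linear_F]

text \<open>The last relation makes \<open>L + span {y, F y}\<close> invariant. As \<open>F\<close>
  is skew and preserves \<open>L\<close>, the vector \<open>F y\<close> is skew-orthogonal to
  \<open>L\<close> like \<open>y\<close>, so the one remaining product that must vanish is
  \<open>\<omega> y (F y)\<close>.\<close>

lemma isotropic_extension:
  assumes L: "subspace L" "L \<subseteq> U" "\<And>x. x \<in> L \<Longrightarrow> F x \<in> L" "isotropic L"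
    and U: "subspace U" "\<And>x. x \<in> U \<Longrightarrow> F x \<in> U"
    and y: "y \<in> U" "y \<in> skew_compl L" "y \<notin> L" "\<omega> y (F y) = 0"
      "F (F y) + a *\<^sub>R F y + b *\<^sub>R y \<in> L"
  shows "\<exists>L'. subspace L' \<and> L' \<subseteq> U \<and> (\<forall>x\<in>L'. F x \<in> L') \<and> isotropic L' \<and> dim L < dim L'"
proof -
  define L' where "L' = {l + s |l s. l \<in> L \<and> s \<in> span {y, F y}}"
  have mem: "x \<in> L' \<longleftrightarrow> (\<exists>l\<in>L. \<exists>c d. x = l + c *\<^sub>R y + d *\<^sub>R F y)" for x
  proof
    assume "x \<in> L'"
    then obtain l c d where "l \<in> L" "x - l - c *\<^sub>R y = d *\<^sub>R F y"
      by (auto simp: L'_def span_breakdown_eq span_singleton)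
    then have "x = l + c *\<^sub>R y + d *\<^sub>R F y" by (simp add: algebra_simps)
    then show "\<exists>l\<in>L. \<exists>c d. x = l + c *\<^sub>R y + d *\<^sub>R F y" using \<open>l \<in> L\<close> by blast
  next
    assume "\<exists>l\<in>L. \<exists>c d. x = l + c *\<^sub>R y + d *\<^sub>R F y"
    then obtain l c d where "l \<in> L" "x = l + (c *\<^sub>R y + d *\<^sub>R F y)" by (auto simp: add.assoc)
    moreover have "c *\<^sub>R y + d *\<^sub>R F y \<in> span {y, F y}"
      by (intro span_add span_scale span_base) auto
    ultimately show "x \<in> L'" unfolding L'_def by blast
  qed
  have sL': "subspace L'" unfolding L'_def by (intro subspace_sums L subspace_span)
  have "L' \<subseteq> U"
  proof
    fix x assume "x \<in> L'"
    then obtain l c d where "l \<in> L" "x = l + c *\<^sub>R y + d *\<^sub>R F y" by (auto simp: mem)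
    then show "x \<in> U" using L(2) U y(1) by (auto intro!: subspace_add subspace_scale)
  qed
  moreover have "F x \<in> L'" if x: "x \<in> L'" for x
  proof -
    obtain l c d where l: "l \<in> L" "x = l + c *\<^sub>R y + d *\<^sub>R F y" using x by (auto simp: mem)
    define l' where "l' = F (F y) + a *\<^sub>R F y + b *\<^sub>R y"
    have "F x = (F l + d *\<^sub>R l') + (- d * b) *\<^sub>R y + (c - d * a) *\<^sub>R F y"
      unfolding l(2) l'_def by (simp add: F_simps algebra_simps)
    moreover have "F l + d *\<^sub>R l' \<in> L"
      using y(5) L l by (auto simp: l'_def intro!: subspace_add[OF L(1)] subspace_scale[OF L(1)])
    ultimately show ?thesis unfolding mem by blast
  qed
  moreover have "isotropic L'"
    unfolding isotropic_def skew_compl_def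
  proof safe
    fix x x' assume "x \<in> L'" "x' \<in> L'"
    then obtain l c d l' c' d' where l: "l \<in> L" "x = l + c *\<^sub>R y + d *\<^sub>R F y"
      "l' \<in> L" "x' = l' + c' *\<^sub>R y + d' *\<^sub>R F y" unfolding mem by blast
    have yl: "\<omega> y u = 0" "\<omega> u y = 0" if "u \<in> L" for u
      using y(2) that skew[of u y] by (auto simp: skew_compl_iff)
    have Fl: "\<omega> (F y) u = 0" "\<omega> u (F y) = 0" if "u \<in> L" for u
      using yl L(3)[OF that] skew_F[of y u] skew[of u "F y"] by auto
    have "\<omega> (F y) y = 0" using y(4) skew[of "F y" y] by simp
    then show "\<omega> x x' = 0"
      unfolding l(2,4) using l(1,3) by (simp add: om_simps yl Fl isotropicD[OF L(4)] y(4))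
  qed
  moreover have "dim L < dim L'"
  proof -
    have "L \<subseteq> L'"
    proof
      fix x assume "x \<in> L"
      then show "x \<in> L'" unfolding mem by (intro bexI[of _ x] exI[of _ 0]) auto
    qed
    moreover have "y \<in> L'"
      unfolding mem using L(1) by (intro bexI[of _ 0] exI[of _ 1] exI[of _ 0]) (auto simp: subspace_0)
    ultimately have "L \<subset> L'" using y(3) by blast
    then show ?thesis using dim_psubset[of L L'] L(1) sL' by (metis span_eq_iff)
  qed
  ultimately show ?thesis using sL' by blast
qed

text \<open>Take \<open>L\<close> of maximal dimension. If its skew complement in \<open>U\<close>
  were larger, the quadratic relation modulo \<open>L\<close> would allow an extension, unless the
  quadratic is \<open>t^2 + b\<close> with \<open>b > 0\<close>; in that case \<open>F^2 + b\<close>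
  has a kernel vector in \<open>U\<close>, against \<open>nimag\<close>.\<close>

lemma invariant_lagrangian:
  assumes U: "subspace U" "\<And>x. x \<in> U \<Longrightarrow> F x \<in> U"
    and nimag: "\<And>u b. u \<in> U \<Longrightarrow> b > 0 \<Longrightarrow> F (F u) = - b *\<^sub>R u \<Longrightarrow> u = 0"
  obtains L where "subspace L" "L \<subseteq> U" "\<And>x. x \<in> L \<Longrightarrow> F x \<in> L" "isotropic L"
    "U \<inter> skew_compl L \<subseteq> L"
proof -
  define Q where "Q = (\<lambda>L. subspace L \<and> L \<subseteq> U \<and> (\<forall>x\<in>L. F x \<in> L) \<and> isotropic L)"
  have "Q {0}" using U by (auto simp: Q_def subspace_0 F_simps isotropic_def skew_compl_iff om_simps)
  moreover have "\<forall>L. Q L \<longrightarrow> dim L \<le> DIM('a)" by (simp add: dim_subset_UNIV)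
  ultimately obtain L where QL: "Q L" and max: "\<And>L'. Q L' \<Longrightarrow> dim L' \<le> dim L"
    using ex_has_greatest_nat[of Q "{0}" dim "DIM('a) + 1"] by (metis less_Suc_eq_le Suc_eq_plus1)
  have L: "subspace L" "L \<subseteq> U" "\<And>x. x \<in> L \<Longrightarrow> F x \<in> L" "isotropic L"
    using QL by (auto simp: Q_def)
  have ext: False if "y \<in> U" "y \<in> skew_compl L" "y \<notin> L" "\<omega> y (F y) = 0"
      "F (F y) + a *\<^sub>R F y + b *\<^sub>R y \<in> L" for y a b
    using isotropic_extension[OF L U that] max unfolding Q_def by (meson linorder_not_less)
  have "U \<inter> skew_compl L \<subseteq> L"
  proof (rule ccontr)
    define W where "W = U \<inter> skew_compl L"
    assume "\<not> U \<inter> skew_compl L \<subseteq> L"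
    then obtain x0 where x0: "x0 \<in> W" "x0 \<notin> L" by (auto simp: W_def)
    have sW: "subspace W" unfolding W_def by (rule subspace_inter[OF U(1) subspace_skew_compl])
    have FW: "F x \<in> W" if "x \<in> W" for x
      using that U L(3) skew_F by (auto simp: W_def skew_compl_iff)
    obtain x a b where x: "x \<in> W" "x \<notin> L" and rel: "F (F x) + a *\<^sub>R F x + b *\<^sub>R x \<in> L"
      using quadratic_relation_mod[OF linear_F sW FW L(1,3) x0] by blast
    have xU: "x \<in> U" "x \<in> skew_compl L" using x by (auto simp: W_def)
    have xl: "\<omega> x l = 0" if "l \<in> L" for l using xU that by (auto simp: skew_compl_iff)
    \<comment> \<open>Pairing the relation with \<open>x\<close> leaves only its middle term: either
      \<open>x\<close> can be adjoined at once or \<open>a\<close> is zero.\<close>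
    have "\<omega> x (F (F x)) = 0" using skew_F[of x "F x"] by (simp add: alt)
    then have "a * \<omega> x (F x) = 0" using xl[OF rel] by (simp add: om_simps)
    then consider "\<omega> x (F x) = 0" | "a = 0" by auto
    then show False
    proof cases
      case 1
      then show False using ext[OF xU x(2) _ rel] by simp
    next
      case 2
      then have rel: "F (F x) + b *\<^sub>R x \<in> L" using rel by simp
      show False
      proof (cases "b \<le> 0")
        case True
        \<comment> \<open>Modulo \<open>L\<close> the relation reads
          \<open>(F - c)(F + c) x = 0\<close>, so \<open>y = (F + c) x\<close> is an eigenvector
          modulo \<open>L\<close> unless it lies in \<open>L\<close>.\<close>
        define c where "c = sqrt (- b)"
        have c: "c * c = - b" using True by (simp add: c_def)
        define y where "y = F x + c *\<^sub>R x"
        define l where "l = F (F x) + b *\<^sub>R x"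
        have lL: "l \<in> L" using rel by (simp add: l_def)
        have Fy: "F y = c *\<^sub>R y + l" using c by (simp add: y_def l_def F_simps algebra_simps)
        show False
        proof (cases "y \<in> L")
          case True
          then have "\<omega> x y = 0" by (rule xl)
          then have "\<omega> x (F x) = 0" by (simp add: y_def om_simps)
          then show False using ext[OF xU x(2), of 0 b] rel by simp
        next
          case False
          have yW: "y \<in> W" using FW sW x by (auto simp: y_def subspace_add subspace_scale)
          then have yU: "y \<in> U" "y \<in> skew_compl L" by (auto simp: W_def)
          have "\<omega> y (F y) = 0" using yU lL by (simp add: Fy om_simps skew_compl_iff)
          moreover have "F (F y) + (- c) *\<^sub>R F y + 0 *\<^sub>R y \<in> L"
          proof -
            have "F (F y) + (- c) *\<^sub>R F y + 0 *\<^sub>R y = F l" by (simp add: Fy F_simps)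
            then show ?thesis using L(3)[OF lL] by simp
          qed
          ultimately show False using ext[OF yU False] by blast
        qed
      next
        case False
        then have b: "b > 0" by simp
        \<comment> \<open>\<open>G\<close> maps \<open>L + span {x}\<close> into the smaller space
          \<open>L\<close>, so it kills a nonzero vector.\<close>
        define G where "G = (\<lambda>u. F (F u) + b *\<^sub>R u)"
        have lG: "linear G" unfolding G_def by (intro linearI) (simp_all add: F_simps algebra_simps)
        define L' where "L' = {l + s |l s. l \<in> L \<and> s \<in> span {x}}"
        have sL': "subspace L'" unfolding L'_def by (intro subspace_sums L subspace_span)
        have GL: "G u \<in> L" if u: "u \<in> L'" for u
        proof -
          obtain l c where l: "l \<in> L" "u = l + c *\<^sub>R x"
            using u by (auto simp: L'_def span_singleton)
          have "G u = F (F l) + b *\<^sub>R l + c *\<^sub>R (F (F x) + b *\<^sub>R x)"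
            by (simp add: G_def l F_simps algebra_simps)
          also have "\<dots> \<in> L" using L l rel by (auto intro!: subspace_add[OF L(1)] subspace_scale[OF L(1)])
          finally show ?thesis .
        qed
        have "L \<inter> span {x} \<subseteq> {0}"
        proof safe
          fix u assume u: "u \<in> L" "u \<in> span {x}"
          then obtain c where c: "u = c *\<^sub>R x" by (auto simp: span_singleton)
          show "u = 0"
          proof (rule ccontr)
            assume "u \<noteq> 0"
            then have "x = (1 / c) *\<^sub>R u" using c by auto
            then show False using subspace_scale[OF L(1) u(1)] x(2) by metis
          qed
        qed
        then have "dim L' = dim L + dim (span {x})"
          unfolding L'_def by (intro dim_direct_sum L subspace_span)
        moreover have "x \<noteq> 0" using x L(1) by (auto simp: subspace_0)
        ultimately have dL': "dim L < dim L'" by simp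
        have "\<not> inj_on G L'"
        proof
          assume "inj_on G L'"
          then have "dim (G ` L') = dim L'"
            using dim_image_eq[OF lG, of L'] sL' by (simp add: span_eq_iff[THEN iffD2])
          moreover have "dim (G ` L') \<le> dim L" using GL by (intro dim_subset) auto
          ultimately show False using dL' by simp
        qed
        then obtain u where u: "u \<in> L'" "G u = 0" "u \<noteq> 0"
          using linear_inj_on_iff_eq_0[OF lG sL'] by blast
        have "F (F u) = - b *\<^sub>R u" using u(2) by (simp add: G_def eq_neg_iff_add_eq_0)
        moreover have "u \<in> U"
          using u(1) L(2) xU U(1) by (auto simp: L'_def span_singleton intro!: subspace_add subspace_scale)
        ultimately show False using nimag[of u b] b u(3) by simp
      qed
    qed
  qed
  then show thesis using that L by blast
qed

end

section \<open>Positivity of the frequency sum and the reference Lagrangian\<close>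

text \<open>\<open>no_invariant\<close> is controllability without coordinates, \<open>F_psi\<close>
  is Hamilton's equations in the coordinates \<open>\<psi>\<close>, and
  \<open>\<omega> z (F z)\<close> stands for 2 H(z). \<open>imaginary_in_range\<close> confines to
  \<open>range \<psi>\<close> the vectors that \<open>invariant_lagrangian\<close> has to
  exclude.\<close>

locale lq_normal_form = hamiltonian_field \<omega> F
  for \<omega> :: "'a::euclidean_space \<Rightarrow> 'a \<Rightarrow> real" and F +
  fixes V :: "'a set" and \<psi> :: "(real^'d) \<times> (real^'d) \<Rightarrow> 'a" and freq :: "'d \<Rightarrow> real"
  assumes subspace_V: "subspace V" and V_eq: "V = skew_compl V"
    and nonneg_V: "z \<in> V \<Longrightarrow> 0 \<le> \<omega> z (F z)"
    and no_invariant: "subspace D \<Longrightarrow> D \<subseteq> V \<Longrightarrow> (\<And>x. x \<in> D \<Longrightarrow> F x \<in> D) \<Longrightarrow> D \<subseteq> {0}"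
    and linear_psi: "linear \<psi>" and inj_psi: "inj \<psi>"
    and omega_psi: "\<omega> (\<psi> (p, x)) (\<psi> (p', x')) = p \<bullet> x' - x \<bullet> p'"
    and F_psi: "F (\<psi> (p, x)) = \<psi> (- (\<chi> j. freq j * x $ j), \<chi> j. freq j * p $ j)"
    and imaginary_in_range: "b > 0 \<Longrightarrow> F (F u) = - b *\<^sub>R u \<Longrightarrow> u \<in> range \<psi>"
begin

lemmas psi_simps = linear_add[OF linear_psi] linear_scale[OF linear_psi] linear_0[OF linear_psi]
  linear_neg[OF linear_psi] linear_diff[OF linear_psi]

lemma psi_eq_0_iff: "\<psi> y = 0 \<longleftrightarrow> y = 0"
  using inj_psi linear_injective_0[OF linear_psi] linear_0[OF linear_psi] by blast

lemma isotropic_V: "x \<in> V \<Longrightarrow> y \<in> V \<Longrightarrow> \<omega> x y = 0"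
  using V_eq skew_compl_iff[of x V] by blast

lemma form_sym: "\<omega> x (F y) = \<omega> y (F x)"
  using skew_F[of x y] skew[of "F x" y] by simp

lemma bilinear_form: "bilinear (\<lambda>x y. \<omega> x (F y))"
  unfolding bilinear_def by (intro conjI allI linearI) (simp_all add: om_simps F_simps)

text \<open>A null vector of the nonnegative form on \<open>V\<close> pairs to zero with all of
  \<open>V\<close>. By skewness of \<open>F\<close> this puts \<open>F x\<close> into the skew
  complement of \<open>V\<close>, which is \<open>V\<close>.\<close>

lemma null_invariant:
  assumes "x \<in> V" "\<omega> x (F x) = 0"
  shows "F x \<in> V"
proof -
  have "\<omega> x (F y) = 0" if "y \<in> V" for y
    using semidefinite_null[OF bilinear_form form_sym subspace_V nonneg_V assms that] .
  then have "F x \<in> skew_compl V"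
    by (simp add: skew_compl_iff skew_F)
  then show ?thesis using V_eq by blast
qed

text \<open>The complex structure that turns the symplectic form into the inner product: a subspace
  is isotropic exactly when \<open>J\<close> maps it into its orthogonal complement.\<close>

definition J :: "(real^'d) \<times> (real^'d) \<Rightarrow> (real^'d) \<times> (real^'d)" where
  "J y = (- snd y, fst y)"

lemma omega_psi_J: "\<omega> (\<psi> y) (\<psi> y') = J y \<bullet> y'"
  using omega_psi[of "fst y" "snd y" "fst y'" "snd y'"]
  by (simp add: J_def inner_prod_def)

lemma subspace_range: "subspace (range \<psi>)"
  using linear_subspace_image[OF linear_psi subspace_UNIV] .

lemma dim_range: "dim (range \<psi>) = 2 * CARD('d)"
  using dim_image_eq[OF linear_psi, of UNIV] inj_psi by simp

lemma F_range: "x \<in> range \<psi> \<Longrightarrow> F x \<in> range \<psi>"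
  by (auto simp: F_psi)

lemma range_cap: "range \<psi> \<inter> skew_compl (range \<psi>) \<subseteq> {0}"
proof safe
  fix y assume "\<psi> y \<in> skew_compl (range \<psi>)"
  then have "J y \<bullet> J y = 0" unfolding skew_compl_iff by (metis omega_psi_J rangeI)
  then have "J y = 0" using inner_eq_zero_iff by blast
  then show "\<psi> y = 0" by (auto simp: J_def psi_eq_0_iff prod_eq_iff)
qed

text \<open>The maximality of \<open>L\<close> makes it the skew complement of
  \<open>range \<psi> + L\<close>, whence its dimension. On the invariant isotropic \<open>L\<close>
  the Hamiltonian vanishes, so \<open>null_invariant\<close> makes \<open>V \<inter> L\<close>
  invariant and \<open>no_invariant\<close> makes it zero.\<close>

lemma lagrangian_complement_exists:
  obtains L where "subspace L" "L \<subseteq> skew_compl (range \<psi>)" "\<And>x. x \<in> L \<Longrightarrow> F x \<in> L" "isotropic L"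
    "2 * (dim L + CARD('d)) = DIM('a)" "V \<inter> L \<subseteq> {0}"
proof -
  let ?U = "skew_compl (range \<psi>)"
  have FU: "F x \<in> ?U" if "x \<in> ?U" for x
    unfolding skew_compl_iff
  proof
    fix y assume "y \<in> range \<psi>"
    then have "F y \<in> range \<psi>" by (rule F_range)
    then have "\<omega> x (F y) = 0" using that unfolding skew_compl_iff by blast
    then show "\<omega> (F x) y = 0" by (simp add: skew_F)
  qed
  have nimag: "u = 0" if "u \<in> ?U" "b > 0" "F (F u) = - b *\<^sub>R u" for u b
    using range_cap imaginary_in_range[OF that(2,3)] that(1) by blast
  obtain L where L: "subspace L" "L \<subseteq> ?U" "\<And>x. x \<in> L \<Longrightarrow> F x \<in> L" "isotropic L"
    "?U \<inter> skew_compl L \<subseteq> L"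
    by (rule invariant_lagrangian[of ?U]) (use subspace_skew_compl FU nimag in blast)+
  define C where "C = {x + y |x y. x \<in> range \<psi> \<and> y \<in> L}"
  have sC: "subspace C" unfolding C_def by (intro subspace_sums subspace_range L)
  have "dim C = dim (range \<psi>) + dim L"
    unfolding C_def by (intro dim_direct_sum subspace_range L) (use range_cap L in blast)
  moreover have "skew_compl C = L"
  proof
    show "skew_compl C \<subseteq> L"
    proof
      fix x assume x: "x \<in> skew_compl C"
      have "\<omega> x y = 0" if "y \<in> range \<psi>" for y
      proof -
        have "y + 0 \<in> C" unfolding C_def using that L(1) subspace_0 by blast
        then show ?thesis using x by (simp add: skew_compl_iff)
      qed
      moreover have "\<omega> x y = 0" if "y \<in> L" for y
      proof -
        have "0 + y \<in> C" unfolding C_def using that subspace_range subspace_0 by blast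
        then show ?thesis using x by (simp add: skew_compl_iff)
      qed
      ultimately show "x \<in> L" using L(5) by (auto simp: skew_compl_iff)
    qed
    show "L \<subseteq> skew_compl C"
      using L(2) L(4) by (auto simp: C_def skew_compl_iff isotropic_def om_simps subset_iff)
  qed
  ultimately have "2 * (dim L + CARD('d)) = DIM('a)"
    using dim_skew_compl[OF sC] dim_range by simp
  moreover have "V \<inter> L \<subseteq> {0}"
  proof (rule no_invariant)
    show "subspace (V \<inter> L)" by (rule subspace_inter[OF subspace_V L(1)])
    fix x assume x: "x \<in> V \<inter> L"
    then show "F x \<in> V \<inter> L"
      using null_invariant[of x] L(3)[of x] isotropicD[OF L(4), of x "F x"] by simp
  qed simp
  ultimately show thesis using that L by blast
qed

end

locale lq_split = lq_normal_form \<omega> F V \<psi> freq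
  for \<omega> :: "'a::euclidean_space \<Rightarrow> 'a \<Rightarrow> real" and F V
    and \<psi> :: "(real^'d) \<times> (real^'d) \<Rightarrow> 'a" and freq +
  fixes L :: "'a set"
  assumes subspace_L: "subspace L" and L_compl: "L \<subseteq> skew_compl (range \<psi>)"
    and F_L: "z \<in> L \<Longrightarrow> F z \<in> L" and isotropic_L: "isotropic L"
    and dim_L: "2 * (dim L + CARD('d)) = DIM('a)" and V_L: "V \<inter> L \<subseteq> {0}"
begin

lemma omega_psi_L:
  assumes "l \<in> L"
  shows "\<omega> l (\<psi> y) = 0" "\<omega> (\<psi> y) l = 0"
proof -
  show "\<omega> l (\<psi> y) = 0" using L_compl assms unfolding skew_compl_def by blast
  then show "\<omega> (\<psi> y) l = 0" using skew[of "\<psi> y" l] by simp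
qed

lemma omega_L_L: "l \<in> L \<Longrightarrow> l' \<in> L \<Longrightarrow> \<omega> l l' = 0"
  using isotropicD[OF isotropic_L] .

definition energy :: "(real^'d) \<times> (real^'d) \<Rightarrow> real" where
  "energy y = (\<Sum>j\<in>UNIV. freq j * ((fst y $ j)\<^sup>2 + (snd y $ j)\<^sup>2))"

text \<open>\<open>F\<close> preserves \<open>L\<close>, which is isotropic and skew-orthogonal to
  \<open>range \<psi>\<close>, so the mixed terms and the term in \<open>l\<close> alone
  vanish.\<close>

lemma energy_eq:
  assumes "l \<in> L"
  shows "\<omega> (\<psi> y + l) (F (\<psi> y + l)) = energy y"
proof -
  have "\<omega> (\<psi> y + l) (F (\<psi> y + l)) = \<omega> (\<psi> y) (F (\<psi> y))"
    using assms F_L[OF assms] form_sym[of l "\<psi> y"]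
    by (simp add: om_simps F_simps omega_psi_L omega_L_L)
  also have "\<dots> = \<omega> (\<psi> (fst y, snd y)) (F (\<psi> (fst y, snd y)))" by simp
  also have "\<dots> = energy y"
    unfolding F_psi omega_psi
    by (simp add: energy_def inner_vec_def power2_eq_square algebra_simps sum.distrib sum_negf)
  finally show ?thesis .
qed

text \<open>The symplectic reduction of \<open>V\<close> by \<open>L\<close>, read in the coordinates \<open>\<psi>\<close>.\<close>

definition M :: "((real^'d) \<times> (real^'d)) set" where
  "M = {y. \<exists>l\<in>L. \<psi> y + l \<in> V}"

lemma subspace_M: "subspace M"
  unfolding subspace_def
proof (intro conjI ballI allI)
  show "0 \<in> M" using subspace_L subspace_V by (auto simp: M_def psi_simps subspace_0 intro!: bexI[of _ 0])
  fix y assume "y \<in> M"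
  then obtain l where l: "l \<in> L" "\<psi> y + l \<in> V" by (auto simp: M_def)
  have "\<psi> (c *\<^sub>R y) + c *\<^sub>R l \<in> V" for c
    using subspace_scale[OF subspace_V l(2), of c] by (simp add: psi_simps algebra_simps)
  then show "c *\<^sub>R y \<in> M" for c using subspace_scale[OF subspace_L l(1)] unfolding M_def by blast
  fix y' assume "y' \<in> M"
  then obtain l' where l': "l' \<in> L" "\<psi> y' + l' \<in> V" by (auto simp: M_def)
  have "\<psi> (y + y') + (l + l') \<in> V"
    using subspace_add[OF subspace_V l(2) l'(2)] by (simp add: psi_simps algebra_simps)
  then show "y + y' \<in> M" using subspace_add[OF subspace_L l(1) l'(1)] unfolding M_def by blast
qed

lemma isotropic_M:
  assumes "y \<in> M" "y' \<in> M"
  shows "J y \<bullet> y' = 0"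
proof -
  obtain l l' where l: "l \<in> L" "\<psi> y + l \<in> V" "l' \<in> L" "\<psi> y' + l' \<in> V"
    using assms by (auto simp: M_def)
  have "\<omega> (\<psi> y + l) (\<psi> y' + l') = 0" using l by (intro isotropic_V)
  then show ?thesis using l by (simp add: om_simps omega_psi_L omega_L_L omega_psi_J)
qed

lemma energy_M_nonneg:
  assumes "y \<in> M"
  shows "energy y \<ge> 0"
proof -
  obtain l where l: "l \<in> L" "\<psi> y + l \<in> V" using assms by (auto simp: M_def)
  show ?thesis using nonneg_V[OF l(2)] unfolding energy_eq[OF l(1)] .
qed

text \<open>As \<open>range \<psi> + L\<close> is the skew complement of \<open>L\<close>, this is
  the part of \<open>V\<close> that takes part in the reduction; \<open>M\<close> is its projection
  along \<open>L\<close>.\<close>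

definition D :: "'a set" where
  "D = V \<inter> {x + l |x l. x \<in> range \<psi> \<and> l \<in> L}"

lemma subspace_D: "subspace D"
  unfolding D_def by (intro subspace_inter subspace_V subspace_sums subspace_range subspace_L)

lemma dim_V: "2 * dim V = DIM('a)"
  using dim_skew_compl[OF subspace_V] V_eq[symmetric] by simp

lemma psi_L_cap: "range \<psi> \<inter> L \<subseteq> {0}"
  using range_cap L_compl by blast

lemma dim_D: "CARD('d) \<le> dim D"
proof -
  define C where "C = {x + l |x l. x \<in> range \<psi> \<and> l \<in> L}"
  have "dim C = 2 * CARD('d) + dim L"
    unfolding C_def using dim_direct_sum[OF subspace_range subspace_L psi_L_cap] dim_range by simp
  moreover have "subspace C" unfolding C_def by (intro subspace_sums subspace_range subspace_L)
  then have "dim V + dim C \<le> dim D + DIM('a)"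
    unfolding D_def C_def[symmetric] by (rule dim_Int_ge[OF subspace_V])
  ultimately show ?thesis using dim_V dim_L by arith
qed

text \<open>Together with \<open>isotropic_M\<close> this makes \<open>M\<close> Lagrangian. The
  projection of \<open>D\<close> along \<open>L\<close> loses no dimension because \<open>V\<close>
  meets \<open>L\<close> only in 0.\<close>

lemma dim_M_ge: "CARD('d) \<le> dim M"
proof -
  have sM: "subspace (\<psi> ` M)" by (rule linear_subspace_image[OF linear_psi subspace_M])
  have "D \<inter> L \<subseteq> {0}" using V_L by (auto simp: D_def)
  then have "dim {x + l |x l. x \<in> D \<and> l \<in> L} = dim D + dim L"
    by (rule dim_direct_sum[OF subspace_D subspace_L])
  moreover have "{x + l |x l. x \<in> D \<and> l \<in> L} \<subseteq> {x + l |x l. x \<in> \<psi> ` M \<and> l \<in> L}"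
  proof safe
    fix x l assume x: "x \<in> D" and l: "l \<in> L"
    then obtain y l' where y: "x = \<psi> y + l'" "l' \<in> L" "x \<in> V" by (auto simp: D_def)
    then have "y \<in> M" by (auto simp: M_def)
    then show "\<exists>x' l'. x + l = x' + l' \<and> x' \<in> \<psi> ` M \<and> l' \<in> L"
      using y l subspace_add[OF subspace_L y(2) l]
      by (intro exI[of _ "\<psi> y"] exI[of _ "l' + l"]) (auto simp: algebra_simps)
  qed
  then have "dim {x + l |x l. x \<in> D \<and> l \<in> L} \<le> dim {x + l |x l. x \<in> \<psi> ` M \<and> l \<in> L}"
    by (rule dim_subset)
  moreover have "\<psi> ` M \<inter> L \<subseteq> {0}" using psi_L_cap by blast
  then have "dim {x + l |x l. x \<in> \<psi> ` M \<and> l \<in> L} = dim (\<psi> ` M) + dim L"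
    by (rule dim_direct_sum[OF sM subspace_L])
  moreover have "dim (\<psi> ` M) \<le> dim M" by (rule dim_image_le[OF linear_psi])
  ultimately show ?thesis using dim_D by simp
qed

text \<open>
  For an orthonormal basis \<open>B\<close> of the Lagrangian \<open>M\<close>, the vectors of \<open>B\<close> and \<open>J ` B\<close> form an
  orthonormal basis of the whole space, and the energy takes the same value at \<open>b\<close> and \<open>J b\<close>.
\<close>

lemma energy_trace:
  obtains B where "B \<subseteq> M" "span B = M" "finite B" "(\<Sum>b\<in>B. energy b) = (\<Sum>j\<in>UNIV. freq j)"
proof -
  obtain B where B: "B \<subseteq> M" "pairwise orthogonal B" "\<And>x. x \<in> B \<Longrightarrow> norm x = 1"
    "independent B" "card B = dim M" "span B = M"
    using orthonormal_basis_subspace[OF subspace_M] by blast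
  have fin: "finite B" using B(4) by (rule independent_imp_finite)
  have JJ: "J y \<bullet> J y' = y \<bullet> y'" for y y' by (simp add: J_def inner_prod_def)
  have injJ: "inj_on J B" by (auto simp: inj_on_def J_def prod_eq_iff)
  have nJ: "norm (J y) = norm y" for y by (simp add: norm_eq_sqrt_inner JJ)
  have cross: "J b \<bullet> b' = 0" if "b \<in> B" "b' \<in> B" for b b'
    using isotropic_M B(1) that by blast
  have disj: "B \<inter> J ` B = {}"
  proof (rule ccontr)
    assume "B \<inter> J ` B \<noteq> {}"
    then obtain b b' where "b \<in> B" "b' \<in> B" "b = J b'" by blast
    then have "b \<bullet> b = 0" using cross by metis
    then show False using B(3)[OF \<open>b \<in> B\<close>] by simp
  qed
  let ?O = "B \<union> J ` B"
  have orth: "pairwise orthogonal ?O"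
  proof (rule pairwiseI, unfold orthogonal_def)
    fix x y assume xy: "x \<in> ?O" "y \<in> ?O" "x \<noteq> y"
    have BB: "b \<bullet> b' = 0" if "b \<in> B" "b' \<in> B" "b \<noteq> b'" for b b'
      using B(2) that unfolding pairwise_def orthogonal_def by blast
    from xy consider "x \<in> B" "y \<in> B" | b where "x \<in> B" "b \<in> B" "y = J b"
      | b where "b \<in> B" "x = J b" "y \<in> B" | b b' where "b \<in> B" "b' \<in> B" "x = J b" "y = J b'"
      by blast
    then show "x \<bullet> y = 0"
    proof cases
      case 1
      then show ?thesis using BB xy(3) by blast
    next
      case 2
      then show ?thesis using cross[of b x] by (simp add: inner_commute)
    next
      case 3
      then show ?thesis using cross[of b y] by simp
    next
      case 4
      then show ?thesis using BB[of b b'] xy(3) by (auto simp: JJ)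
    qed
  qed
  have norm1: "norm x = 1" if "x \<in> ?O" for x using that B(3) nJ by (metis UnE imageE)
  have ind: "independent ?O"
    using norm1 by (intro pairwise_orthogonal_independent[OF orth]) (metis norm_zero zero_neq_one)
  have "card ?O = card B + card (J ` B)" using fin disj by (intro card_Un_disjoint) auto
  then have cardO: "card ?O = 2 * dim M" using B(5) card_image[OF injJ] by simp
  have "span ?O = UNIV"
  proof -
    have "dim ?O = card ?O" by (rule dim_eq_card_independent[OF ind])
    moreover have "card ?O \<ge> DIM((real^'d) \<times> (real^'d))" using cardO dim_M_ge by simp
    moreover have "dim ?O \<le> DIM((real^'d) \<times> (real^'d))" by (rule dim_subset_UNIV)
    ultimately have "dim ?O = DIM((real^'d) \<times> (real^'d))" by simp
    then show ?thesis using dim_eq_full by blast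
  qed
  then have expand: "(\<Sum>b\<in>?O. (f \<bullet> b) *\<^sub>R b) = f" for f
    using fin by (intro orthonormal_basis_expand orth norm1) auto
  have parseval: "f \<bullet> f = (\<Sum>b\<in>B. (f \<bullet> b)\<^sup>2 + (f \<bullet> J b)\<^sup>2)" for f
  proof -
    have "f \<bullet> f = f \<bullet> (\<Sum>b\<in>?O. (f \<bullet> b) *\<^sub>R b)" by (simp add: expand)
    also have "\<dots> = (\<Sum>b\<in>?O. (f \<bullet> b)\<^sup>2)" by (simp add: inner_sum_right power2_eq_square)
    also have "\<dots> = (\<Sum>b\<in>B. (f \<bullet> b)\<^sup>2) + (\<Sum>b\<in>J ` B. (f \<bullet> b)\<^sup>2)"
      using fin disj by (intro sum.union_disjoint) auto
    finally show ?thesis by (simp add: sum.reindex[OF injJ] sum.distrib)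
  qed
  \<comment> \<open>Parseval for a coordinate vector: over \<open>B\<close>, the squared coordinates
    belonging to one frequency sum to 1, so each frequency enters the trace with weight 1.\<close>
  have "(\<Sum>b\<in>B. (fst b $ j)\<^sup>2 + (snd b $ j)\<^sup>2) = 1" for j
    using parseval[of "(axis j 1, 0)"]
    by (simp add: J_def inner_prod_def inner_axis' inner_axis_axis)
  then have "(\<Sum>j\<in>UNIV. freq j) = (\<Sum>j\<in>UNIV. freq j * (\<Sum>b\<in>B. (fst b $ j)\<^sup>2 + (snd b $ j)\<^sup>2))"
    by simp
  also have "\<dots> = (\<Sum>b\<in>B. energy b)"
    unfolding energy_def sum_distrib_left by (rule sum.swap)
  finally have "(\<Sum>j\<in>UNIV. freq j) = (\<Sum>b\<in>B. energy b)" .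
  then show thesis using that[OF B(1,6) fin] by simp
qed

text \<open>By \<open>energy_trace\<close> the sum is one of nonnegative energies. If it were not
  positive, all of them would vanish, hence H on \<open>M\<close> and on \<open>D\<close>; then
  \<open>null_invariant\<close> would make \<open>D\<close> an invariant subspace of
  \<open>V\<close> of positive dimension.\<close>

lemma freq_sum_pos: "(\<Sum>j\<in>UNIV. freq j) > 0"
proof (rule ccontr)
  assume np: "\<not> (\<Sum>j\<in>UNIV. freq j) > 0"
  obtain B where B: "B \<subseteq> M" "span B = M" "finite B" "(\<Sum>b\<in>B. energy b) = (\<Sum>j\<in>UNIV. freq j)"
    by (rule energy_trace)
  have nn: "energy b \<ge> 0" if "b \<in> B" for b using energy_M_nonneg B(1) that by blast
  then have "(\<Sum>b\<in>B. energy b) = 0" using np B(4) sum_nonneg[of B energy] by simp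
  then have zero: "energy b = 0" if "b \<in> B" for b
    using sum_nonneg_eq_0_iff[OF B(3), of energy] nn that by simp
  define \<beta> where "\<beta> = (\<lambda>y y'. \<omega> (\<psi> y) (F (\<psi> y')))"
  have bb: "bilinear \<beta>"
    unfolding \<beta>_def bilinear_def by (intro conjI allI linearI) (simp_all add: om_simps F_simps psi_simps)
  have bsym: "\<beta> y y' = \<beta> y' y" for y y' unfolding \<beta>_def by (rule form_sym)
  have be: "\<beta> y y = energy y" for y
    using energy_eq[of 0 y] subspace_0[OF subspace_L] by (simp add: \<beta>_def)
  have zeroM: "energy y = 0" if y: "y \<in> M" for y
  proof -
    have "\<beta> b y = 0" if "b \<in> B" for b
      by (rule semidefinite_null[OF bb bsym subspace_M])
        (use B(1) zero y that energy_M_nonneg in \<open>auto simp: be\<close>)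
    moreover have "subspace {z. \<beta> z y = 0}"
      by (simp add: subspace_def bilinear_ladd[OF bb] bilinear_lmul[OF bb] bilinear_lzero[OF bb])
    ultimately have "span B \<subseteq> {z. \<beta> z y = 0}" by (intro span_minimal) auto
    then have "\<beta> y y = 0" using y B(2) by blast
    then show ?thesis by (simp add: be)
  qed
  have "D \<subseteq> {0}"
  proof (rule no_invariant[OF subspace_D])
    show "D \<subseteq> V" by (auto simp: D_def)
    fix x assume "x \<in> D"
    then obtain y l where y: "x \<in> V" "l \<in> L" "x = \<psi> y + l" by (auto simp: D_def)
    then have "y \<in> M" by (auto simp: M_def)
    then have "\<omega> x (F x) = 0" using energy_eq[OF y(2), of y] zeroM y by simp
    then have "F x \<in> V" using null_invariant y by simp
    moreover have "F x = F (\<psi> y) + F l" using y by (simp add: F_simps)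
    ultimately show "F x \<in> D" using F_range[of "\<psi> y"] F_L[OF y(2)] unfolding D_def by blast
  qed
  then have "dim D = 0" using dim_eq_0 by blast
  then show False using dim_D zero_less_card_finite[where 'a = 'd] by linarith
qed

section \<open>Rotated coordinate Lagrangians\<close>

definition ray :: "real \<Rightarrow> real^'d \<Rightarrow> (real^'d) \<times> (real^'d)" where
  "ray \<theta> r = (cos \<theta> *\<^sub>R r, sin \<theta> *\<^sub>R r)"

lemma linear_ray: "linear (ray \<theta>)"
  by (intro linearI) (auto simp: ray_def algebra_simps)

lemma inner_ray: "ray \<theta> r \<bullet> ray \<theta>' r' = cos (\<theta> - \<theta>') * (r \<bullet> r')"
  by (simp add: ray_def inner_prod_def cos_diff algebra_simps)

text \<open>At equal angles the right-hand side is zero, so every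
  \<open>range (ray \<theta>)\<close> is a Lagrangian subspace.\<close>

lemma J_inner_ray: "J (ray \<theta> r) \<bullet> ray \<theta>' r' = sin (\<theta>' - \<theta>) * (r \<bullet> r')"
  by (simp add: ray_def J_def inner_prod_def sin_diff algebra_simps)

lemma ray_eq_0_iff: "ray \<theta> r = 0 \<longleftrightarrow> r = 0"
proof -
  have "ray \<theta> r \<bullet> ray \<theta> r = r \<bullet> r" by (simp add: inner_ray)
  then show ?thesis by (metis inner_eq_zero_iff)
qed

text \<open>
  Nonzero vectors of \<open>M\<close> lying in planes \<open>range (ray \<theta>)\<close> with different angles are orthogonal,
  so only finitely many angles fail.
\<close>

lemma transversal_angle:
  obtains \<theta> where "\<And>r. ray \<theta> r \<in> M \<Longrightarrow> r = 0"
proof -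
  have "\<exists>\<theta>. \<forall>r. ray \<theta> r \<in> M \<longrightarrow> r = 0"
  proof (rule ccontr)
    assume "\<not> ?thesis"
    then obtain r where r: "\<And>\<theta>. ray \<theta> (r \<theta>) \<in> M" "\<And>\<theta>. r \<theta> \<noteq> 0" by metis
    define y where "y = (\<lambda>\<theta>. ray \<theta> (r \<theta>))"
    have yM: "y \<theta> \<in> M" and y0: "y \<theta> \<noteq> 0" for \<theta>
      using r by (auto simp: y_def ray_eq_0_iff)
    \<comment> \<open>Two different angles in an open interval of length pi never differ by a
      multiple of pi.\<close>
    have orth: "y \<theta> \<bullet> y \<theta>' = 0" if "\<theta> \<in> {0<..<pi}" "\<theta>' \<in> {0<..<pi}" "\<theta> \<noteq> \<theta>'" for \<theta> \<theta>'
    proof -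
      have "sin (\<theta>' - \<theta>) * (r \<theta> \<bullet> r \<theta>') = 0"
        using isotropic_M[OF yM yM, of \<theta> \<theta>'] by (simp add: y_def J_inner_ray)
      moreover have "sin (\<theta>' - \<theta>) \<noteq> 0"
      proof (cases "\<theta> < \<theta>'")
        case True
        then show ?thesis using sin_gt_zero[of "\<theta>' - \<theta>"] that by simp
      next
        case False
        then have "sin (\<theta> - \<theta>') > 0" using that by (intro sin_gt_zero) auto
        then show ?thesis using sin_minus[of "\<theta> - \<theta>'"] by simp
      qed
      ultimately show ?thesis by (simp add: y_def inner_ray)
    qed
    have inj: "inj_on y {0<..<pi}"
    proof (rule inj_onI, rule ccontr)
      fix \<theta> \<theta>' assume "\<theta> \<in> {0<..<pi}" "\<theta>' \<in> {0<..<pi}" "y \<theta> = y \<theta>'" "\<theta> \<noteq> \<theta>'"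
      then have "y \<theta> \<bullet> y \<theta> = 0" using orth by metis
      then show False using y0 by simp
    qed
    have "independent (y ` {0<..<pi})"
      using orth y0 by (intro pairwise_orthogonal_independent) (auto simp: pairwise_def orthogonal_def intro!: orth)
    then have "finite (y ` {0<..<pi})" by (rule independent_imp_finite)
    then have "finite {0<..<pi}" using inj finite_imageD by blast
    then show False using infinite_Ioo[of 0 pi] by simp
  qed
  then show thesis using that by blast
qed

end

section \<open>The form comparing a Lagrangian splitting with its image under the flow\<close>

locale lagrangian_splitting = hamiltonian_field \<omega> F
  for \<omega> :: "'a::euclidean_space \<Rightarrow> 'a \<Rightarrow> real" and F +
  fixes V K :: "'a set"
  assumes sub_V: "subspace V" and sub_K: "subspace K"
    and iso_V: "isotropic V" and iso_K: "isotropic K"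
    and V_K: "V \<inter> K \<subseteq> {0}" and dim_V_K: "dim V + dim K = DIM('a)"
begin

definition proj :: "'a \<Rightarrow> 'a" where
  "proj z = (SOME u. u \<in> V \<and> z - u \<in> K)"

lemma proj: "proj z \<in> V" "z - proj z \<in> K"
proof -
  define Z where "Z = {u + l |u l. u \<in> V \<and> l \<in> K}"
  have "dim Z = DIM('a)" unfolding Z_def using dim_direct_sum[OF sub_V sub_K V_K] dim_V_K by simp
  moreover have "subspace Z" unfolding Z_def by (rule subspace_sums[OF sub_V sub_K])
  ultimately have "Z = UNIV" using dim_eq_full[of Z] span_eq_iff[of Z] by metis
  then obtain u l where "z = u + l" "u \<in> V" "l \<in> K" unfolding Z_def by blast
  then have "\<exists>u. u \<in> V \<and> z - u \<in> K" by (intro exI[of _ u]) simp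
  from someI_ex[OF this] show "proj z \<in> V" "z - proj z \<in> K" by (auto simp: proj_def)
qed

lemma proj_eqI:
  assumes "u \<in> V" "z - u \<in> K"
  shows "proj z = u"
proof -
  have "proj z - u \<in> V" using proj assms sub_V by (simp add: subspace_diff)
  moreover have "(z - u) - (z - proj z) \<in> K" by (rule subspace_diff[OF sub_K assms(2) proj(2)])
  ultimately have "proj z - u \<in> V \<inter> K" by simp
  then show ?thesis using V_K by fastforce
qed

lemma linear_proj: "linear proj"
proof (rule linearI)
  fix x y :: 'a and c :: real
  have "(x - proj x) + (y - proj y) \<in> K" by (rule subspace_add[OF sub_K proj(2) proj(2)])
  then show "proj (x + y) = proj x + proj y"
    using proj sub_V by (intro proj_eqI) (auto simp: subspace_add algebra_simps)
  have "c *\<^sub>R (x - proj x) \<in> K" by (rule subspace_scale[OF sub_K proj(2)])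
  then show "proj (c *\<^sub>R x) = c *\<^sub>R proj x"
    using proj sub_V by (intro proj_eqI) (auto simp: subspace_scale algebra_simps)
qed

text \<open>Twice the polarization of the quadratic form \<open>v + l \<mapsto> \<omega> v l\<close>, where \<open>v \<in> V\<close> and \<open>l \<in> K\<close>.\<close>

definition pairing :: "'a \<Rightarrow> 'a \<Rightarrow> real" where
  "pairing z w = \<omega> (proj z) w + \<omega> (proj w) z"

lemma bilinear_pairing: "bilinear pairing"
  unfolding pairing_def bilinear_def
  by (intro conjI allI linearI)
    (simp_all add: om_simps linear_add[OF linear_proj] linear_scale[OF linear_proj] algebra_simps)

lemma pairing_sym: "pairing z w = pairing w z"
  by (simp add: pairing_def)

text \<open>\<open>2 *\<^sub>R proj z - z\<close> is the reflection that fixes \<open>V\<close> and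
  negates \<open>K\<close>. The two terms of \<open>pairing\<close> merge because \<open>V\<close>
  and \<open>K\<close> are isotropic, and nondegeneracy of \<open>\<omega>\<close> then gives access
  to kernels.\<close>

lemma pairing_eq: "pairing z w = \<omega> (2 *\<^sub>R proj z - z) w"
proof -
  have "\<omega> (z - proj z) (w - proj w) = 0" "\<omega> (proj z) (proj w) = 0"
    using proj iso_K iso_V isotropicD by blast+
  then show ?thesis
    using skew[of "proj w" z] by (simp add: pairing_def om_simps scaleR_2)
qed

lemma pairing_K: "l \<in> K \<Longrightarrow> pairing l w = \<omega> w l"
  using proj_eqI[of 0 l] subspace_0[OF sub_V] skew[of w l] by (simp add: pairing_eq om_simps)

definition crossing_form :: "real \<Rightarrow> 'a \<Rightarrow> 'a \<Rightarrow> real" where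
  "crossing_form t z w = pairing z w - pairing (flow F t z) (flow F t w)"

lemmas flow_simps = linear_add[OF linear_flow[OF linear_F]] linear_scale[OF linear_flow[OF linear_F]]
  linear_0[OF linear_flow[OF linear_F]] linear_diff[OF linear_flow[OF linear_F]]

lemmas pairing_simps = bilinear_ladd[OF bilinear_pairing] bilinear_radd[OF bilinear_pairing]
  bilinear_lmul[OF bilinear_pairing] bilinear_rmul[OF bilinear_pairing]

lemma bilinear_crossing_form: "bilinear (crossing_form t)"
  unfolding crossing_form_def bilinear_def
  by (intro conjI allI linearI) (simp_all add: pairing_simps flow_simps algebra_simps)

lemma crossing_form_sym: "crossing_form t z w = crossing_form t w z"
  by (simp add: crossing_form_def pairing_sym)

definition crossing_deriv :: "real \<Rightarrow> 'a \<Rightarrow> 'a \<Rightarrow> real" where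
  "crossing_deriv t z w =
    - (pairing (F (flow F t z)) (flow F t w) + pairing (flow F t z) (F (flow F t w)))"

lemma bilinear_crossing_deriv: "bilinear (crossing_deriv t)"
  unfolding crossing_deriv_def bilinear_def
  by (intro conjI allI linearI) (simp_all add: pairing_simps flow_simps F_simps algebra_simps)

lemma crossing_form_has_derivative:
  "((\<lambda>t. crossing_form t z w) has_real_derivative crossing_deriv t z w) (at t)"
  unfolding crossing_form_def crossing_deriv_def
  by (rule derivative_eq_intros bilinear_flow_has_derivative[OF linear_F bilinear_pairing] refl | simp)+

lemma flow_symplectic: "\<omega> (flow F t x) (flow F t y) = \<omega> x y"
  by (rule flow_preserves[OF linear_F bil skew_F])

lemma crossing_K_radical:
  assumes "l \<in> K" "flow F t l \<in> K"
  shows "l \<in> radical (crossing_form t)"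
  using assms by (simp add: radical_def crossing_form_def pairing_K flow_symplectic)

text \<open>For the field of H this is 4 H(l), by conservation of energy: the sign of H decides how
  the index moves when \<open>l\<close> returns to \<open>K\<close>.\<close>

lemma crossing_deriv_K:
  assumes "l \<in> K" "flow F t l \<in> K"
  shows "crossing_deriv t l l = 2 * \<omega> l (F l)"
proof -
  have "crossing_deriv t l l = - 2 * \<omega> (F (flow F t l)) (flow F t l)"
    using assms pairing_sym[of "F (flow F t l)"] by (simp add: crossing_deriv_def pairing_K)
  also have "\<dots> = 2 * \<omega> (flow F t l) (flow F t (F l))"
    using skew[of "F (flow F t l)" "flow F t l"] by (simp add: flow_commute[OF linear_F])
  finally show ?thesis by (simp add: flow_symplectic)
qed

text \<open>By \<open>pairing_eq\<close> and the invariance of \<open>\<omega>\<close>, the flow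
  commutes with the reflection at a kernel vector \<open>z\<close>, hence with \<open>proj\<close>.
  So each component of \<open>z\<close> flows back into its own subspace.\<close>

lemma crossing_radical:
  assumes "z \<in> radical (crossing_form t)"
  shows "flow F t (proj z) \<in> V" "flow F t (z - proj z) \<in> K"
proof -
  let ?g = "flow F t"
  have "?g (2 *\<^sub>R proj z - z) = 2 *\<^sub>R proj (?g z) - ?g z"
  proof -
    have "\<omega> (?g (2 *\<^sub>R proj z - z) - (2 *\<^sub>R proj (?g z) - ?g z)) y = 0" for y
    proof -
      define w where "w = flow F (- t) y"
      have y: "y = ?g w" by (simp add: w_def flow_flow_minus[OF linear_F])
      have "pairing z w = pairing (?g z) (?g w)"
        using assms by (simp add: radical_def crossing_form_def)
      then have "\<omega> (2 *\<^sub>R proj z - z) w = \<omega> (2 *\<^sub>R proj (?g z) - ?g z) y"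
        by (simp only: pairing_eq y)
      then have "\<omega> (?g (2 *\<^sub>R proj z - z)) y = \<omega> (2 *\<^sub>R proj (?g z) - ?g z) y"
        by (simp only: y flow_symplectic)
      then show ?thesis by (simp add: bilinear_lsub[OF bil])
    qed
    then show ?thesis using nondegenerate by (metis right_minus_eq)
  qed
  then have "2 *\<^sub>R ?g (proj z) = 2 *\<^sub>R proj (?g z)" by (simp add: flow_simps)
  then have e: "?g (proj z) = proj (?g z)" by simp
  then show "?g (proj z) \<in> V" using proj by simp
  show "?g (z - proj z) \<in> K" using e proj by (simp add: flow_simps)
qed

lemma dim_crossing_radical:
  "dim (radical (crossing_form t)) \<le> dim {u \<in> V. flow F t u \<in> V} + dim {l \<in> K. flow F t l \<in> K}"
proof -
  let ?A = "{u \<in> V. flow F t u \<in> V}" and ?B = "{l \<in> K. flow F t l \<in> K}"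
  have sA: "subspace ?A" and sB: "subspace ?B"
    using sub_V sub_K by (auto simp: subspace_def flow_simps)
  have "radical (crossing_form t) \<subseteq> {x + y |x y. x \<in> ?A \<and> y \<in> ?B}"
  proof
    fix z assume z: "z \<in> radical (crossing_form t)"
    have "z = proj z + (z - proj z)" by simp
    then show "z \<in> {x + y |x y. x \<in> ?A \<and> y \<in> ?B}" using crossing_radical[OF z] proj by blast
  qed
  then have "dim (radical (crossing_form t)) \<le> dim {x + y |x y. x \<in> ?A \<and> y \<in> ?B}" by (rule dim_subset)
  also have "\<dots> = dim ?A + dim ?B" by (rule dim_direct_sum[OF sA sB]) (use V_K in auto)
  finally show ?thesis .
qed

end

section \<open>Counting crossings\<close>

text \<open>\<open>n\<close> drops by at least \<open>g\<close> on arriving at a point and rises by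
  at most \<open>h\<close> on leaving it, so \<open>n\<close> corrected by the accumulated
  \<open>g\<close> and \<open>h\<close> never increases. The total drop thus exceeds the total rise
  by at most the range of \<open>n\<close>.\<close>

lemma jump_sum:
  fixes n g h :: "real \<Rightarrow> nat"
  assumes T: "T > 0" and fin: "finite S" and S: "S \<subseteq> {0<..T}"
    and outside: "\<And>s. 0 < s \<Longrightarrow> s \<le> T \<Longrightarrow> s \<notin> S \<Longrightarrow> h s = 0 \<and> g s = 0"
    and after: "\<And>x. \<exists>\<eta>>0. \<forall>t. x < t \<and> t < x + \<eta> \<longrightarrow> n t \<le> n x + h x"
    and before: "\<And>x. \<exists>\<eta>>0. \<forall>t. x - \<eta> < t \<and> t < x \<longrightarrow> n x + g x \<le> n t"
    and bound: "\<And>t. n t \<le> N"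
  shows "(\<Sum>s\<in>S. g s) \<le> N + (\<Sum>s\<in>S. h s)"
proof -
  \<comment> \<open>The sum of \<open>g\<close> includes the point \<open>t\<close>, that of
    \<open>h\<close> does not: at \<open>t\<close> itself the drop has happened and the rise is
    still to come.\<close>
  define \<Phi> where "\<Phi> = (\<lambda>t. int (n t) + int (\<Sum>s\<in>S \<inter> {..t}. g s) - int (\<Sum>s\<in>S \<inter> {..<t}. h s))"
  obtain d0 where d0: "d0 > 0" "\<And>x. x \<in> S \<Longrightarrow> x \<noteq> 0 \<Longrightarrow> d0 \<le> dist 0 x"
    using finite_set_avoid[OF fin, of 0] by blast
  \<comment> \<open>The count starts after 0 and before the first point of \<open>S\<close>. Time 0
    is outside the range of \<open>outside\<close>; in the application the whole form vanishes
    there.\<close>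
  define \<epsilon> where "\<epsilon> = min T (d0 / 2)"
  have e: "0 < \<epsilon>" "\<epsilon> \<le> T" using T d0 by (auto simp: \<epsilon>_def)
  have Se: "S \<inter> {..\<epsilon>} = {}" "S \<inter> {..<\<epsilon>} = {}"
    using d0 S by (force simp: \<epsilon>_def)+
  have "0 < \<epsilon> \<longrightarrow> T \<le> T \<longrightarrow> \<Phi> T \<le> \<Phi> \<epsilon>"
  \<comment> \<open>Bisection: it suffices that \<open>\<Phi>\<close> does not increase across short
    intervals around each point.\<close>
  proof (induction rule: Bolzano[OF e(2), where P = "\<lambda>a b. 0 < a \<longrightarrow> b \<le> T \<longrightarrow> \<Phi> b \<le> \<Phi> a"])
    case (1 a b c)
    then show ?case by force
  next
    case (2 x)
    then have x: "0 < x" "x \<le> T" using e by auto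
    obtain \<eta>1 where \<eta>1: "\<eta>1 > 0" "\<And>t. x < t \<Longrightarrow> t < x + \<eta>1 \<Longrightarrow> n t \<le> n x + h x"
      using after[of x] by blast
    obtain \<eta>2 where \<eta>2: "\<eta>2 > 0" "\<And>t. x - \<eta>2 < t \<Longrightarrow> t < x \<Longrightarrow> n x + g x \<le> n t"
      using before[of x] by blast
    obtain d1 where d1: "d1 > 0" "\<And>y. y \<in> S \<Longrightarrow> y \<noteq> x \<Longrightarrow> d1 \<le> dist x y"
      using finite_set_avoid[OF fin, of x] by blast
    define d where "d = min d1 (min \<eta>1 \<eta>2)"
    have d: "d > 0" "d \<le> d1" "d \<le> \<eta>1" "d \<le> \<eta>2" using d1 \<eta>1 \<eta>2 by (auto simp: d_def)
    have far: "y \<le> x - d \<or> y = x \<or> y \<ge> x + d" if "y \<in> S" for y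
      using d1(2)[OF that] d by (force simp: dist_real_def)
    have single: "(\<Sum>s\<in>S \<inter> {..x}. f s) = (\<Sum>s\<in>S \<inter> {..<x}. f s) + f x"
      if "f x = 0 \<or> x \<in> S" for f :: "real \<Rightarrow> nat"
    proof (cases "x \<in> S")
      case True
      then have "S \<inter> {..x} = insert x (S \<inter> {..<x})" by auto
      then show ?thesis using fin by simp
    next
      case False
      then have "S \<inter> {..x} = S \<inter> {..<x}" by (auto simp: order_le_less)
      then show ?thesis using False that by simp
    qed
    have gx: "g x = 0 \<or> x \<in> S" and hx: "h x = 0 \<or> x \<in> S" using outside x by blast+
    have right: "\<Phi> b \<le> \<Phi> x" if b: "x < b" "b < x + d" for b
    proof -
      have "S \<inter> {..b} = S \<inter> {..x}" "S \<inter> {..<b} = S \<inter> {..x}" using far b by force+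
      then show ?thesis
        using \<eta>1(2)[of b] b d single[of h, OF hx] by (simp add: \<Phi>_def del: of_nat_sum)
    qed
    have left: "\<Phi> x \<le> \<Phi> a" if a: "x - d < a" "a < x" for a
    proof -
      have "S \<inter> {..a} = S \<inter> {..<x}" "S \<inter> {..<a} = S \<inter> {..<x}" using far a by force+
      then show ?thesis
        using \<eta>2(2)[of a] a d single[of g, OF gx] by (simp add: \<Phi>_def del: of_nat_sum)
    qed
    show ?case
    proof (intro exI[of _ d] conjI allI impI d(1))
      fix a b assume ab: "a \<le> x \<and> x \<le> b \<and> b - a < d"
      have "\<Phi> b \<le> \<Phi> x" using right[of b] ab by (cases "b = x") auto
      also have "\<Phi> x \<le> \<Phi> a" using left[of a] ab by (cases "a = x") auto
      finally show "\<Phi> b \<le> \<Phi> a" .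
    qed
  qed
  then have "\<Phi> T \<le> \<Phi> \<epsilon>" using e by simp
  also have "\<Phi> \<epsilon> \<le> int N" using bound[of \<epsilon>] by (simp add: \<Phi>_def Se)
  finally have "int (\<Sum>s\<in>S \<inter> {..T}. g s) \<le> int (N + (\<Sum>s\<in>S \<inter> {..<T}. h s))"
    by (simp add: \<Phi>_def del: of_nat_sum)
  then have "(\<Sum>s\<in>S \<inter> {..T}. g s) \<le> N + (\<Sum>s\<in>S \<inter> {..<T}. h s)" by (simp only: of_nat_le_iff)
  moreover have "S \<inter> {..T} = S" using S by auto
  moreover have "(\<Sum>s\<in>S \<inter> {..<T}. h s) \<le> (\<Sum>s\<in>S. h s)" using fin by (intro sum_mono2) auto
  ultimately show ?thesis by simp
qed

text \<open>The zeros are the multiples of \<open>pi / \<bar>f\<bar>\<close>. The floor is the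
  source of the rounding loss in the final bound.\<close>

lemma sin_zeros:
  fixes f T :: real
  assumes f: "f \<noteq> 0" and T: "T > 0"
  shows "finite {t \<in> {0<..T}. sin (f * t) = 0}"
    and "card {t \<in> {0<..T}. sin (f * t) = 0} = nat \<lfloor>\<bar>f\<bar> * T / pi\<rfloor>"
proof -
  have "{t \<in> {0<..T}. sin (f * t) = 0} = (\<lambda>i. real i * pi / \<bar>f\<bar>) ` {1..nat \<lfloor>\<bar>f\<bar> * T / pi\<rfloor>}"
    (is "?A = ?B")
  proof
    show "?A \<subseteq> ?B"
    proof
      fix t assume t: "t \<in> ?A"
      then have "sin (\<bar>f\<bar> * t) = 0" by (cases "f \<ge> 0") auto
      then obtain i :: int where i: "\<bar>f\<bar> * t = of_int i * pi" unfolding sin_zero_iff_int2 by blast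
      have "0 < \<bar>f\<bar> * t" using t f by simp
      then have i1: "i \<ge> 1" unfolding i by (simp add: zero_less_mult_iff)
      have "of_int i * pi \<le> \<bar>f\<bar> * T" unfolding i[symmetric] using t by (intro mult_left_mono) auto
      then have "of_int i \<le> \<bar>f\<bar> * T / pi" by (simp add: field_simps)
      then have "i \<le> \<lfloor>\<bar>f\<bar> * T / pi\<rfloor>" by (simp add: le_floor_iff)
      then have "nat i \<in> {1..nat \<lfloor>\<bar>f\<bar> * T / pi\<rfloor>}" using i1 by auto
      moreover have "t = real (nat i) * pi / \<bar>f\<bar>" using i i1 f by (simp add: field_simps)
      ultimately show "t \<in> ?B" by blast
    qed
    show "?B \<subseteq> ?A"
    proof safe
      fix i assume i: "i \<in> {1..nat \<lfloor>\<bar>f\<bar> * T / pi\<rfloor>}"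
      then show "real i * pi / \<bar>f\<bar> \<in> {0<..T}"
      proof -
        have "int i \<le> \<lfloor>\<bar>f\<bar> * T / pi\<rfloor>" using i by auto
        then have "real i \<le> \<bar>f\<bar> * T / pi" by (simp add: le_floor_iff)
        then show ?thesis using i f by (simp add: field_simps)
      qed
      have "f * (real i * pi / \<bar>f\<bar>) = sgn f * (real i * pi)" using f by (simp add: sgn_if)
      then show "sin (f * (real i * pi / \<bar>f\<bar>)) = 0" using f by (simp add: sgn_if)
    qed
  qed
  moreover have "inj_on (\<lambda>i. real i * pi / \<bar>f\<bar>) {1..nat \<lfloor>\<bar>f\<bar> * T / pi\<rfloor>}"
    using f by (auto simp: inj_on_def)
  ultimately show "finite ?A" "card ?A = nat \<lfloor>\<bar>f\<bar> * T / pi\<rfloor>"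
    by (auto simp: card_image)
qed

lemma dim_coordinate_subspace:
  "dim {r :: real^'d. \<forall>j. j \<notin> S \<longrightarrow> r $ j = 0} = card S"
  using dim_substandard_cart[where 'a = real, of S] by (simp add: dim_vec_eq)

section \<open>The reference Lagrangian and its returns under the flow\<close>

locale lq_reference = lq_split \<omega> F V \<psi> freq L
  for \<omega> :: "'a::euclidean_space \<Rightarrow> 'a \<Rightarrow> real" and F V
    and \<psi> :: "(real^'d) \<times> (real^'d) \<Rightarrow> 'a" and freq L +
  fixes \<theta> :: real
  assumes transversal: "ray \<theta> r \<in> M \<Longrightarrow> r = 0"
begin

definition embed :: "real \<Rightarrow> real^'d \<Rightarrow> 'a" where
  "embed \<alpha> r = \<psi> (ray \<alpha> r)"

lemma linear_embed: "linear (embed \<alpha>)"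
  using linear_compose[OF linear_ray linear_psi] by (simp add: embed_def[abs_def] o_def)

lemma embed_eq_0_iff: "embed \<alpha> r = 0 \<longleftrightarrow> r = 0"
  by (simp add: embed_def psi_eq_0_iff ray_eq_0_iff)

lemma embed_range: "embed \<alpha> r \<in> range \<psi>"
  by (simp add: embed_def)

definition K :: "'a set" where
  "K = {x + l |x l. x \<in> range (embed \<theta>) \<and> l \<in> L}"

lemma embed_add_K: "l \<in> L \<Longrightarrow> embed \<theta> r + l \<in> K"
  by (auto simp: K_def)

lemma embed_L_cap: "range (embed \<theta>) \<inter> L \<subseteq> {0}"
  using psi_L_cap embed_range by blast

lemma inj_embed: "inj (embed \<alpha>)"
  using linear_injective_0[OF linear_embed] embed_eq_0_iff by blast

text \<open>The ray of a vector of \<open>V \<inter> K\<close> lies in \<open>M\<close>, so the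
  choice of the angle reduces \<open>V \<inter> K\<close> to \<open>V \<inter> L\<close>.\<close>

sublocale lagrangian_splitting \<omega> F V K
proof
  show "subspace V" by (rule subspace_V)
  have sR: "subspace (range (embed \<theta>))" by (rule linear_subspace_image[OF linear_embed subspace_UNIV])
  show "subspace K" unfolding K_def by (rule subspace_sums[OF sR subspace_L])
  show "isotropic V" using isotropic_V by (auto simp: isotropic_def skew_compl_iff)
  show "isotropic K"
    unfolding isotropic_def skew_compl_def
  proof safe
    fix x y assume "x \<in> K" "y \<in> K"
    then obtain r l r' l' where "l \<in> L" "l' \<in> L" "x = embed \<theta> r + l" "y = embed \<theta> r' + l'"
      by (auto simp: K_def)
    then show "\<omega> x y = 0"
      by (simp add: embed_def om_simps omega_psi_L omega_L_L omega_psi_J J_inner_ray)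
  qed
  show "V \<inter> K \<subseteq> {0}"
  proof safe
    fix z assume z: "z \<in> V" "z \<in> K"
    then obtain r l where rl: "l \<in> L" "z = embed \<theta> r + l" by (auto simp: K_def)
    then have "ray \<theta> r \<in> M" using z by (auto simp: M_def embed_def)
    then have "r = 0" by (rule transversal)
    then have "z = l" using rl by (simp add: embed_eq_0_iff)
    then show "z = 0" using V_L z rl by blast
  qed
  have "dim K = CARD('d) + dim L"
    unfolding K_def dim_direct_sum[OF sR subspace_L embed_L_cap]
    using dim_image_eq[OF linear_embed, of \<theta> UNIV] inj_embed by simp
  then show "dim V + dim K = DIM('a)" using dim_V dim_L by arith
qed

lemma embed_expand:
  "embed \<alpha> r = (\<Sum>j\<in>UNIV. r $ j *\<^sub>R embed \<alpha> (axis j 1))"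
proof -
  have "embed \<alpha> r = embed \<alpha> (\<Sum>j\<in>UNIV. r $ j *s axis j 1)" by (simp add: basis_expansion)
  then show ?thesis
    by (simp add: linear_sum[OF linear_embed] linear_scale[OF linear_embed] scalar_mult_eq_scaleR)
qed

lemma F_embed: "F (embed \<alpha> (axis j 1)) = freq j *\<^sub>R embed (\<alpha> + pi / 2) (axis j 1)"
proof -
  have "(\<chi> i. freq i * (c *\<^sub>R axis j 1 :: real^'d) $ i) = (freq j * c) *\<^sub>R axis j 1" for c :: real
    by (simp add: vec_eq_iff axis_def)
  then show ?thesis
    by (simp add: embed_def ray_def F_psi cos_add sin_add flip: psi_simps(2))
qed

lemma F_embed_shift: "F (embed (\<alpha> + pi / 2) (axis j 1)) = - freq j *\<^sub>R embed \<alpha> (axis j 1)"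
proof -
  have "embed (\<alpha> + pi / 2 + pi / 2) r = - embed \<alpha> r" for r
    by (simp add: embed_def ray_def flip: psi_simps(4))
  then show ?thesis using F_embed[of "\<alpha> + pi / 2"] by simp
qed

text \<open>The \<open>j\<close>-th coordinate plane rotates with speed \<open>freq j\<close>. Since
  the speeds differ, the image of a ray is split along two perpendicular angles. The right-hand side
  solves the differential equation, so \<open>flow_eqI\<close> applies.\<close>

lemma flow_embed:
  "flow F t (embed \<alpha> r) =
    embed \<alpha> (\<chi> j. cos (freq j * t) * r $ j) + embed (\<alpha> + pi / 2) (\<chi> j. sin (freq j * t) * r $ j)"
proof -
  define y where "y = (\<lambda>t. \<Sum>j\<in>UNIV. (cos (freq j * t) * r $ j) *\<^sub>R embed \<alpha> (axis j 1) +
    (sin (freq j * t) * r $ j) *\<^sub>R embed (\<alpha> + pi / 2) (axis j 1))"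
  have "(y has_vector_derivative F (y t)) (at t)" for t
  proof -
    have "(y has_vector_derivative (\<Sum>j\<in>UNIV.
        ((cos (freq j * t) * r $ j) *\<^sub>R 0 + (- freq j * sin (freq j * t) * r $ j) *\<^sub>R embed \<alpha> (axis j 1)) +
        ((sin (freq j * t) * r $ j) *\<^sub>R 0 +
          (freq j * cos (freq j * t) * r $ j) *\<^sub>R embed (\<alpha> + pi / 2) (axis j 1)))) (at t)"
      unfolding y_def
      by (intro has_vector_derivative_sum has_vector_derivative_add has_vector_derivative_scaleR
        has_vector_derivative_const) (auto intro!: derivative_eq_intros)
    also have "(\<Sum>j\<in>UNIV.
        ((cos (freq j * t) * r $ j) *\<^sub>R 0 + (- freq j * sin (freq j * t) * r $ j) *\<^sub>R embed \<alpha> (axis j 1)) +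
        ((sin (freq j * t) * r $ j) *\<^sub>R 0 +
          (freq j * cos (freq j * t) * r $ j) *\<^sub>R embed (\<alpha> + pi / 2) (axis j 1))) = F (y t)"
      by (simp add: y_def linear_sum[OF linear_F] F_simps F_embed[of \<alpha>] F_embed_shift[of \<alpha>] sum.distrib sum_negf sum_subtractf mult_ac)
    finally show ?thesis .
  qed
  from flow_eqI[OF linear_F this, of t]
  have "flow F t (y 0) = y t" .
  moreover have "y 0 = embed \<alpha> r" by (simp add: y_def flip: embed_expand)
  moreover have "y t = embed \<alpha> (\<chi> j. cos (freq j * t) * r $ j) +
      embed (\<alpha> + pi / 2) (\<chi> j. sin (freq j * t) * r $ j)"
    unfolding y_def sum.distrib
    by (subst (3 4) embed_expand) simp
  ultimately show ?thesis by simp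
qed

lemma flow_L: "l \<in> L \<Longrightarrow> flow F t l \<in> L"
  by (rule flow_invariant[OF linear_F subspace_L F_L])

text \<open>The part in \<open>L\<close> stays in \<open>L\<close>, so a return to \<open>K\<close>
  depends only on the component along the angle \<open>\<theta> + pi / 2\<close>.\<close>

lemma flow_in_K_iff:
  assumes "l \<in> L"
  shows "flow F t (embed \<theta> r + l) \<in> K \<longleftrightarrow> (\<forall>j. sin (freq j * t) * r $ j = 0)"
proof -
  define c where "c = (\<chi> j. cos (freq j * t) * r $ j)"
  define s where "s = (\<chi> j. sin (freq j * t) * r $ j)"
  have eq: "flow F t (embed \<theta> r + l) = embed \<theta> c + embed (\<theta> + pi / 2) s + flow F t l"
    by (simp add: flow_simps flow_embed c_def s_def)
  have "flow F t (embed \<theta> r + l) \<in> K \<longleftrightarrow> s = 0"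
  proof
    assume "s = 0"
    then have "flow F t (embed \<theta> r + l) = embed \<theta> c + flow F t l"
      by (simp add: eq embed_eq_0_iff)
    then show "flow F t (embed \<theta> r + l) \<in> K" using embed_add_K[OF flow_L[OF assms]] by simp
  next
    assume "flow F t (embed \<theta> r + l) \<in> K"
    then obtain r' l' where r': "l' \<in> L" "flow F t (embed \<theta> r + l) = embed \<theta> r' + l'"
      by (auto simp: K_def)
    define y where "y = ray \<theta> (c - r') + ray (\<theta> + pi / 2) s"
    have "\<psi> y = l' - flow F t l"
      using r'(2) unfolding eq
      by (simp add: y_def embed_def psi_simps linear_diff[OF linear_ray] algebra_simps)
    moreover have "l' - flow F t l \<in> L" by (rule subspace_diff[OF subspace_L r'(1) flow_L[OF assms]])
    ultimately have "\<psi> y \<in> L" by simp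
    then have "\<psi> y = 0" using psi_L_cap by blast
    then have "y = 0" by (simp add: psi_eq_0_iff)
    then have "y \<bullet> ray (\<theta> + pi / 2) s = 0" by simp
    then show "s = 0" by (simp add: y_def inner_add_left inner_ray)
  qed
  then show ?thesis by (simp add: s_def vec_eq_iff)
qed

definition coords :: "'d set \<Rightarrow> (real^'d) set" where
  "coords S = {r. \<forall>j. j \<notin> S \<longrightarrow> r $ j = 0}"

lemma subspace_embed_coords: "subspace (embed \<theta> ` coords S)"
  by (intro linear_subspace_image[OF linear_embed]) (auto simp: subspace_def coords_def)

lemma dim_embed_coords: "dim (embed \<theta> ` coords S) = card S"
proof -
  have "dim (embed \<theta> ` coords S) = dim (coords S)"
    by (rule dim_image_eq[OF linear_embed]) (rule inj_on_subset[OF inj_embed subset_UNIV])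
  then show ?thesis by (simp add: coords_def dim_coordinate_subspace)
qed

lemma dim_embed_coords_L: "dim {x + l |x l. x \<in> embed \<theta> ` coords S \<and> l \<in> L} = card S + dim L"
proof -
  have "embed \<theta> ` coords S \<inter> L \<subseteq> {0}" using embed_L_cap by blast
  from dim_direct_sum[OF subspace_embed_coords subspace_L this] show ?thesis
    by (simp add: dim_embed_coords)
qed

text \<open>As J(t) is the image of \<open>V\<close> under the flow at time \<open>- t\<close>, the
  set is \<open>V \<inter> J(t)\<close> and its dimension is the multiplicity of
  \<open>t\<close>.\<close>

definition conj_dim :: "real \<Rightarrow> nat" where
  "conj_dim t = dim {u \<in> V. flow F t u \<in> V}"

abbreviation index :: "real \<Rightarrow> nat" where
  "index t \<equiv> neg_index (crossing_form t)"

lemma dim_radical_le: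
  "dim (radical (crossing_form t)) \<le> conj_dim t + card {j. sin (freq j * t) = 0} + dim L"
proof -
  have "{l \<in> K. flow F t l \<in> K} \<subseteq> {x + l |x l. x \<in> embed \<theta> ` coords {j. sin (freq j * t) = 0} \<and> l \<in> L}"
  proof safe
    fix z assume z: "z \<in> K" "flow F t z \<in> K"
    then obtain r l where rl: "z = embed \<theta> r + l" "l \<in> L" by (auto simp: K_def)
    then have "r \<in> coords {j. sin (freq j * t) = 0}"
      using z flow_in_K_iff[OF rl(2), of t r] by (auto simp: coords_def)
    then show "\<exists>x l. z = x + l \<and> x \<in> embed \<theta> ` coords {j. sin (freq j * t) = 0} \<and> l \<in> L"
      using rl by blast
  qed
  then have "dim {l \<in> K. flow F t l \<in> K} \<le> card {j. sin (freq j * t) = 0} + dim L"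
    unfolding dim_embed_coords_L[symmetric] by (rule dim_subset)
  then show ?thesis using dim_crossing_radical[of t] by (simp add: conj_dim_def)
qed

lemma coords_radical:
  assumes "\<And>j. j \<in> S \<Longrightarrow> sin (freq j * t) = 0" "r \<in> coords S" "l \<in> L"
  shows "embed \<theta> r + l \<in> K" "flow F t (embed \<theta> r + l) \<in> K"
    "embed \<theta> r + l \<in> radical (crossing_form t)"
proof -
  show 1: "embed \<theta> r + l \<in> K" using assms by (intro embed_add_K)
  show 2: "flow F t (embed \<theta> r + l) \<in> K"
    unfolding flow_in_K_iff[OF assms(3)] using assms by (auto simp: coords_def)
  show "embed \<theta> r + l \<in> radical (crossing_form t)" by (rule crossing_K_radical[OF 1 2])
qed

definition pos_crossings :: "real \<Rightarrow> 'd set" where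
  "pos_crossings t = {j. freq j > 0 \<and> sin (freq j * t) = 0}"

definition neg_crossings :: "real \<Rightarrow> 'd set" where
  "neg_crossings t = {j. freq j < 0 \<and> sin (freq j * t) = 0}"

lemma pos_crossings_radical: "embed \<theta> ` coords (pos_crossings t) \<subseteq> radical (crossing_form t)"
  using coords_radical(3)[of "pos_crossings t" t _ 0] subspace_0[OF subspace_L]
  by (auto simp: pos_crossings_def)

text \<open>The energy of a ray does not depend on its angle: it is the sum of
  \<open>freq j * (r $ j)\<^sup>2\<close>, and here all nonzero terms have positive
  frequency.\<close>

lemma pos_crossings_deriv:
  assumes "p \<in> embed \<theta> ` coords (pos_crossings t)" "p \<noteq> 0"
  shows "crossing_deriv t p p > 0"
proof -
  obtain r where r: "p = embed \<theta> r" "r \<in> coords (pos_crossings t)" using assms by blast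
  have "r \<noteq> 0" using assms r embed_eq_0_iff by blast
  then obtain i where i: "r $ i \<noteq> 0" by (auto simp: vec_eq_iff)
  have pos: "freq j > 0" if "r $ j \<noteq> 0" for j
    using that r by (auto simp: coords_def pos_crossings_def)
  have L0: "0 \<in> L" by (rule subspace_0[OF subspace_L])
  have "crossing_deriv t p p = 2 * \<omega> p (F p)"
    using coords_radical(1,2)[of "pos_crossings t" t r 0] r L0
    by (intro crossing_deriv_K) (auto simp: pos_crossings_def)
  also have "\<omega> p (F p) = energy (ray \<theta> r)"
    using energy_eq[OF L0, of "ray \<theta> r"] by (simp add: r embed_def)
  also have "\<dots> = (\<Sum>j\<in>UNIV. freq j * (r $ j)\<^sup>2)"
  proof -
    have "(cos \<theta> * x)\<^sup>2 + (sin \<theta> * x)\<^sup>2 = x\<^sup>2" for x :: real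
      by (simp add: power_mult_distrib flip: distrib_right)
    then show ?thesis by (simp add: energy_def ray_def)
  qed
  finally have "crossing_deriv t p p = 2 * (\<Sum>j\<in>UNIV. freq j * (r $ j)\<^sup>2)" .
  moreover have "(\<Sum>j\<in>UNIV. freq j * (r $ j)\<^sup>2) > 0"
  proof (rule sum_pos2)
    show "0 < freq i * (r $ i)\<^sup>2" using i pos by simp
    show "0 \<le> freq j * (r $ j)\<^sup>2" for j using pos[of j] by (cases "r $ j = 0") auto
  qed auto
  ultimately show ?thesis by simp
qed

lemma index_before:
  "\<exists>\<eta>>0. \<forall>t. x - \<eta> < t \<and> t < x \<longrightarrow> index x + card (pos_crossings x) \<le> index t"
  using neg_index_before[OF bilinear_crossing_form crossing_form_sym bilinear_crossing_deriv
      crossing_form_has_derivative subspace_embed_coords pos_crossings_radical pos_crossings_deriv, of x]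
  by (simp add: dim_embed_coords)

text \<open>Of the radical at \<open>x\<close>, the part \<open>R\<close> coming from
  \<open>L\<close> and from zero frequencies stays null at all times, and the part from
  \<open>pos_crossings\<close> turns positive. What remains, from negative frequencies and from the
  conjugate time, is allowed to turn negative altogether.\<close>

lemma index_after:
  "\<exists>\<eta>>0. \<forall>t. x < t \<and> t < x + \<eta> \<longrightarrow> index t \<le> index x + (card (neg_crossings x) + conj_dim x)"
proof -
  define Z where "Z = {j. freq j = 0}"
  define R where "R = {y + l |y l. y \<in> embed \<theta> ` coords Z \<and> l \<in> L}"
  have sR: "subspace R" unfolding R_def by (rule subspace_sums[OF subspace_embed_coords subspace_L])
  have Rrad: "R \<subseteq> radical (crossing_form s)" for s
    unfolding R_def using coords_radical(3)[of Z s] by (auto simp: Z_def)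
  have PR: "embed \<theta> ` coords (pos_crossings x) \<inter> R \<subseteq> {0}"
  proof safe
    fix r assume r: "r \<in> coords (pos_crossings x)" "embed \<theta> r \<in> R"
    then obtain r' l where r': "r' \<in> coords Z" "l \<in> L" "embed \<theta> r = embed \<theta> r' + l"
      by (auto simp: R_def)
    then have "embed \<theta> (r - r') = l" by (simp add: linear_diff[OF linear_embed])
    then have "embed \<theta> (r - r') = 0" using embed_L_cap r'(2) by blast
    then have "r = r'" by (simp add: embed_eq_0_iff)
    then have "r = 0"
      using r r' by (auto simp: coords_def Z_def pos_crossings_def vec_eq_iff)
        (metis less_irrefl)
    then show "embed \<theta> r = 0" by (simp add: embed_eq_0_iff)
  qed
  obtain \<eta> where \<eta>: "\<eta> > 0" "\<And>t. x < t \<Longrightarrow> t < x + \<eta> \<Longrightarrow>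
      index t + card (pos_crossings x) + dim R \<le> index x + dim (radical (crossing_form x))"
    using neg_index_after[OF bilinear_crossing_form crossing_form_sym bilinear_crossing_deriv
      crossing_form_has_derivative subspace_embed_coords pos_crossings_radical pos_crossings_deriv
      sR Rrad PR] by (auto simp: dim_embed_coords)
  have dR: "dim R = card Z + dim L" unfolding R_def by (rule dim_embed_coords_L)
  have "{j. sin (freq j * x) = 0} = pos_crossings x \<union> neg_crossings x \<union> Z"
    by (auto simp: pos_crossings_def neg_crossings_def Z_def)
  moreover have "card (pos_crossings x \<union> neg_crossings x \<union> Z) =
      card (pos_crossings x) + card (neg_crossings x) + card Z"
    by (subst card_Un_disjoint | force simp: pos_crossings_def neg_crossings_def Z_def)+
  ultimately have c: "card {j. sin (freq j * x) = 0} =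
      card (pos_crossings x) + card (neg_crossings x) + card Z" by simp
  show ?thesis
  proof (intro exI[of _ \<eta>] conjI allI impI \<eta>(1))
    fix t assume "x < t \<and> t < x + \<eta>"
    then show "index t \<le> index x + (card (neg_crossings x) + conj_dim x)"
      using \<eta>(2)[of t] dR c dim_radical_le[of x] by linarith
  qed
qed

lemma index_le: "index t \<le> 2 * CARD('d) + dim L"
proof -
  have "L \<subseteq> radical (crossing_form t)"
    using crossing_K_radical flow_L embed_add_K[of _ 0] by (auto simp: linear_0[OF linear_embed])
  then have "index t + dim L \<le> DIM('a)"
    by (intro neg_index_le[OF subspace_L]) (auto simp: radical_def)
  then show ?thesis using dim_L by arith
qed

text \<open>\<open>jump_sum\<close> bounds the positive crossings by the index range
  \<open>2 * CARD('d) + dim L\<close>, the negative crossings and the conjugate multiplicities.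
  Frequency \<open>j\<close> contributes to positive minus negative crossings more than
  \<open>freq j * T / pi - 1\<close>, which costs a further \<open>CARD('d)\<close>.\<close>

lemma conj_dim_sum:
  assumes T: "T > 0" and fin: "finite {t \<in> {0<..T}. conj_dim t \<noteq> 0}"
  shows "T * (\<Sum>j\<in>UNIV. freq j) / pi - 3 * real CARD('d) - real (dim L)
    < real (\<Sum>t | t \<in> {0<..T} \<and> conj_dim t \<noteq> 0. conj_dim t)"
proof -
  define C where "C = {t \<in> {0<..T}. conj_dim t \<noteq> 0}"
  define Z where "Z = (\<lambda>j. {t \<in> {0<..T}. sin (freq j * t) = 0})"
  define S where "S = C \<union> (\<Union>j\<in>{j. freq j \<noteq> 0}. Z j)"
  have finS: "finite S" unfolding S_def Z_def C_def using fin sin_zeros(1)[OF _ T] by auto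
  have S: "S \<subseteq> {0<..T}" by (auto simp: S_def C_def Z_def)
  have "(\<Sum>s\<in>S. card (pos_crossings s)) \<le>
      (2 * CARD('d) + dim L) + (\<Sum>s\<in>S. card (neg_crossings s) + conj_dim s)"
  proof (rule jump_sum[OF T finS S _ index_after index_before index_le])
    fix s assume "0 < s" "s \<le> T" "s \<notin> S"
    then have "conj_dim s = 0" and "freq j = 0 \<or> sin (freq j * s) \<noteq> 0" for j
      by (auto simp: S_def C_def Z_def)
    then have "conj_dim s = 0" "\<not> (freq j < 0 \<and> sin (freq j * s) = 0)"
      "\<not> (freq j > 0 \<and> sin (freq j * s) = 0)" for j by (auto dest: meta_spec[of _ j])
    then have "conj_dim s = 0" "neg_crossings s = {}" "pos_crossings s = {}"
      by (auto simp: neg_crossings_def pos_crossings_def)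
    then show "card (neg_crossings s) + conj_dim s = 0 \<and> card (pos_crossings s) = 0" by simp
  qed
  moreover have "(\<Sum>s\<in>S. conj_dim s) = (\<Sum>s\<in>C. conj_dim s)"
    by (rule sum.mono_neutral_right[OF finS]) (use S in \<open>auto simp: S_def C_def\<close>)
  \<comment> \<open>Double counting of the pairs of a time and a frequency crossing at that
    time.\<close>
  moreover have "(\<Sum>s\<in>S. card (pos_crossings s)) = (\<Sum>j\<in>UNIV. if freq j > 0 then card (Z j) else 0)"
  proof -
    have "card (pos_crossings s) = (\<Sum>j\<in>UNIV. if freq j > 0 \<and> sin (freq j * s) = 0 then 1 else 0)" for s
      by (simp add: pos_crossings_def sum.If_cases)
    then have "(\<Sum>s\<in>S. card (pos_crossings s)) =
        (\<Sum>j\<in>UNIV. \<Sum>s\<in>S. if freq j > 0 \<and> sin (freq j * s) = 0 then 1 else 0)"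
      by (simp only: sum.swap[of _ S UNIV])
    also have "\<dots> = (\<Sum>j\<in>UNIV. if freq j > 0 then card (Z j) else 0)"
    proof (rule sum.cong[OF refl])
      fix j
      have "S \<inter> {s. sin (freq j * s) = 0} = Z j" if "freq j > 0"
      proof -
        have "j \<in> {j. freq j \<noteq> 0}" using that by simp
        then have "Z j \<subseteq> S" unfolding S_def by blast
        then show ?thesis using S unfolding Z_def by blast
      qed
      then show "(\<Sum>s\<in>S. if freq j > 0 \<and> sin (freq j * s) = 0 then 1 else 0) =
          (if freq j > 0 then card (Z j) else 0)"
        using finS by (simp add: sum.If_cases)
    qed
    finally show ?thesis .
  qed
  moreover have "(\<Sum>s\<in>S. card (neg_crossings s)) = (\<Sum>j\<in>UNIV. if freq j < 0 then card (Z j) else 0)"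
  proof -
    have "card (neg_crossings s) = (\<Sum>j\<in>UNIV. if freq j < 0 \<and> sin (freq j * s) = 0 then 1 else 0)" for s
      by (simp add: neg_crossings_def sum.If_cases)
    then have "(\<Sum>s\<in>S. card (neg_crossings s)) =
        (\<Sum>j\<in>UNIV. \<Sum>s\<in>S. if freq j < 0 \<and> sin (freq j * s) = 0 then 1 else 0)"
      by (simp only: sum.swap[of _ S UNIV])
    also have "\<dots> = (\<Sum>j\<in>UNIV. if freq j < 0 then card (Z j) else 0)"
    proof (rule sum.cong[OF refl])
      fix j
      have "S \<inter> {s. sin (freq j * s) = 0} = Z j" if "freq j < 0"
      proof -
        have "j \<in> {j. freq j \<noteq> 0}" using that by simp
        then have "Z j \<subseteq> S" unfolding S_def by blast
        then show ?thesis using S unfolding Z_def by blast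
      qed
      then show "(\<Sum>s\<in>S. if freq j < 0 \<and> sin (freq j * s) = 0 then 1 else 0) =
          (if freq j < 0 then card (Z j) else 0)"
        using finS by (simp add: sum.If_cases)
    qed
    finally show ?thesis .
  qed
  ultimately have "(\<Sum>j\<in>UNIV. if freq j > 0 then card (Z j) else 0) \<le>
      2 * CARD('d) + dim L + (\<Sum>j\<in>UNIV. if freq j < 0 then card (Z j) else 0) + (\<Sum>s\<in>C. conj_dim s)"
    by (simp add: sum.distrib)
  then have "real (\<Sum>j\<in>UNIV. if freq j > 0 then card (Z j) else 0) \<le>
      real (2 * CARD('d) + dim L + (\<Sum>j\<in>UNIV. if freq j < 0 then card (Z j) else 0) + (\<Sum>s\<in>C. conj_dim s))"
    by (rule of_nat_mono)
  moreover have "(\<Sum>j\<in>UNIV. freq j * T / pi - 1) <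
      (\<Sum>j\<in>UNIV. real (if freq j > 0 then card (Z j) else 0) - real (if freq j < 0 then card (Z j) else 0))"
  proof (rule sum_strict_mono)
    fix j
    have floor: "\<bar>freq j\<bar> * T / pi - 1 < real (card (Z j))" "real (card (Z j)) \<le> \<bar>freq j\<bar> * T / pi"
      if "freq j \<noteq> 0"
    proof -
      have "real (card (Z j)) = of_int \<lfloor>\<bar>freq j\<bar> * T / pi\<rfloor>"
        unfolding Z_def sin_zeros(2)[OF that T] using T by simp
      then show "\<bar>freq j\<bar> * T / pi - 1 < real (card (Z j))" "real (card (Z j)) \<le> \<bar>freq j\<bar> * T / pi"
        by linarith+
    qed
    \<comment> \<open>For a positive frequency the count exceeds the exact value minus 1; for a
      negative one it enters with a minus sign and is at most the exact value.\<close>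
    show "freq j * T / pi - 1 <
        real (if freq j > 0 then card (Z j) else 0) - real (if freq j < 0 then card (Z j) else 0)"
      using floor by (cases "freq j" "0 :: real" rule: linorder_cases) auto
  qed auto
  moreover have "(\<Sum>j\<in>UNIV. freq j * T / pi - 1) = T * (\<Sum>j\<in>UNIV. freq j) / pi - real CARD('d)"
    by (simp add: sum_subtractf sum_distrib_left sum_divide_distrib mult.commute)
  ultimately have "T * (\<Sum>j\<in>UNIV. freq j) / pi - 3 * real CARD('d) - real (dim L)
      < real (\<Sum>s\<in>C. conj_dim s)"
    by (simp add: sum_subtractf)
  then show ?thesis by (simp add: C_def)
qed

end

section \<open>From the definitions to the normal form\<close>

text \<open>Replaces the derivative in the definition by the polarization of H, from which
  linearity, skewness and the energy formula of the field follow algebraically.\<close>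

lemma hamiltonian_vf_polar:
  assumes \<omega>: "symplectic_form \<omega>" and H: "quadratic_form H"
  shows "\<omega> v (hamiltonian_vf \<omega> H x) = H (x + v) - H x - H v"
proof -
  obtain b where b: "bilinear b" "H = (\<lambda>x. b x x)"
    using H by (auto simp: quadratic_form_def)
  interpret b: bounded_bilinear b
    using b(1) bilinear_conv_bounded_bilinear by blast
  have "(H has_derivative (\<lambda>v. b x v + b v x)) (at x)"
    unfolding b(2) by (rule b.FDERIV) (auto intro!: derivative_eq_intros)
  then have "(\<lambda>v. b x v + b v x) = (\<lambda>v. \<omega> v (hamiltonian_vf \<omega> H x))"
    using hamiltonian_vf_has_derivative[OF \<omega> H] has_derivative_unique by blast
  then have "\<omega> v (hamiltonian_vf \<omega> H x) = b x v + b v x" by metis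
  then show ?thesis by (simp add: b(2) b.add_left b.add_right)
qed

lemma hamiltonian_field_hamiltonian_vf:
  assumes \<omega>: "symplectic_form \<omega>" and H: "quadratic_form H"
  shows "hamiltonian_field \<omega> (hamiltonian_vf \<omega> H)"
proof -
  interpret symplectic_space \<omega> by unfold_locales (rule \<omega>)
  let ?F = "hamiltonian_vf \<omega> H"
  note polar = hamiltonian_vf_polar[OF \<omega> H]
  obtain b where b: "bilinear b" "\<And>x. H x = b x x"
    using H by (auto simp: quadratic_form_def)
  note bs = bilinear_ladd[OF b(1)] bilinear_radd[OF b(1)] bilinear_lmul[OF b(1)] bilinear_rmul[OF b(1)]
  have eqI: "x = y" if "\<And>v. \<omega> v x = \<omega> v y" for x y
  proof -
    have "\<omega> (x - y) v = 0" for v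
      using that[of v] skew[of "x - y" v] by (simp add: om_simps)
    then show ?thesis using nondegenerate[of "x - y"] by simp
  qed
  have "linear ?F"
    by (intro linearI eqI) (simp_all add: polar om_simps b(2) bs algebra_simps)
  moreover have "\<omega> (?F x) y = - \<omega> x (?F y)" for x y
    using skew[of "?F x" y] by (simp add: polar add.commute)
  ultimately show ?thesis by unfold_locales (auto simp: linear_add linear_scale)
qed

lemma hamiltonian_vf_eq_H:
  assumes \<omega>: "symplectic_form \<omega>" and H: "quadratic_form H"
  shows "\<omega> x (hamiltonian_vf \<omega> H x) = 2 * H x"
proof -
  obtain b where b: "bilinear b" "\<And>x. H x = b x x"
    using H by (auto simp: quadratic_form_def)
  then show ?thesis
    by (simp add: hamiltonian_vf_polar[OF \<omega> H] bilinear_ladd bilinear_radd)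
qed

section \<open>Imaginary spectrum, controllability and Hamilton's equations\<close>

lemma clift_invariant:
  assumes F: "linear F" and w: "((\<lambda>w. clift F w - cscale l w) ^^ j) w = 0"
  shows "((\<lambda>w. clift F w - cscale l w) ^^ j) (clift F w) = 0"
proof -
  let ?T = "\<lambda>w. clift F w - cscale l w"
  have comm: "?T (clift F w) = clift F (?T w)" for w
    by (simp add: clift_def cscale_def linear_add[OF F] linear_diff[OF F] linear_scale[OF F])
  have "(?T ^^ j) (clift F w) = clift F ((?T ^^ j) w)"
    by (induction j) (simp_all add: comm)
  moreover have "clift F 0 = 0" by (simp add: clift_def linear_0[OF F] prod_eq_iff)
  ultimately show ?thesis using w by (simp only:)
qed

lemma imaginary_subspace_invariant:
  assumes F: "linear F" and x: "x \<in> imaginary_subspace F"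
  shows "F x \<in> imaginary_subspace F"
proof -
  have gen: "F x \<in> real_gen_eigenspace F l" if "x \<in> real_gen_eigenspace F l" for x l
    using that unfolding real_gen_eigenspace_def
  proof (induction rule: span_induct_alt)
    case base
    then show ?case by (simp add: linear_0[OF F] span_zero)
  next
    case (step c x y)
    then obtain u v j where x: "x \<in> {u, v}" and uv: "((\<lambda>w. clift F w - cscale l w) ^^ j) (u, v) = 0"
      by blast
    have "((\<lambda>w. clift F w - cscale l w) ^^ j) (F u, F v) = 0"
      using clift_invariant[OF F uv] by (simp add: clift_def)
    then have "F x \<in> \<Union>{{u, v} |u v. \<exists>j. ((\<lambda>w. clift F w - cscale l w) ^^ j) (u, v) = 0}"
      using x by blast
    then show ?case
      using step by (simp add: linear_add[OF F] linear_scale[OF F] span_add span_scale span_base)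
  qed
  show ?thesis
    using x unfolding imaginary_subspace_def
  proof (induction rule: span_induct_alt)
    case base
    then show ?case by (simp add: linear_0[OF F] span_zero)
  next
    case (step c x y)
    then have "F x \<in> (\<Union>l\<in>{l. ceigenvalue F l \<and> pure_imaginary l}. real_gen_eigenspace F l)"
      using gen by blast
    then show ?case
      using step by (simp add: linear_add[OF F] linear_scale[OF F] span_add span_scale span_base)
  qed
qed

lemma square_eigenvector_imaginary:
  assumes F: "linear F" and b: "b > 0" and u: "F (F u) = - b *\<^sub>R u"
  shows "u \<in> imaginary_subspace F"
proof (cases "u = 0")
  case True
  then show ?thesis by (simp add: imaginary_subspace_def span_zero)
next
  case False
  define \<beta> where "\<beta> = sqrt b"
  have \<beta>: "\<beta> \<noteq> 0" "\<beta> * \<beta> = b" using b by (auto simp: \<beta>_def)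
  \<comment> \<open>Chosen so that \<open>F u = - \<beta> *\<^sub>R v\<close> and
    \<open>F v = \<beta> *\<^sub>R u\<close>, which makes \<open>(u, v)\<close> an eigenvector to
    \<open>l\<close>.\<close>
  define v where "v = - (1 / \<beta>) *\<^sub>R F u"
  define l where "l = \<i> * complex_of_real \<beta>"
  have eq: "clift F (u, v) = cscale l (u, v)"
    using \<beta> by (simp add: clift_def cscale_def l_def v_def linear_neg[OF F] linear_scale[OF F] u
      field_simps)
  moreover have "(u, v) \<noteq> 0" using False by (simp add: prod_eq_iff)
  ultimately have "ceigenvalue F l" unfolding ceigenvalue_def by blast
  moreover have "pure_imaginary l" unfolding pure_imaginary_def l_def using \<beta> by blast
  moreover have "((\<lambda>w. clift F w - cscale l w) ^^ 1) (u, v) = 0" using eq by simp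
  then have "u \<in> real_gen_eigenspace F l"
    unfolding real_gen_eigenspace_def by (intro span_base) blast
  ultimately show ?thesis unfolding imaginary_subspace_def by (intro span_base) blast
qed

text \<open>On an invariant subspace of the isotropic \<open>V\<close> the energy vanishes, which
  forces \<open>transpose B *v p = 0\<close>, and the field acts as minus the transpose of
  \<open>A\<close>. Iterating, \<open>p\<close> is orthogonal to the columns of all
  \<open>A^i B\<close>, and these span the space.\<close>

lemma controllable_no_invariant:
  fixes \<phi> :: "(real^'n) \<times> (real^'n) \<Rightarrow> 'a::euclidean_space"
    and A Q :: "real^'n^'n" and B :: "real^'r^'n"
  assumes \<omega>: "symplectic_form \<omega>" and H: "quadratic_form H"
    and c: "controllable_in \<omega> H V \<phi> A B Q"
    and D: "subspace D" "D \<subseteq> V" "\<And>x. x \<in> D \<Longrightarrow> hamiltonian_vf \<omega> H x \<in> D"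
  shows "D \<subseteq> {0}"
proof -
  let ?F = "hamiltonian_vf \<omega> H"
  have lin: "linear \<phi>" and om: "\<omega> (\<phi> (p, x)) (\<phi> (p', x')) = p \<bullet> x' - x \<bullet> p'"
    and V: "V = {\<phi> (p, 0) |p. True}"
    and Hphi: "H (\<phi> (p, x)) =
        1/2 * (p \<bullet> ((B ** transpose B) *v p) + 2 * (p \<bullet> (A *v x)) + x \<bullet> (Q *v x))"
    and kal: "kalman_condition A B" for p x p' x'
    using c by (auto simp: controllable_in_def darboux_coords_def inner_vec_def sum_subtractf)
  note polar = hamiltonian_vf_polar[OF \<omega> H]
  have step: "transpose B *v p = 0 \<and> \<phi> (transpose A *v p, 0) \<in> D" if p: "\<phi> (p, 0) \<in> D" for p
  proof -
    obtain q where q: "?F (\<phi> (p, 0)) = \<phi> (q, 0)" using D p V by blast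
    have "0 = \<omega> (\<phi> (p, 0)) (?F (\<phi> (p, 0)))" unfolding q om by simp
    also have "\<dots> = p \<bullet> ((B ** transpose B) *v p)"
      by (simp add: hamiltonian_vf_eq_H[OF \<omega> H] Hphi)
    also have "\<dots> = (transpose B *v p) \<bullet> (transpose B *v p)"
      by (simp add: dot_lmul_matrix flip: matrix_vector_mul_assoc)
    finally have "transpose B *v p = 0" by simp
    moreover have "q = - (transpose A *v p)"
    proof -
      have "(transpose A *v p + q) \<bullet> x = 0" for x
      proof -
        have "- (x \<bullet> q) = \<omega> (\<phi> (0, x)) (?F (\<phi> (p, 0)))" unfolding q om by simp
        also have "\<dots> = H (\<phi> (p, x)) - H (\<phi> (p, 0)) - H (\<phi> (0, x))"
          unfolding polar by (simp flip: linear_add[OF lin])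
        also have "\<dots> = p \<bullet> (A *v x)" by (simp add: Hphi field_simps)
        also have "\<dots> = (transpose A *v p) \<bullet> x" by (simp add: dot_lmul_matrix)
        finally show ?thesis by (simp add: inner_add_left inner_commute[of x])
      qed
      then have "transpose A *v p + q = 0" using inner_eq_zero_iff by blast
      then show ?thesis by (simp add: eq_neg_iff_add_eq_0 add.commute)
    qed
    moreover have "\<phi> (q, 0) \<in> D" using D(3)[OF p] q by simp
    then have "- \<phi> (q, 0) \<in> D" by (rule subspace_neg[OF D(1)])
    then have "\<phi> (- q, 0) \<in> D" by (simp flip: linear_neg[OF lin])
    ultimately show ?thesis by simp
  qed
  show ?thesis
  proof
    fix z assume "z \<in> D"
    then obtain p where p: "z = \<phi> (p, 0)" "\<phi> (p, 0) \<in> D" using V D(2) by blast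
    have iter: "\<phi> (((*v) (transpose A) ^^ i) p, 0) \<in> D" for i
      using p(2) step by (induction i) auto
    have orth: "p \<bullet> ((((\<lambda>M. A ** M) ^^ i) B) *v x) = 0" for i x
    proof -
      have "q \<bullet> ((((\<lambda>M. A ** M) ^^ i) B) *v x) =
          (((*v) (transpose A) ^^ i) q) \<bullet> (B *v x)" for q
      proof (induction i arbitrary: q)
        case (Suc i)
        have "q \<bullet> ((((\<lambda>M. A ** M) ^^ Suc i) B) *v x) =
            (transpose A *v q) \<bullet> ((((\<lambda>M. A ** M) ^^ i) B) *v x)"
          by (simp add: dot_lmul_matrix flip: matrix_vector_mul_assoc)
        also have "\<dots> = (((*v) (transpose A) ^^ i) (transpose A *v q)) \<bullet> (B *v x)" by (rule Suc)
        also have "\<dots> = (((*v) (transpose A) ^^ Suc i) q) \<bullet> (B *v x)"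
          by (simp only: funpow_Suc_right o_apply)
        finally show ?case .
      qed simp
      also have "(((*v) (transpose A) ^^ i) p) \<bullet> (B *v x) =
          (transpose B *v (((*v) (transpose A) ^^ i) p)) \<bullet> x"
        by (simp add: dot_lmul_matrix)
      finally show ?thesis using step[OF iter[of i]] by simp
    qed
    obtain m where "dim (\<Union>i<m. columns (((\<lambda>M. A ** M) ^^ i) B)) = CARD('n)"
      using kal by (auto simp: kalman_condition_def)
    then have "span (\<Union>i<m. columns (((\<lambda>M. A ** M) ^^ i) B)) = UNIV"
      using dim_eq_full[of "\<Union>i<m. columns (((\<lambda>M. A ** M) ^^ i) B)"] by simp
    moreover have "span (\<Union>i<m. columns (((\<lambda>M. A ** M) ^^ i) B)) \<subseteq> {x. p \<bullet> x = 0}"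
    proof (rule span_minimal)
      show "(\<Union>i<m. columns (((\<lambda>M. A ** M) ^^ i) B)) \<subseteq> {x. p \<bullet> x = 0}"
        using orth by (auto simp: columns_def simp flip: matrix_vector_mult_basis)
      show "subspace {x. p \<bullet> x = 0}" by (rule subspace_hyperplane)
    qed
    ultimately have "p \<bullet> p = 0" by blast
    then show "z \<in> {0}" using p(1) linear_0[OF lin] by (simp add: zero_prod_def)
  qed
qed

text \<open>Invariance of \<open>E\<close> gives the value of the field coordinates in
  \<open>\<psi>\<close>; pairing it with the coordinate vectors and polarizing H identifies
  them.\<close>

lemma darboux_coords_F:
  assumes \<omega>: "symplectic_form \<omega>" and H: "quadratic_form H"
    and dar: "darboux_coords \<omega> E \<psi>" and inv: "\<And>x. x \<in> E \<Longrightarrow> hamiltonian_vf \<omega> H x \<in> E"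
    and Hpsi: "\<And>(p :: real^'d) x. H (\<psi> (p, x)) = 1/2 * (\<Sum>j\<in>UNIV. freq j * ((p $ j)\<^sup>2 + (x $ j)\<^sup>2))"
  shows "hamiltonian_vf \<omega> H (\<psi> (p, x)) = \<psi> (- (\<chi> j. freq j * x $ j), \<chi> j. freq j * p $ j)"
proof -
  let ?F = "hamiltonian_vf \<omega> H"
  have lin: "linear \<psi>" and E: "range \<psi> = E"
    and om: "\<And>p x p' x'. \<omega> (\<psi> (p, x)) (\<psi> (p', x')) = p \<bullet> x' - x \<bullet> p'"
    using dar by (auto simp: darboux_coords_def bij_betw_def inner_vec_def sum_subtractf)
  have "\<psi> (p, x) \<in> E" using E by blast
  then have "?F (\<psi> (p, x)) \<in> range \<psi>" unfolding E by (rule inv)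
  then obtain p' x' where F: "?F (\<psi> (p, x)) = \<psi> (p', x')" by auto
  have key: "q \<bullet> x' - y \<bullet> p' = (\<Sum>j\<in>UNIV. freq j * (p $ j * q $ j + x $ j * y $ j))" for q y
  proof -
    have "q \<bullet> x' - y \<bullet> p' = H (\<psi> (p, x) + \<psi> (q, y)) - H (\<psi> (p, x)) - H (\<psi> (q, y))"
      using hamiltonian_vf_polar[OF \<omega> H, of "\<psi> (q, y)" "\<psi> (p, x)"] by (simp add: F om)
    also have "\<psi> (p, x) + \<psi> (q, y) = \<psi> (p + q, x + y)" by (simp flip: linear_add[OF lin])
    also have "H (\<psi> (p + q, x + y)) - H (\<psi> (p, x)) - H (\<psi> (q, y)) =
        (\<Sum>j\<in>UNIV. freq j * (p $ j * q $ j + x $ j * y $ j))"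
      unfolding Hpsi right_diff_distrib[symmetric] sum_subtractf[symmetric] sum_distrib_left
      by (rule sum.cong) (simp_all add: power2_eq_square algebra_simps)
    finally show ?thesis .
  qed
  have ax: "(\<Sum>i\<in>UNIV. freq i * (c $ i * axis j 1 $ i)) = freq j * c $ j" for c :: "real^'d" and j
    by (simp add: axis_def if_distrib[of "\<lambda>a. _ * a"] cong: if_cong)
  have "x' $ j = freq j * p $ j" "p' $ j = - (freq j * x $ j)" for j
    using key[of "axis j 1" 0] key[of 0 "axis j 1"] by (simp_all add: inner_axis' ax)
  then have "x' = (\<chi> j. freq j * p $ j)" "p' = - (\<chi> j. freq j * x $ j)"
    by (simp_all add: vec_eq_iff)
  then show ?thesis using F by simp
qed

lemma jacobi_curve_eq: "jacobi_curve \<omega> H V t = flow (hamiltonian_vf \<omega> H) (- t) ` V"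
  by (simp add: jacobi_curve_def flow_def)

text \<open>If there are infinitely many conjugate times up to \<open>T\<close>, any
  \<open>N\<close> of them contribute at least \<open>N\<close>. So the count may assume finiteness,
  and isolation of conjugate times need not be shown.\<close>

lemma num_conjugate_times_ge:
  fixes N :: nat
  assumes "finite {t \<in> {0<..T}. conj_multiplicity \<omega> H V t \<noteq> 0} \<Longrightarrow>
      N \<le> (\<Sum>t | t \<in> {0<..T} \<and> conj_multiplicity \<omega> H V t \<noteq> 0. conj_multiplicity \<omega> H V t)"
    and zero: "0 \<in> V"
    and conj: "\<And>t. t > 0 \<Longrightarrow> conj_multiplicity \<omega> H V t \<noteq> 0 \<Longrightarrow> conjugate_time \<omega> H V t"
  shows "enat N \<le> num_conjugate_times \<omega> H V T"
proof -
  define C where "C = {t \<in> {0<..T}. conj_multiplicity \<omega> H V t \<noteq> 0}"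
  have C: "C \<subseteq> {t. 0 < t \<and> t \<le> T \<and> conjugate_time \<omega> H V t}" using conj by (auto simp: C_def)
  obtain S where S: "finite S" "S \<subseteq> C" "N \<le> (\<Sum>t\<in>S. conj_multiplicity \<omega> H V t)"
  proof (cases "finite C")
    case True
    then show thesis using that[of C] assms(1) by (simp add: C_def)
  next
    case False
    then obtain S where S: "finite S" "card S = N" "S \<subseteq> C"
      using infinite_arbitrarily_large by blast
    have "card S \<le> (\<Sum>t\<in>S. conj_multiplicity \<omega> H V t)"
      using sum_mono[of S "\<lambda>_. 1" "conj_multiplicity \<omega> H V"] S by (force simp: C_def)
    then show thesis using that S by blast
  qed
  show ?thesis
    unfolding num_conjugate_times_def
    by (rule SUP_upper2[of S]) (use S C in auto)
qed

theorem corollary3p13: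
  fixes \<omega> :: "'a::euclidean_space \<Rightarrow> 'a \<Rightarrow> real"
    and H :: "'a \<Rightarrow> real"
    and V :: "'a set"
    and \<phi> :: "(real^'n) \<times> (real^'n) \<Rightarrow> 'a"
    and A Q :: "real^'n^'n"
    and B :: "real^'r^'n"
    and \<psi> :: "(real^'d) \<times> (real^'d) \<Rightarrow> 'a"
    and freq :: "'d \<Rightarrow> real"
    and n k :: nat
  assumes "DIM('a) = 2 * n"
    and "lq_problem \<omega> H V"
    and "controllable_in \<omega> H V \<phi> A B Q"
    and "cdiagonalizable (hamiltonian_vf \<omega> H)"
    and "\<exists>l. ceigenvalue (hamiltonian_vf \<omega> H) l \<and> pure_imaginary l"
    and "k \<le> n" and "dim (imaginary_subspace (hamiltonian_vf \<omega> H)) = 2 * (n - k)"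
    and "darboux_coords \<omega> (imaginary_subspace (hamiltonian_vf \<omega> H)) \<psi>"
    and "\<forall>p x. H (\<psi> (p, x)) = 1/2 * (\<Sum>j\<in>UNIV. freq j * ((p $ j)\<^sup>2 + (x $ j)\<^sup>2))"
  shows "(\<forall>N::nat. N \<ge> 1 \<longrightarrow>
            (\<forall>T::real. T \<ge> (real N + 4 * real n - 3 * real k - 1) * pi / (\<Sum>j\<in>UNIV. freq j)
               \<longrightarrow> enat N \<le> num_conjugate_times \<omega> H V T))
       \<and> first_conjugate_time \<omega> H V
            \<le> ereal ((4 * real n - 3 * real k) * pi / (\<Sum>j\<in>UNIV. freq j))"
proof -
  define F where "F = hamiltonian_vf \<omega> H"
  have \<omega>: "symplectic_form \<omega>" and H: "quadratic_form H" and lag: "lagrangian \<omega> V"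
    and nonneg: "\<And>v. v \<in> V \<Longrightarrow> H v \<ge> 0"
    using assms(2) by (auto simp: lq_problem_def)
  interpret hamiltonian_field \<omega> F
    unfolding F_def by (rule hamiltonian_field_hamiltonian_vf[OF \<omega> H])
  note dar = assms(8)[folded F_def]
  have range: "range \<psi> = imaginary_subspace F" and inj: "inj \<psi>" and lin: "linear \<psi>"
    and om: "\<omega> (\<psi> (p, x)) (\<psi> (p', x')) = p \<bullet> x' - x \<bullet> p'" for p x p' x'
    using dar by (auto simp: darboux_coords_def bij_betw_def inner_vec_def sum_subtractf)
  have Fpsi: "F (\<psi> (p, x)) = \<psi> (- (\<chi> j. freq j * x $ j), \<chi> j. freq j * p $ j)" for p x
    unfolding F_def
    by (rule darboux_coords_F[OF \<omega> H assms(8)])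
      (use imaginary_subspace_invariant[OF linear_F] assms(9) in \<open>auto simp: F_def\<close>)
  interpret lq_normal_form \<omega> F V \<psi> freq
  proof
    show "subspace V" using lag by (simp add: lagrangian_def)
    show "V = skew_compl V" using lag unfolding lagrangian_def skew_compl_def by blast
    show "0 \<le> \<omega> z (F z)" if "z \<in> V" for z
      using nonneg[OF that] by (simp add: F_def hamiltonian_vf_eq_H[OF \<omega> H])
    show "D \<subseteq> {0}" if "subspace D" "D \<subseteq> V" "\<And>x. x \<in> D \<Longrightarrow> F x \<in> D" for D
      using controllable_no_invariant[OF \<omega> H assms(3) that(1,2)] that(3) by (simp add: F_def)
    show "u \<in> range \<psi>" if "b > 0" "F (F u) = - b *\<^sub>R u" for b u
      unfolding range by (rule square_eigenvector_imaginary[OF linear_F that])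
  qed (simp_all add: linear_add[OF lin] linear_scale[OF lin] inj om Fpsi)
  obtain L where L: "subspace L" "L \<subseteq> skew_compl (range \<psi>)" "\<And>x. x \<in> L \<Longrightarrow> F x \<in> L" "isotropic L"
    "2 * (dim L + CARD('d)) = DIM('a)" "V \<inter> L \<subseteq> {0}"
    using lagrangian_complement_exists by blast
  interpret lq_split \<omega> F V \<psi> freq L by unfold_locales (fact L)+
  obtain \<theta> where \<theta>: "\<And>r. ray \<theta> r \<in> M \<Longrightarrow> r = 0" using transversal_angle by blast
  interpret lq_reference \<omega> F V \<psi> freq L \<theta> by unfold_locales (rule \<theta>)
  have m: "CARD('d) = n - k"
    using dim_range assms(7) by (simp add: range F_def)
  have kL: "dim L = k" using L(5) m assms(1,6) by arith
  define s where "s = (\<Sum>j\<in>UNIV. freq j)"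
  have s: "s > 0" unfolding s_def by (rule freq_sum_pos)
  have inter: "jacobi_curve \<omega> H V t \<inter> V = {u \<in> V. flow F t u \<in> V}" for t
  proof safe
    fix u assume "u \<in> jacobi_curve \<omega> H V t" "u \<in> V"
    then obtain v where "v \<in> V" "u = flow F (- t) v" by (auto simp: jacobi_curve_eq F_def)
    then show "flow F t u \<in> V" by (simp add: flow_flow_minus[OF linear_F])
  next
    fix u assume "u \<in> V" "flow F t u \<in> V"
    then show "u \<in> jacobi_curve \<omega> H V t"
      unfolding jacobi_curve_eq F_def[symmetric]
      by (intro image_eqI[of _ _ "flow F t u"]) (simp_all add: flow_minus_flow[OF linear_F])
  qed
  then have mult: "conj_multiplicity \<omega> H V t = conj_dim t" for t
    by (simp add: conj_multiplicity_def conj_dim_def)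
  have conj: "conjugate_time \<omega> H V t" if "t > 0" "conj_multiplicity \<omega> H V t \<noteq> 0" for t
    using that dim_eq_0[of "jacobi_curve \<omega> H V t \<inter> V"]
    by (auto simp: conjugate_time_def conj_multiplicity_def)
  have main: "enat N \<le> num_conjugate_times \<omega> H V T"
    if N: "N \<ge> 1" and T: "T \<ge> (real N + 4 * real n - 3 * real k - 1) * pi / s" for N :: nat and T
  proof (rule num_conjugate_times_ge[OF _ subspace_0[OF subspace_V] conj])
    have m1: "real CARD('d) \<ge> 1" using zero_less_card_finite[where 'a = 'd] by linarith
    have e: "real N + 4 * real n - 3 * real k - 1 = real N + 4 * real CARD('d) + real k - 1"
      using m assms(6) by (simp add: of_nat_diff)
    have pos: "real N + 4 * real n - 3 * real k - 1 > 0" unfolding e using N m1 by linarith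
    have "0 < (real N + 4 * real n - 3 * real k - 1) * pi / s"
      using pos s by (intro divide_pos_pos mult_pos_pos) auto
    then have T0: "T > 0" using T by linarith
    assume "finite {t \<in> {0<..T}. conj_multiplicity \<omega> H V t \<noteq> 0}"
    then have "T * s / pi - 3 * real CARD('d) - real (dim L)
        < real (\<Sum>t | t \<in> {0<..T} \<and> conj_dim t \<noteq> 0. conj_dim t)"
      using conj_dim_sum[OF T0] by (simp only: mult s_def)
    moreover have "real N + 4 * real n - 3 * real k - 1 \<le> T * s / pi"
      using T s by (simp add: field_simps)
    \<comment> \<open>\<open>T * s / pi\<close> exceeds \<open>3 * CARD('d) + k\<close> by at least
      \<open>N + CARD('d) - 1\<close>, which is at least \<open>N\<close>.\<close>
    ultimately have "real N < real (\<Sum>t | t \<in> {0<..T} \<and> conj_dim t \<noteq> 0. conj_dim t)"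
      unfolding e kL using m1 by linarith
    then show "N \<le> (\<Sum>t | t \<in> {0<..T} \<and> conj_multiplicity \<omega> H V t \<noteq> 0. conj_multiplicity \<omega> H V t)"
      unfolding mult by linarith
  qed
  have first: "first_conjugate_time \<omega> H V \<le> ereal ((4 * real n - 3 * real k) * pi / s)"
  proof -
    define T where "T = (4 * real n - 3 * real k) * pi / s"
    \<comment> \<open>For \<open>N = 1\<close> the threshold is exactly this \<open>T\<close>. A
      positive supremum needs a nonempty set of conjugate times, any element of which bounds the
      infimum.\<close>
    have "enat 1 \<le> num_conjugate_times \<omega> H V T" by (rule main) (simp_all add: T_def)
    moreover have "0 < enat 1" by (simp add: zero_enat_def)
    ultimately have "0 < num_conjugate_times \<omega> H V T" by (rule order.strict_trans2[rotated])
    then obtain S where S: "S \<subseteq> {t. 0 < t \<and> t \<le> T \<and> conjugate_time \<omega> H V t}"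
      "0 < enat (\<Sum>t\<in>S. conj_multiplicity \<omega> H V t)"
      unfolding num_conjugate_times_def less_SUP_iff by blast
    then have "S \<noteq> {}" by (auto simp: zero_enat_def)
    then obtain t where t: "0 < t" "t \<le> T" "conjugate_time \<omega> H V t" using S by blast
    then have "first_conjugate_time \<omega> H V \<le> ereal t"
      unfolding first_conjugate_time_def by (intro INF_lower) auto
    also have "\<dots> \<le> ereal T" using t by simp
    finally show ?thesis by (simp add: T_def)
  qed
  show ?thesis using main first unfolding s_def by blast
qed

end
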